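(* For all integers $d \geq 5$, $\dim \mathcal{S}(d,6) = \binom{d+2}{2}-4$.
   Context: Let $k$ be an algebraically closed field and $S = k[x_0,x_1,x_2]$, with $\mathbb{P}S_d$ the projective space of plane curves of degree $d$. For $l \geq 2$, let $\mathcal{D}_l \subseteq (\check{\mathbb{P}}^2)^l$ be the quasi-projective variety of $l$-tuples of distinct lines in $\mathbb{P}^2$ no three of which pass through a common point; the star configuration $\mathbb{X}(l)$ of such a tuple is the set of its $\binom{l}{2}$ pairwise intersection points. $\mathcal{S}(d,l)\subseteq \mathbb{P}S_d$ denotes the set of degree-$d$ plane curves containing the star configuration of some tuple in $\mathcal{D}_l$ (the image of the incidence correspondence $\{(\mathcal{C},(\ell_i)) : \mathcal{C}\supseteq \mathbb{X}(l)\}$ under projection to $\mathbb{P}S_d$), and its dimension is that of its Zariski closure. *)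

theory Defs
  imports "HOL-Computational_Algebra.Polynomial"
begin

definition alg_closed :: "'k::field itself \<Rightarrow> bool" where
  "alg_closed _ \<longleftrightarrow> (\<forall>p::'k poly. degree p > 0 \<longrightarrow> (\<exists>x. poly p x = 0))"

text \<open>Vectors with coordinates indexed by I are functions vanishing outside I.
  A point of the projective space P(k^I) is represented by a nonzero vector;
  subsets of projective space are represented by scaling-invariant sets of
  nonzero vectors.\<close>

definition pts :: "'i set \<Rightarrow> ('i \<Rightarrow> 'k::field) set" where
  "pts I = {x. (\<forall>i. i \<notin> I \<longrightarrow> x i = 0) \<and> x \<noteq> (\<lambda>_. 0)}"

definition hom_poly :: "'i set \<Rightarrow> (('i \<Rightarrow> 'k::field) \<Rightarrow> 'k) \<Rightarrow> bool" where
  "hom_poly I p \<longleftrightarrow> (\<exists>(A :: ('i \<Rightarrow> nat) set) (e::nat) (c :: ('i \<Rightarrow> nat) \<Rightarrow> 'k).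
      finite A \<and> (\<forall>\<alpha>\<in>A. (\<forall>i. i \<notin> I \<longrightarrow> \<alpha> i = 0) \<and> sum \<alpha> I = e) \<and>
      p = (\<lambda>x. \<Sum>\<alpha>\<in>A. c \<alpha> * (\<Prod>i\<in>I. x i ^ \<alpha> i)))"

definition proj_closed :: "'i set \<Rightarrow> ('i \<Rightarrow> 'k::field) set \<Rightarrow> bool" where
  "proj_closed I Z \<longleftrightarrow> (\<exists>P. (\<forall>p\<in>P. hom_poly I p) \<and> Z = {x \<in> pts I. \<forall>p\<in>P. p x = 0})"

definition proj_irreducible :: "'i set \<Rightarrow> ('i \<Rightarrow> 'k::field) set \<Rightarrow> bool" where
  "proj_irreducible I Z \<longleftrightarrow> proj_closed I Z \<and> Z \<noteq> {} \<and>
     \<not> (\<exists>Z1 Z2. proj_closed I Z1 \<and> proj_closed I Z2 \<and> Z = Z1 \<union> Z2 \<and> Z1 \<noteq> Z \<and> Z2 \<noteq> Z)"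

definition proj_closure :: "'i set \<Rightarrow> ('i \<Rightarrow> 'k::field) set \<Rightarrow> ('i \<Rightarrow> 'k) set" where
  "proj_closure I X = \<Inter> {Z. proj_closed I Z \<and> X \<subseteq> Z}"

definition proj_dim :: "'i set \<Rightarrow> ('i \<Rightarrow> 'k::field) set \<Rightarrow> nat" where
  "proj_dim I X = (GREATEST n. \<exists>Z :: nat \<Rightarrow> ('i \<Rightarrow> 'k) set.
       (\<forall>j\<le>n. proj_irreducible I (Z j)) \<and> (\<forall>j<n. Z j \<subset> Z (Suc j)) \<and> Z n \<subseteq> proj_closure I X)"

definition Mon :: "nat \<Rightarrow> (nat \<times> nat \<times> nat) set" where
  "Mon d = {(a, b, c). a + b + c = d}"

definition evalF :: "nat \<Rightarrow> (nat \<times> nat \<times> nat \<Rightarrow> 'k::field) \<Rightarrow> 'k \<times> 'k \<times> 'k \<Rightarrow> 'k" where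
  "evalF d F q = (case q of (q0, q1, q2) \<Rightarrow>
     (\<Sum>m\<in>Mon d. case m of (a, b, c) \<Rightarrow> F (a, b, c) * q0 ^ a * q1 ^ b * q2 ^ c))"

definition dot3 :: "'k::field \<times> 'k \<times> 'k \<Rightarrow> 'k \<times> 'k \<times> 'k \<Rightarrow> 'k" where
  "dot3 u v = (case u of (u0, u1, u2) \<Rightarrow> case v of (v0, v1, v2) \<Rightarrow> u0 * v0 + u1 * v1 + u2 * v2)"

definition smult3 :: "'k::field \<Rightarrow> 'k \<times> 'k \<times> 'k \<Rightarrow> 'k \<times> 'k \<times> 'k" where
  "smult3 t u = (case u of (u0, u1, u2) \<Rightarrow> (t * u0, t * u1, t * u2))"

text \<open>A line a0 x0 + a1 x1 + a2 x2 = 0 is given by a nonzero vector (a0,a1,a2) (up to scaling);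
  a point of P^2 by a nonzero vector q; incidence is dot3 a q = 0.
  D l: l-tuples of pairwise distinct lines, no three through a common point.\<close>
definition D :: "nat \<Rightarrow> (nat \<Rightarrow> 'k::field \<times> 'k \<times> 'k) set" where
  "D l = {L. (\<forall>i<l. L i \<noteq> (0, 0, 0)) \<and>
           (\<forall>i<l. \<forall>j<l. i \<noteq> j \<longrightarrow> \<not> (\<exists>t. L i = smult3 t (L j))) \<and>
           (\<forall>i<l. \<forall>j<l. \<forall>k<l. i \<noteq> j \<and> j \<noteq> k \<and> i \<noteq> k \<longrightarrow>
              \<not> (\<exists>q. q \<noteq> (0, 0, 0) \<and> dot3 (L i) q = 0 \<and> dot3 (L j) q = 0 \<and> dot3 (L k) q = 0))}"

definition star :: "nat \<Rightarrow> (nat \<Rightarrow> 'k::field \<times> 'k \<times> 'k) \<Rightarrow> ('k \<times> 'k \<times> 'k) set" where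
  "star l L = {q. q \<noteq> (0, 0, 0) \<and> (\<exists>i<l. \<exists>j<l. i \<noteq> j \<and> dot3 (L i) q = 0 \<and> dot3 (L j) q = 0)}"

definition S :: "nat \<Rightarrow> nat \<Rightarrow> (nat \<times> nat \<times> nat \<Rightarrow> 'k::field) set" where
  "S d l = {F \<in> pts (Mon d). \<exists>L \<in> D l. \<forall>q \<in> star l L. evalF d F q = 0}"

end

(* For the upper bound, a curve through the star configuration of six lines L_i is a combination
   sum_i a_i prod_(j ~= i) L_j, and after normalising the L_i and the multipliers a_i such curves depend
   on binom(d+2,2) - 3 affine parameters; each strict inclusion of irreducible closed cones raises the
   transcendence degree by one. For the lower bound, take the closures of the images of a flag of linear
   subspaces of the parameter space through a suitable base point. The inclusions are strict because the
   parametrisation is immersive there: evaluating a tangent vector at the 15 points of the configuration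
   gives linear equations in the moving lines, and for a suitable choice of lines these have only the
   trivial solution. In characteristic 2 and for equal multipliers, translating all lines by one linear
   form is invisible to first order, so the second-order terms of these three directions are used. *)

theory Submission
  imports Defs
begin

section \<open>Polynomial functions\<close>

text \<open>The value is the expected one: fifteen points impose independent conditions on curves of
  degree \<open>d\<close>, six lines move in a family of dimension 12, and one is lost to scaling.
  What has to be shown is that the parametrisation is generically finite. For \<open>d = 5\<close>
  the multipliers are constants and, if nonzero, can be absorbed into scalars of the lines, so they
  may always be taken equal. In characteristic 2 the differential then has a kernel of dimension at
  least 3 at every such point: the parametrisation is inseparable, and no base point makes it
  immersive. This forces the tangent argument to run along curves that leave the base point at order
  \<open>s^2\<close>: translations move at speed \<open>s\<close>, everything else at speed
  \<open>s^2\<close>, and square roots of the parameters make the second-order term linear in them.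
  No general dimension theory enters; both bounds rest on one count, that more polynomials than
  variables are algebraically dependent.\<close>

inductive_set polyfun :: "'i set \<Rightarrow> (('i \<Rightarrow> 'k::field) \<Rightarrow> 'k) set" for I where
  const: "(\<lambda>_. c) \<in> polyfun I"
| var: "i \<in> I \<Longrightarrow> (\<lambda>x. x i) \<in> polyfun I"
| add: "f \<in> polyfun I \<Longrightarrow> g \<in> polyfun I \<Longrightarrow> (\<lambda>x. f x + g x) \<in> polyfun I"
| mult: "f \<in> polyfun I \<Longrightarrow> g \<in> polyfun I \<Longrightarrow> (\<lambda>x. f x * g x) \<in> polyfun I"

lemma polyfun_sum:
  "(\<And>a. a \<in> A \<Longrightarrow> f a \<in> polyfun I) \<Longrightarrow> (\<lambda>x. \<Sum>a\<in>A. f a x) \<in> polyfun I"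
  by (induction A rule: infinite_finite_induct) (auto intro: polyfun.intros)

lemma polyfun_prod:
  "(\<And>a. a \<in> A \<Longrightarrow> f a \<in> polyfun I) \<Longrightarrow> (\<lambda>x. \<Prod>a\<in>A. f a x) \<in> polyfun I"
  by (induction A rule: infinite_finite_induct) (auto intro: polyfun.intros)

lemma polyfun_power: "f \<in> polyfun I \<Longrightarrow> (\<lambda>x. f x ^ n) \<in> polyfun I"
  by (induction n) (auto intro: polyfun.intros)

lemma polyfun_diff:
  assumes "f \<in> polyfun I" "g \<in> polyfun I"
  shows "(\<lambda>x. f x - g x) \<in> polyfun I"
  using polyfun.add[OF assms(1) polyfun.mult[OF polyfun.const[of "-1"] assms(2)]] by simp

lemma polyfun_cong: "f \<in> polyfun I \<Longrightarrow> (\<And>i. i \<in> I \<Longrightarrow> x i = y i) \<Longrightarrow> f x = f y"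
  by (induction rule: polyfun.induct) auto

lemma polyfun_mono: "f \<in> polyfun I \<Longrightarrow> I \<subseteq> J \<Longrightarrow> f \<in> polyfun J"
  by (induction rule: polyfun.induct) (auto intro: polyfun.intros)

lemma polyfun_compose:
  "f \<in> polyfun I \<Longrightarrow> (\<And>i. i \<in> I \<Longrightarrow> (\<lambda>t. g t i) \<in> polyfun J) \<Longrightarrow> (\<lambda>t. f (g t)) \<in> polyfun J"
  by (induction rule: polyfun.induct) (auto intro: polyfun.intros)

text \<open>Along a curve with polynomial coordinates everything becomes univariate. Polynomials are
  treated as functions, which loses nothing over an infinite field, and identities between them are
  tested on such curves by counting roots.\<close>

lemma polyfun_poly:
  "f \<in> polyfun I \<Longrightarrow> (\<And>i. i \<in> I \<Longrightarrow> \<exists>p. \<forall>s. g s i = poly p s) \<Longrightarrow> \<exists>p. \<forall>s. f (g s) = poly p s"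
proof (induction rule: polyfun.induct)
  case (const c)
  show ?case by (rule exI[of _ "[:c:]"]) simp
next
  case (var i)
  then show ?case by auto
next
  case (add f h)
  then obtain p q where "\<forall>s. f (g s) = poly p s" "\<forall>s. h (g s) = poly q s" by blast
  then show ?case by (intro exI[of _ "p + q"]) simp
next
  case (mult f h)
  then obtain p q where "\<forall>s. f (g s) = poly p s" "\<forall>s. h (g s) = poly q s" by blast
  then show ?case by (intro exI[of _ "p * q"]) simp
qed

lemma poly_eq_0_cofinite:
  fixes p :: "'k::field poly"
  assumes inf: "infinite (UNIV :: 'k set)" and fin: "finite B" and z: "\<And>s. s \<notin> B \<Longrightarrow> poly p s = 0"
  shows "p = 0"
proof (rule ccontr)
  assume "p \<noteq> 0"
  then have "finite {s. poly p s = 0}" by (rule poly_roots_finite)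
  moreover have "UNIV \<subseteq> B \<union> {s. poly p s = 0}" using z by auto
  ultimately show False using fin inf by (meson finite_Un finite_subset)
qed

text \<open>A point where \<open>f\<close> is nonzero is joined by a line to one where
  \<open>g\<close> is nonzero; on this line both restrict to nonzero univariate polynomials, whose
  product cannot vanish.\<close>

lemma polyfun_mult_eq_0:
  fixes f g :: "('i \<Rightarrow> 'k::field) \<Rightarrow> 'k"
  assumes inf: "infinite (UNIV :: 'k set)" and f: "f \<in> polyfun I" and g: "g \<in> polyfun I"
    and z: "\<And>t. f t * g t = 0"
  shows "(\<forall>t. f t = 0) \<or> (\<forall>t. g t = 0)"
proof (rule ccontr)
  assume "\<not> ?thesis"
  then obtain t u where t: "f t \<noteq> 0" and u: "g u \<noteq> 0" by auto
  define line where "line s i = t i + s * (u i - t i)" for s i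
  have line: "\<exists>p. \<forall>s. line s i = poly p s" for i
    by (rule exI[of _ "[:t i, u i - t i:]"]) (simp add: line_def)
  obtain p where p: "\<forall>s. f (line s) = poly p s"
    using polyfun_poly[where g = line, OF f line] by blast
  obtain q where q: "\<forall>s. g (line s) = poly q s"
    using polyfun_poly[where g = line, OF g line] by blast
  have "line 0 = t" "line 1 = u" by (auto simp: line_def)
  then have "p \<noteq> 0" "q \<noteq> 0" using p q t u by auto
  moreover have "p * q = 0"
    by (rule poly_eq_0_cofinite[OF inf, of "{}"]) (use p q z in \<open>auto simp flip: p[rule_format] q[rule_format]\<close>)
  ultimately show False by simp
qed

section \<open>Monomial expansions with bounded exponents\<close>

definition monom_on :: "'i set \<Rightarrow> ('i \<Rightarrow> nat) \<Rightarrow> ('i \<Rightarrow> 'k::field) \<Rightarrow> 'k" where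
  "monom_on I \<alpha> x = (\<Prod>i\<in>I. x i ^ \<alpha> i)"

text \<open>Bounding each exponent separately, instead of the total degree, makes the number of
  monomials an exact power and lets inductions add one variable at a time.\<close>

definition Box :: "'i set \<Rightarrow> nat \<Rightarrow> ('i \<Rightarrow> nat) set" where
  "Box I K = {\<alpha>. \<forall>i. \<alpha> i \<le> (if i \<in> I then K else 0)}"

lemma monom_on_polyfun: "monom_on I \<alpha> \<in> polyfun I"
proof -
  have "(\<lambda>x. \<Prod>i\<in>I. x i ^ \<alpha> i) \<in> polyfun I"
    by (intro polyfun_prod polyfun_power polyfun.var)
  then show ?thesis by (simp add: monom_on_def[abs_def])
qed

lemma monom_on_add: "monom_on I (\<lambda>i. \<alpha> i + \<beta> i) x = monom_on I \<alpha> x * monom_on I \<beta> x"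
  by (simp add: monom_on_def power_add prod.distrib)

lemma Box_empty [simp]: "Box {} K = {\<lambda>_. 0}"
  by (auto simp: Box_def)

lemma bij_betw_Box_insert:
  assumes "a \<notin> I"
  shows "bij_betw (\<lambda>(e, \<beta>). \<beta>(a := e)) ({..K} \<times> Box I K) (Box (insert a I) K)"
proof (rule bij_betw_byWitness[where f' = "\<lambda>\<alpha>. (\<alpha> a, \<alpha>(a := 0))"])
  have "\<beta> a = 0" if "\<beta> \<in> Box I K" for \<beta>
    using that assms by (simp add: Box_def) (metis le_zero_eq)
  then show "\<forall>x\<in>{..K} \<times> Box I K. (\<lambda>\<alpha>. (\<alpha> a, \<alpha>(a := 0))) ((\<lambda>(e, \<beta>). \<beta>(a := e)) x) = x"
    by (auto simp: fun_eq_iff)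
  show "(\<lambda>(e, \<beta>). \<beta>(a := e)) ` ({..K} \<times> Box I K) \<subseteq> Box (insert a I) K"
    by (auto simp: Box_def)
  show "(\<lambda>\<alpha>. (\<alpha> a, \<alpha>(a := 0))) ` Box (insert a I) K \<subseteq> {..K} \<times> Box I K"
    using assms by (auto simp: Box_def split: if_splits)
qed auto

lemma finite_card_Box:
  assumes "finite I"
  shows "finite (Box I K) \<and> card (Box I K) = (K + 1) ^ card I"
  using assms
proof (induction I)
  case (insert a I)
  note b = bij_betw_Box_insert[OF \<open>a \<notin> I\<close>, of K]
  have fin: "finite ({..K} \<times> Box I K)" using insert.IH by auto
  have "card ({..K} \<times> Box I K) = (K + 1) * (K + 1) ^ card I"
    using insert.IH by (simp only: card_cartesian_product card_atMost Suc_eq_plus1)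
  also have "\<dots> = (K + 1) ^ card (insert a I)"
    using insert.hyps by simp
  finally have "card (Box (insert a I) K) = (K + 1) ^ card (insert a I)"
    using bij_betw_same_card[OF b] by (rule trans[OF sym, rotated])
  moreover have "finite (Box (insert a I) K)" using bij_betw_finite[OF b] fin by (rule iffD1)
  ultimately show ?case by (rule conjI[rotated])
qed auto

lemma sum_Box_insert:
  assumes "finite I" "a \<notin> I"
  shows "(\<Sum>\<alpha>\<in>Box (insert a I) K. c \<alpha> * monom_on (insert a I) \<alpha> x)
    = (\<Sum>e\<le>K. (\<Sum>\<beta>\<in>Box I K. c (\<beta>(a := e)) * monom_on I \<beta> x) * x a ^ e)"
proof -
  have "(\<Prod>i\<in>I. x i ^ (\<beta>(a := e)) i) = (\<Prod>i\<in>I. x i ^ \<beta> i)" for \<beta> e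
    using assms by (intro prod.cong) auto
  then have m: "monom_on (insert a I) (\<beta>(a := e)) x = x a ^ e * monom_on I \<beta> x" for \<beta> e
    using assms by (simp add: monom_on_def)
  have "(\<Sum>\<alpha>\<in>Box (insert a I) K. c \<alpha> * monom_on (insert a I) \<alpha> x)
     = (\<Sum>(e, \<beta>)\<in>{..K} \<times> Box I K. c (\<beta>(a := e)) * monom_on (insert a I) (\<beta>(a := e)) x)"
    using sum.reindex_bij_betw[OF bij_betw_Box_insert[OF assms(2), of K],
        of "\<lambda>\<alpha>. c \<alpha> * monom_on (insert a I) \<alpha> x"]
    by (simp add: case_prod_unfold)
  also have "\<dots> = (\<Sum>e\<le>K. \<Sum>\<beta>\<in>Box I K. c (\<beta>(a := e)) * monom_on (insert a I) (\<beta>(a := e)) x)"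
    by (simp add: sum.cartesian_product)
  finally show ?thesis
    by (simp add: m sum_distrib_left mult_ac)
qed

lemma sum_Box_extend:
  assumes "finite I" "K \<le> E"
  shows "(\<Sum>\<alpha>\<in>Box I K. c \<alpha> * monom_on I \<alpha> x)
    = (\<Sum>\<alpha>\<in>Box I E. (if \<alpha> \<in> Box I K then c \<alpha> else 0) * monom_on I \<alpha> x)"
proof -
  have "Box I K \<subseteq> Box I E" using assms(2) by (auto simp: Box_def intro: order_trans)
  then show ?thesis
    using finite_card_Box[OF assms(1), of E] by (intro sum.mono_neutral_cong_left) auto
qed

lemma monomial_expansion_mult:
  assumes "finite I"
  shows "\<exists>c. \<forall>x. (\<Sum>\<alpha>\<in>Box I K. a \<alpha> * monom_on I \<alpha> x) * (\<Sum>\<alpha>\<in>Box I E. b \<alpha> * monom_on I \<alpha> x)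
    = (\<Sum>\<alpha>\<in>Box I (K + E). c \<alpha> * monom_on I \<alpha> x)"
proof -
  let ?P = "Box I K \<times> Box I E"
  define s where "s p = (\<lambda>i. fst p i + snd p i)" for p :: "('a \<Rightarrow> nat) \<times> ('a \<Rightarrow> nat)"
  define c where "c \<gamma> = (\<Sum>p\<in>{p \<in> ?P. s p = \<gamma>}. a (fst p) * b (snd p))" for \<gamma>
  have fin: "finite ?P" "finite (Box I (K + E))"
    using finite_card_Box[OF assms] by auto
  have sub: "s ` ?P \<subseteq> Box I (K + E)"
    by (force simp: s_def Box_def intro: add_mono split: if_splits)
  have "(\<Sum>\<alpha>\<in>Box I K. a \<alpha> * monom_on I \<alpha> x) * (\<Sum>\<alpha>\<in>Box I E. b \<alpha> * monom_on I \<alpha> x)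
    = (\<Sum>\<gamma>\<in>Box I (K + E). c \<gamma> * monom_on I \<gamma> x)" for x
  proof -
    have "(\<Sum>\<alpha>\<in>Box I K. a \<alpha> * monom_on I \<alpha> x) * (\<Sum>\<alpha>\<in>Box I E. b \<alpha> * monom_on I \<alpha> x)
      = (\<Sum>p\<in>?P. a (fst p) * b (snd p) * monom_on I (s p) x)"
      unfolding sum_product sum.cartesian_product
      by (intro sum.cong) (auto simp: s_def monom_on_add)
    also have "\<dots> = (\<Sum>\<gamma>\<in>Box I (K + E). \<Sum>p\<in>{p \<in> ?P. s p = \<gamma>}. a (fst p) * b (snd p) * monom_on I (s p) x)"
      by (rule sum.group[OF fin sub, symmetric])
    also have "\<dots> = (\<Sum>\<gamma>\<in>Box I (K + E). c \<gamma> * monom_on I \<gamma> x)"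
      by (intro sum.cong refl) (simp add: c_def sum_distrib_right)
    finally show ?thesis .
  qed
  then show ?thesis by blast
qed

lemma polyfun_monomial_expansion:
  assumes "f \<in> polyfun I" and fin: "finite I"
  shows "\<exists>K c. \<forall>x. f x = (\<Sum>\<alpha>\<in>Box I K. c \<alpha> * monom_on I \<alpha> x)"
  using assms(1)
proof (induction rule: polyfun.induct)
  case (const c)
  have "Box I 0 = {\<lambda>_. 0}" by (auto simp: Box_def split: if_splits)
  then show ?case
    by (intro exI[of _ 0] exI[of _ "\<lambda>_. c"]) (simp add: monom_on_def)
next
  case (var i)
  define \<delta> :: "'a \<Rightarrow> nat" where "\<delta> = (\<lambda>j. if j = i then 1 else 0)"
  have d: "\<delta> \<in> Box I 1" using var by (auto simp: \<delta>_def Box_def)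
  have "x i = (\<Sum>\<alpha>\<in>Box I 1. (if \<alpha> = \<delta> then 1 else 0) * monom_on I \<alpha> x)" for x :: "'a \<Rightarrow> 'b"
  proof -
    have "(\<Sum>\<alpha>\<in>Box I 1. (if \<alpha> = \<delta> then 1 else 0) * monom_on I \<alpha> x)
      = (\<Sum>\<alpha>\<in>Box I 1. if \<alpha> = \<delta> then monom_on I \<alpha> x else 0)"
      by (intro sum.cong) auto
    also have "\<dots> = monom_on I \<delta> x"
      using d finite_card_Box[OF fin, of 1] by simp
    also have "\<dots> = (\<Prod>j\<in>I. if j = i then x j else 1)"
      unfolding monom_on_def \<delta>_def by (intro prod.cong) auto
    also have "\<dots> = x i" using var fin by simp
    finally show ?thesis by simp
  qed
  then show ?case by (intro exI allI)
next
  case (add f g)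
  then obtain K c E e where f: "\<forall>x. f x = (\<Sum>\<alpha>\<in>Box I K. c \<alpha> * monom_on I \<alpha> x)"
    and g: "\<forall>x. g x = (\<Sum>\<alpha>\<in>Box I E. e \<alpha> * monom_on I \<alpha> x)" by blast
  show ?case
    by (rule exI[of _ "max K E"], rule exI[of _ "\<lambda>\<alpha>. (if \<alpha> \<in> Box I K then c \<alpha> else 0)
          + (if \<alpha> \<in> Box I E then e \<alpha> else 0)"])
      (simp add: f g sum_Box_extend[OF fin, of K "max K E"] sum_Box_extend[OF fin, of E "max K E"]
        distrib_right sum.distrib)
next
  case (mult f g)
  then obtain K c E e where f: "\<forall>x. f x = (\<Sum>\<alpha>\<in>Box I K. c \<alpha> * monom_on I \<alpha> x)"
    and g: "\<forall>x. g x = (\<Sum>\<alpha>\<in>Box I E. e \<alpha> * monom_on I \<alpha> x)" by blast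
  show ?case
    unfolding f[rule_format] g[rule_format]
    using monomial_expansion_mult[OF fin] by blast
qed

text \<open>Varying one coordinate alone turns the sum into a univariate polynomial without nonzero
  coefficients; these coefficients are expansions in the remaining variables.\<close>

lemma monomial_expansion_coeff_0:
  fixes c :: "('i \<Rightarrow> nat) \<Rightarrow> 'k::field"
  assumes inf: "infinite (UNIV :: 'k set)" and "finite I"
    and "\<And>x. (\<Sum>\<alpha>\<in>Box I K. c \<alpha> * monom_on I \<alpha> x) = 0" and "\<alpha> \<in> Box I K"
  shows "c \<alpha> = 0"
  using assms(2-)
proof (induction I arbitrary: c \<alpha>)
  case empty
  then show ?case by (simp add: monom_on_def)
next
  case (insert a I)
  have *: "(\<Sum>\<beta>\<in>Box I K. c (\<beta>(a := e)) * monom_on I \<beta> x) = 0" if "e \<le> K" for e x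
  proof -
    define T where "T e = (\<Sum>\<beta>\<in>Box I K. c (\<beta>(a := e)) * monom_on I \<beta> x)" for e
    define p where "p = (\<Sum>e\<le>K. monom (T e) e)"
    have Sx: "(\<Sum>\<beta>\<in>Box I K. c (\<beta>(a := e)) * monom_on I \<beta> (x(a := s))) = T e" for e s
    proof -
      have "monom_on I \<beta> (x(a := s)) = monom_on I \<beta> x" for \<beta>
        unfolding monom_on_def using insert.hyps by (intro prod.cong) auto
      then show ?thesis by (simp add: T_def)
    qed
    have "poly p s = 0" for s
      using insert.prems(1)[of "x(a := s)"]
      unfolding sum_Box_insert[OF insert.hyps] Sx
      by (simp add: p_def poly_sum poly_monom)
    then have "p = 0" by (intro poly_eq_0_cofinite[OF inf, of "{}"]) auto
    then have "coeff p e = 0" by simp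
    then show ?thesis
      using that by (simp add: p_def coeff_sum T_def)
  qed
  have "\<alpha> \<in> (\<lambda>(e, \<beta>). \<beta>(a := e)) ` ({..K} \<times> Box I K)"
    using bij_betw_imp_surj_on[OF bij_betw_Box_insert[OF insert.hyps(2), of K]] insert.prems(2) by simp
  then obtain e \<beta> where "e \<le> K" "\<beta> \<in> Box I K" and ab: "\<alpha> = \<beta>(a := e)"
    by auto
  then show ?case
    unfolding ab using insert.IH[of "\<lambda>\<beta>. c (\<beta>(a := e))", OF *] by blast
qed

lemma polyfun_insert_expansion:
  assumes f: "f \<in> polyfun (insert a I)" and fin: "finite I" and a: "a \<notin> I"
  shows "\<exists>E h. (\<forall>e. h e \<in> polyfun I) \<and> (\<forall>x. f x = (\<Sum>e\<le>E. h e x * x a ^ e))"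
proof -
  obtain K c where c: "\<forall>x. f x = (\<Sum>\<alpha>\<in>Box (insert a I) K. c \<alpha> * monom_on (insert a I) \<alpha> x)"
    using polyfun_monomial_expansion[OF f] fin by auto
  show ?thesis
    by (rule exI[of _ K], rule exI[of _ "\<lambda>e x. \<Sum>\<beta>\<in>Box I K. c (\<beta>(a := e)) * monom_on I \<beta> x"])
      (auto simp: c sum_Box_insert[OF fin a] intro!: polyfun_sum polyfun.mult polyfun.const monom_on_polyfun)
qed

text \<open>Gaussian elimination: an equation with a nonzero entry is solved for its pivot unknown
  \<open>p\<close>, which lowers both counts by one; an equation without such an entry is
  dropped.\<close>

lemma underdetermined_system:
  fixes M :: "'a \<Rightarrow> 'b \<Rightarrow> 'k::field"
  assumes "finite B" "finite A" "card B < card A"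
  shows "\<exists>c. (\<exists>a\<in>A. c a \<noteq> 0) \<and> (\<forall>b\<in>B. (\<Sum>a\<in>A. c a * M a b) = 0)"
  using assms
proof (induction B arbitrary: A M)
  case empty
  then obtain a where "a \<in> A" by fastforce
  then show ?case by (intro exI[of _ "\<lambda>_. 1"]) auto
next
  case (insert b B)
  show ?case
  proof (cases "\<exists>p\<in>A. M p b \<noteq> 0")
    case False
    moreover obtain c where "(\<exists>a\<in>A. c a \<noteq> 0) \<and> (\<forall>b\<in>B. (\<Sum>a\<in>A. c a * M a b) = 0)"
      using insert.IH[of A M] insert.prems insert.hyps by auto
    ultimately show ?thesis by (intro exI[of _ c]) auto
  next
    case True
    then obtain p where p: "p \<in> A" "M p b \<noteq> 0" by auto
    define M' where "M' a b' = M a b' - M a b / M p b * M p b'" for a b'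
    have "card B < card (A - {p})" using insert p by simp
    then obtain c where c: "\<exists>a\<in>A - {p}. c a \<noteq> 0" "\<forall>b\<in>B. (\<Sum>a\<in>A - {p}. c a * M' a b) = 0"
      using insert.IH[of "A - {p}" M'] insert.prems by blast
    define c' where "c' a = (if a = p then - (\<Sum>a\<in>A - {p}. c a * M a b) / M p b else c a)" for a
    have split: "(\<Sum>a\<in>A. c' a * M a b') = c' p * M p b' + (\<Sum>a\<in>A - {p}. c a * M a b')" for b'
      using insert.prems(1) p(1) by (subst sum.remove[of A p]) (auto simp: c'_def intro!: sum.cong)
    have "(\<Sum>a\<in>A. c' a * M a b') = 0" if "b' \<in> insert b B" for b'
    proof (cases "b' = b")
      case True
      then show ?thesis using p(2) by (simp add: split) (simp add: c'_def)
    next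
      case False
      then have "(\<Sum>a\<in>A - {p}. c a * M' a b') = 0" using that c(2) by auto
      then have "(\<Sum>a\<in>A - {p}. c a * M a b') = (\<Sum>a\<in>A - {p}. c a * M a b) / M p b * M p b'"
        by (simp add: M'_def algebra_simps sum_subtractf sum_distrib_left sum_divide_distrib)
      then show ?thesis by (simp add: split) (simp add: c'_def)
    qed
    moreover have "\<exists>a\<in>A. c' a \<noteq> 0" using c(1) by (auto simp: c'_def)
    ultimately show ?thesis by blast
  qed
qed

text \<open>Counting: the products of the \<open>f i\<close> with exponents below \<open>e\<close> number \<open>e ^ card R\<close>, but they lie
  in a space of dimension \<open>O(e ^ card J)\<close>.\<close>

lemma polyfun_algebraically_dependent:
  fixes f :: "'r \<Rightarrow> ('j \<Rightarrow> 'k::field) \<Rightarrow> 'k"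
  assumes inf: "infinite (UNIV :: 'k set)" and R: "finite R" and J: "finite J" and card: "card J < card R"
    and f: "\<And>i. i \<in> R \<Longrightarrow> f i \<in> polyfun J"
  shows "\<exists>H\<in>polyfun R. (\<exists>x. H x \<noteq> 0) \<and> (\<forall>t. H (\<lambda>i. f i t) = 0)"
proof -
  have "\<forall>i\<in>R. \<exists>K c. \<forall>x. f i x = (\<Sum>\<alpha>\<in>Box J K. c \<alpha> * monom_on J \<alpha> x)"
    using polyfun_monomial_expansion[OF f J] by blast
  then obtain Df cf where Df: "\<And>i x. i \<in> R \<Longrightarrow> f i x = (\<Sum>\<alpha>\<in>Box J (Df i). cf i \<alpha> * monom_on J \<alpha> x)"
    by metis
  define K where "K = (\<Sum>i\<in>R. Df i)"
  have DfK: "Df i \<le> K" if "i \<in> R" for i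
    unfolding K_def using R that by (intro member_le_sum) auto
  have fD: "\<exists>c. \<forall>x. f i x = (\<Sum>\<alpha>\<in>Box J K. c \<alpha> * monom_on J \<alpha> x)" if "i \<in> R" for i
    unfolding Df[OF that] sum_Box_extend[OF J DfK[OF that]]
    by (rule exI[of _ "\<lambda>\<alpha>. if \<alpha> \<in> Box J (Df i) then cf i \<alpha> else 0"]) simp
  have pow: "\<exists>c. \<forall>x. f i x ^ n = (\<Sum>\<alpha>\<in>Box J (n * K). c \<alpha> * monom_on J \<alpha> x)" if iR: "i \<in> R" for i n
  proof (induction n)
    case 0
    have "Box J 0 = {\<lambda>_. 0}" by (auto simp: Box_def split: if_splits)
    then show ?case by (intro exI[of _ "\<lambda>_. 1"]) (simp add: monom_on_def)
  next
    case (Suc n)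
    obtain c c' where "\<forall>x. f i x ^ n = (\<Sum>\<alpha>\<in>Box J (n * K). c \<alpha> * monom_on J \<alpha> x)"
      "\<forall>x. f i x = (\<Sum>\<alpha>\<in>Box J K. c' \<alpha> * monom_on J \<alpha> x)"
      using Suc fD[OF iR] by blast
    then show ?case using monomial_expansion_mult[OF J, of c' K c "n * K"] by simp
  qed
  define r where "r = card R"
  define m where "m = card J"
  \<comment> \<open>Chosen so that \<open>(r*e*K + 1)^m \<le> ((r*K + 1)*e)^m = e^(m+1) \<le> e^r <
    (e + 1)^r\<close>: the products of the \<open>f i\<close> outnumber the monomials available to
    them.\<close>
  define e where "e = (r * K + 1) ^ m"
  have e1: "e \<ge> 1" by (simp add: e_def)
  have prod: "\<exists>c. \<forall>x. (\<Prod>i\<in>Q. f i x ^ \<alpha> i) = (\<Sum>\<beta>\<in>Box J (card Q * (e * K)). c \<beta> * monom_on J \<beta> x)"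
    if "Q \<subseteq> R" "\<alpha> \<in> Box R e" for Q \<alpha>
    using finite_subset[OF that(1) R] that(1)
  proof (induction Q)
    case empty
    have "Box J 0 = {\<lambda>_. 0}" by (auto simp: Box_def split: if_splits)
    then show ?case by (intro exI[of _ "\<lambda>_. 1"]) (simp add: monom_on_def)
  next
    case (insert i Q)
    have "\<alpha> i \<le> e" using that(2) insert.prems unfolding Box_def
      by (auto dest!: spec[of _ i])
    then have le: "\<alpha> i * K \<le> e * K" by simp
    obtain c0 where c0: "\<forall>x. f i x ^ \<alpha> i = (\<Sum>\<beta>\<in>Box J (\<alpha> i * K). c0 \<beta> * monom_on J \<beta> x)"
      using pow[of i "\<alpha> i"] insert.prems by blast
    define c where "c \<beta> = (if \<beta> \<in> Box J (\<alpha> i * K) then c0 \<beta> else 0)" for \<beta>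
    have "\<forall>x. f i x ^ \<alpha> i = (\<Sum>\<beta>\<in>Box J (e * K). c \<beta> * monom_on J \<beta> x)"
      by (simp add: c0 c_def sum_Box_extend[OF J le])
    moreover obtain c' where
      "\<forall>x. (\<Prod>i\<in>Q. f i x ^ \<alpha> i) = (\<Sum>\<beta>\<in>Box J (card Q * (e * K)). c' \<beta> * monom_on J \<beta> x)"
      using insert by blast
    ultimately show ?case
      using insert.hyps monomial_expansion_mult[OF J, of c "e * K" c' "card Q * (e * K)"] by simp
  qed
  define N where "N = r * (e * K)"
  have "\<forall>\<alpha>\<in>Box R e. \<exists>c. \<forall>x. (\<Prod>i\<in>R. f i x ^ \<alpha> i) = (\<Sum>\<beta>\<in>Box J N. c \<beta> * monom_on J \<beta> x)"
    using prod[of R] by (simp add: N_def r_def)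
  then obtain C where C: "\<And>\<alpha> x. \<alpha> \<in> Box R e \<Longrightarrow>
      (\<Prod>i\<in>R. f i x ^ \<alpha> i) = (\<Sum>\<beta>\<in>Box J N. C \<alpha> \<beta> * monom_on J \<beta> x)"
    by metis
  have "card (Box J N) = (N + 1) ^ m" using finite_card_Box[OF J] by (simp add: m_def)
  also have "\<dots> \<le> ((r * K + 1) * e) ^ m"
    using e1 by (intro power_mono) (auto simp: N_def algebra_simps)
  also have "\<dots> = e ^ Suc m" by (simp only: power_mult_distrib e_def[symmetric] power_Suc)
  also have "\<dots> \<le> e ^ r" using e1 card by (intro power_increasing) (auto simp: r_def m_def)
  also have "\<dots> < (e + 1) ^ r" using card by (intro power_strict_mono) (auto simp: r_def)
  also have "\<dots> = card (Box R e)" using finite_card_Box[OF R] by (simp add: r_def)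
  finally obtain c where c: "\<exists>\<alpha>\<in>Box R e. c \<alpha> \<noteq> 0"
      "\<forall>\<beta>\<in>Box J N. (\<Sum>\<alpha>\<in>Box R e. c \<alpha> * C \<alpha> \<beta>) = 0"
    using underdetermined_system[of "Box J N" "Box R e" C] finite_card_Box R J by metis
  define H where "H x = (\<Sum>\<alpha>\<in>Box R e. c \<alpha> * monom_on R \<alpha> x)" for x :: "'r \<Rightarrow> 'k"
  have "H \<in> polyfun R"
    unfolding H_def[abs_def] by (intro polyfun_sum polyfun.mult polyfun.const monom_on_polyfun)
  moreover have "\<exists>x. H x \<noteq> 0"
    using monomial_expansion_coeff_0[OF inf R, of c e] c(1) unfolding H_def by blast
  moreover have "H (\<lambda>i. f i t) = 0" for t
  proof -
    have "H (\<lambda>i. f i t) = (\<Sum>\<alpha>\<in>Box R e. c \<alpha> * (\<Sum>\<beta>\<in>Box J N. C \<alpha> \<beta> * monom_on J \<beta> t))"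
      unfolding H_def by (intro sum.cong refl) (simp add: monom_on_def[of R] C)
    also have "\<dots> = (\<Sum>\<beta>\<in>Box J N. (\<Sum>\<alpha>\<in>Box R e. c \<alpha> * C \<alpha> \<beta>) * monom_on J \<beta> t)"
      unfolding sum_distrib_left sum_distrib_right by (subst sum.swap) (simp add: mult_ac)
    also have "\<dots> = 0" using c(2) by simp
    finally show ?thesis .
  qed
  ultimately show ?thesis by blast
qed

section \<open>Projective closed sets\<close>

definition hom_deg :: "'i set \<Rightarrow> nat \<Rightarrow> (('i \<Rightarrow> 'k::field) \<Rightarrow> 'k) \<Rightarrow> bool" where
  "hom_deg I e p \<longleftrightarrow> (\<exists>A c. finite A \<and> (\<forall>\<alpha>\<in>A. (\<forall>i. i \<notin> I \<longrightarrow> \<alpha> i = 0) \<and> sum \<alpha> I = e) \<and>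
      p = (\<lambda>x. \<Sum>\<alpha>\<in>A. c \<alpha> * monom_on I \<alpha> x))"

lemma hom_poly_iff: "hom_poly I p \<longleftrightarrow> (\<exists>e. hom_deg I e p)"
  unfolding hom_poly_def hom_deg_def monom_on_def by blast

lemma hom_deg_scale:
  assumes "hom_deg I e p" shows "p (\<lambda>i. c * x i) = c ^ e * p x"
proof -
  obtain A a where A: "\<forall>\<alpha>\<in>A. (\<forall>i. i \<notin> I \<longrightarrow> \<alpha> i = 0) \<and> sum \<alpha> I = e"
    and p: "p = (\<lambda>x. \<Sum>\<alpha>\<in>A. a \<alpha> * monom_on I \<alpha> x)"
    using assms unfolding hom_deg_def by blast
  have "monom_on I \<alpha> (\<lambda>i. c * x i) = c ^ e * monom_on I \<alpha> x" if "\<alpha> \<in> A" for \<alpha>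
    using A that by (auto simp: monom_on_def power_mult_distrib prod.distrib simp flip: power_sum)
  then show ?thesis
    unfolding p sum_distrib_left by (intro sum.cong) auto
qed

lemma hom_deg_polyfun:
  assumes "hom_deg I e p" shows "p \<in> polyfun I"
proof -
  obtain A a where p: "p = (\<lambda>x. \<Sum>\<alpha>\<in>A. a \<alpha> * monom_on I \<alpha> x)"
    using assms unfolding hom_deg_def by blast
  show ?thesis
    unfolding p by (intro polyfun_sum polyfun.mult polyfun.const monom_on_polyfun)
qed

lemma hom_decomposition:
  assumes f: "f \<in> polyfun I" and fin: "finite I"
  shows "\<exists>E h. (\<forall>e. hom_deg I e (h e)) \<and> (\<forall>x. f x = (\<Sum>e\<le>E. h e x))"
proof -
  obtain K c where c: "\<forall>x. f x = (\<Sum>\<alpha>\<in>Box I K. c \<alpha> * monom_on I \<alpha> x)"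
    using polyfun_monomial_expansion[OF f fin] by blast
  have finB: "finite (Box I K)" using finite_card_Box[OF fin] by blast
  define E where "E = card I * K"
  have sub: "(\<lambda>\<alpha>. sum \<alpha> I) ` Box I K \<subseteq> {..E}"
  proof
    fix e assume "e \<in> (\<lambda>\<alpha>. sum \<alpha> I) ` Box I K"
    then obtain \<alpha> where a: "\<alpha> \<in> Box I K" "e = sum \<alpha> I" by auto
    have "sum \<alpha> I \<le> of_nat (card I) * K"
      using a(1) by (intro sum_bounded_above) (auto simp: Box_def dest!: spec split: if_splits)
    then show "e \<in> {..E}" using a by (simp add: E_def)
  qed
  define h where "h e x = (\<Sum>\<alpha>\<in>{\<alpha>\<in>Box I K. sum \<alpha> I = e}. c \<alpha> * monom_on I \<alpha> x)" for e x
  have "hom_deg I e (h e)" for e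
    unfolding hom_deg_def h_def[abs_def] using finB
    by (intro exI[of _ "{\<alpha>\<in>Box I K. sum \<alpha> I = e}"] exI[of _ c]) (auto simp: Box_def dest!: spec split: if_splits)
  moreover have "f x = (\<Sum>e\<le>E. h e x)" for x
    unfolding c[rule_format] h_def
    by (rule sum.group[OF finB _ sub, symmetric]) simp
  ultimately show ?thesis by blast
qed

text \<open>On the ray \<open>c * x\<close> the function is a polynomial in \<open>c\<close> whose
  coefficients are the values at \<open>x\<close> of the homogeneous components.\<close>

lemma hom_components_eq_0:
  fixes x :: "'i \<Rightarrow> 'k::field"
  assumes inf: "infinite (UNIV :: 'k set)" and h: "\<And>e. hom_deg I e (h e)"
    and f: "\<And>x. f x = (\<Sum>e\<le>E. h e x)" and z: "\<And>c. c \<noteq> 0 \<Longrightarrow> f (\<lambda>i. c * x i) = 0" and e: "e \<le> E"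
  shows "h e x = 0"
proof -
  define p where "p = (\<Sum>e\<le>E. monom (h e x) e)"
  have "poly p c = 0" if "c \<notin> {0}" for c
    using z[of c] that hom_deg_scale[OF h, of _ c x]
    by (simp add: f p_def poly_sum poly_monom mult.commute)
  then have "p = 0" by (rule poly_eq_0_cofinite[OF inf, rotated]) auto
  then have "coeff p e = 0" by simp
  then show ?thesis using e by (simp add: p_def coeff_sum)
qed

lemma proj_closed_scale:
  assumes "proj_closed I Z" "z \<in> Z" "c \<noteq> 0" shows "(\<lambda>i. c * z i) \<in> Z"
proof -
  obtain P where P: "\<forall>p\<in>P. hom_poly I p" "Z = {x \<in> pts I. \<forall>p\<in>P. p x = 0}"
    using assms(1) unfolding proj_closed_def by blast
  have "p (\<lambda>i. c * z i) = 0" if "p \<in> P" for p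
    using P assms(2) that by (auto simp: hom_poly_iff hom_deg_scale)
  then show ?thesis
    using P(2) assms by (auto simp: pts_def fun_eq_iff)
qed

lemma proj_closed_hom_zeros:
  assumes "proj_closed I Z" "hom_poly I p" shows "proj_closed I {z \<in> Z. p z = 0}"
proof -
  obtain P where P: "\<forall>p\<in>P. hom_poly I p" "Z = {x \<in> pts I. \<forall>p\<in>P. p x = 0}"
    using assms(1) unfolding proj_closed_def by blast
  then show ?thesis
    unfolding proj_closed_def using assms(2) by (intro exI[of _ "insert p P"]) auto
qed

lemma proj_closure_eq:
  assumes "X \<subseteq> pts I"
  shows "proj_closure I X = {x \<in> pts I. \<forall>p. hom_poly I p \<and> (\<forall>y\<in>X. p y = 0) \<longrightarrow> p x = 0}" (is "_ = ?C")
proof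
  have "proj_closed I ?C"
    unfolding proj_closed_def
    by (rule exI[of _ "{p. hom_poly I p \<and> (\<forall>y\<in>X. p y = 0)}"]) auto
  moreover have "X \<subseteq> ?C" using assms by auto
  ultimately show "proj_closure I X \<subseteq> ?C" unfolding proj_closure_def by blast
  show "?C \<subseteq> proj_closure I X"
  proof
    fix x assume x: "x \<in> ?C"
    have "x \<in> Z" if Z: "proj_closed I Z" "X \<subseteq> Z" for Z
    proof -
      obtain P where P: "\<forall>p\<in>P. hom_poly I p" "Z = {x \<in> pts I. \<forall>p\<in>P. p x = 0}"
        using Z(1) unfolding proj_closed_def by blast
      then show ?thesis using x Z(2) by blast
    qed
    then show "x \<in> proj_closure I X" unfolding proj_closure_def by blast
  qed
qed

lemma proj_closed_closure: "X \<subseteq> pts I \<Longrightarrow> proj_closed I (proj_closure I X)"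
  unfolding proj_closure_eq proj_closed_def
  by (rule exI[of _ "{p. hom_poly I p \<and> (\<forall>y\<in>X. p y = 0)}"]) auto

lemma proj_closure_superset: "X \<subseteq> proj_closure I X"
  unfolding proj_closure_def by blast

lemma proj_closure_least: "proj_closed I Z \<Longrightarrow> X \<subseteq> Z \<Longrightarrow> proj_closure I X \<subseteq> Z"
  unfolding proj_closure_def by blast

text \<open>The closure is cut out by forms, whereas algebraic relations yield inhomogeneous
  \<open>u\<close>. As \<open>X\<close> is a cone, every homogeneous component of \<open>u\<close>
  vanishes on it separately.\<close>

lemma polyfun_vanish_closure:
  fixes X :: "('i \<Rightarrow> 'k::field) set"
  assumes inf: "infinite (UNIV :: 'k set)" and fin: "finite I" and X: "X \<subseteq> pts I"
    and scale: "\<And>x c. x \<in> X \<Longrightarrow> c \<noteq> 0 \<Longrightarrow> (\<lambda>i. c * x i) \<in> X"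
    and u: "u \<in> polyfun I" and z: "\<And>x. x \<in> X \<Longrightarrow> u x = 0" and y: "y \<in> proj_closure I X"
  shows "u y = 0"
proof -
  obtain E h where h: "\<And>e. hom_deg I e (h e)" and E: "\<And>x. u x = (\<Sum>e\<le>E. h e x)"
    using hom_decomposition[OF u fin] by blast
  have "h e y = 0" if "e \<le> E" for e
  proof -
    have "h e x = 0" if "x \<in> X" for x
      by (rule hom_components_eq_0[OF inf h E _ \<open>e \<le> E\<close>]) (use scale z that in blast)
    then show ?thesis using y h unfolding proj_closure_eq[OF X] hom_poly_iff by blast
  qed
  then show ?thesis by (simp add: E)
qed

text \<open>The vanishing ideal of an irreducible set is prime. Since \<open>u\<close> may be
  inhomogeneous, irreducibility is applied to one homogeneous component at a time.\<close>

lemma irreducible_prime: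
  fixes Z :: "('i \<Rightarrow> 'k::field) set"
  assumes inf: "infinite (UNIV :: 'k set)" and fin: "finite I" and Z: "proj_irreducible I Z"
    and u: "u \<in> polyfun I" and g: "hom_poly I g" and z: "\<And>z. z \<in> Z \<Longrightarrow> u z * g z = 0"
    and gZ: "\<exists>z\<in>Z. g z \<noteq> 0"
  shows "\<forall>z\<in>Z. u z = 0"
proof -
  have cl: "proj_closed I Z" using Z by (simp add: proj_irreducible_def)
  obtain E h where h: "\<And>e. hom_deg I e (h e)" and E: "\<And>x. u x = (\<Sum>e\<le>E. h e x)"
    using hom_decomposition[OF u fin] by blast
  obtain eg where eg: "hom_deg I eg g" using g by (auto simp: hom_poly_iff)
  have hg: "h e x * g x = 0" if x: "x \<in> Z" and e: "e \<le> E" for x e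
  proof (cases "g x = 0")
    case False
    have "h e x = 0"
    proof (rule hom_components_eq_0[OF inf h E _ e])
      fix c :: 'k assume "c \<noteq> 0"
      then have "u (\<lambda>i. c * x i) * g (\<lambda>i. c * x i) = 0"
        using z[OF proj_closed_scale[OF cl x]] by blast
      moreover have "g (\<lambda>i. c * x i) \<noteq> 0"
        using False \<open>c \<noteq> 0\<close> by (simp add: hom_deg_scale[OF eg])
      ultimately show "u (\<lambda>i. c * x i) = 0" by simp
    qed
    then show ?thesis by simp
  qed simp
  have "h e x = 0" if e: "e \<le> E" and x: "x \<in> Z" for e x
  proof -
    have "proj_closed I {z \<in> Z. h e z = 0}" "proj_closed I {z \<in> Z. g z = 0}"
      using proj_closed_hom_zeros[OF cl] h g by (auto simp: hom_poly_iff)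
    moreover have "Z = {z \<in> Z. h e z = 0} \<union> {z \<in> Z. g z = 0}" using hg[OF _ e] by auto
    moreover have "{z \<in> Z. g z = 0} \<noteq> Z" using gZ by blast
    ultimately have "{z \<in> Z. h e z = 0} = Z" using Z unfolding proj_irreducible_def by blast
    then show ?thesis using x by blast
  qed
  then show ?thesis by (simp add: E)
qed

text \<open>Polynomial functions on the parameter space form a domain, so two closed sets that
  together cover the image cannot both be proper.\<close>

lemma irreducible_closure_image:
  fixes \<Xi> :: "('j \<Rightarrow> 'k::field) \<Rightarrow> 'i \<Rightarrow> 'k"
  assumes inf: "infinite (UNIV :: 'k set)"
    and poly: "\<And>i. (\<lambda>t. \<Xi> t i) \<in> polyfun J" and ne: "range \<Xi> \<inter> pts I \<noteq> {}"
    and supp: "\<And>t i. i \<notin> I \<Longrightarrow> \<Xi> t i = 0"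
  shows "proj_irreducible I (proj_closure I (range \<Xi> \<inter> pts I))"
  unfolding proj_irreducible_def
proof (intro conjI notI)
  let ?X = "range \<Xi> \<inter> pts I"
  let ?Z = "proj_closure I ?X"
  show "proj_closed I ?Z" by (rule proj_closed_closure) simp
  show False if "?Z = {}" using that ne proj_closure_superset[of ?X I] by blast
  assume "\<exists>Z1 Z2. proj_closed I Z1 \<and> proj_closed I Z2 \<and> ?Z = Z1 \<union> Z2 \<and> Z1 \<noteq> ?Z \<and> Z2 \<noteq> ?Z"
  then obtain Z1 Z2 where Zs: "proj_closed I Z1" "proj_closed I Z2" "?Z = Z1 \<union> Z2" "Z1 \<noteq> ?Z" "Z2 \<noteq> ?Z"
    by blast
  have ex: "\<exists>p. p \<in> polyfun I \<and> (\<forall>z\<in>Z. p z = 0) \<and> (\<exists>t. p (\<Xi> t) \<noteq> 0)"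
    if Z: "proj_closed I Z" "Z \<subseteq> ?Z" "Z \<noteq> ?Z" for Z
  proof -
    obtain P where P: "\<forall>p\<in>P. hom_poly I p" "Z = {x \<in> pts I. \<forall>p\<in>P. p x = 0}"
      using Z(1) unfolding proj_closed_def by blast
    have "\<not> ?X \<subseteq> Z" using proj_closure_least[OF Z(1)] Z by blast
    then obtain p t where "p \<in> P" "p (\<Xi> t) \<noteq> 0" using P(2) by blast
    then show ?thesis using P hom_deg_polyfun unfolding hom_poly_iff by blast
  qed
  obtain p1 where p1: "p1 \<in> polyfun I" "\<forall>z\<in>Z1. p1 z = 0" "\<exists>t. p1 (\<Xi> t) \<noteq> 0"
    using ex[of Z1] Zs by blast
  obtain p2 where p2: "p2 \<in> polyfun I" "\<forall>z\<in>Z2. p2 z = 0" "\<exists>t. p2 (\<Xi> t) \<noteq> 0"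
    using ex[of Z2] Zs by blast
  obtain t0 where "\<Xi> t0 \<in> pts I" using ne by blast
  then obtain l where l: "\<exists>t. \<Xi> t l \<noteq> 0" by (auto simp: pts_def fun_eq_iff)
  have c1: "(\<lambda>t. p1 (\<Xi> t)) \<in> polyfun J" and c2: "(\<lambda>t. p2 (\<Xi> t)) \<in> polyfun J"
    using polyfun_compose[OF p1(1) poly] polyfun_compose[OF p2(1) poly] by auto
  \<comment> \<open>The coordinate \<open>l\<close> as a further factor takes care of parameters
    sent to the zero vector, which represents no point.\<close>
  have "p1 (\<Xi> t) * (p2 (\<Xi> t) * \<Xi> t l) = 0" for t
  proof (cases "\<Xi> t \<in> pts I")
    case True
    then have "\<Xi> t \<in> ?Z" by (intro subsetD[OF proj_closure_superset]) simp
    then have "\<Xi> t \<in> Z1 \<or> \<Xi> t \<in> Z2" unfolding Zs(3) Un_iff .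
    then have "p1 (\<Xi> t) = 0 \<or> p2 (\<Xi> t) = 0" using p1(2) p2(2) by blast
    then show ?thesis by (elim disjE) simp_all
  next
    case False
    then have "\<Xi> t l = 0" using supp by (auto simp: pts_def fun_eq_iff)
    then show ?thesis by simp
  qed
  then have "(\<forall>t. p1 (\<Xi> t) = 0) \<or> (\<forall>t. p2 (\<Xi> t) * \<Xi> t l = 0)"
    by (rule polyfun_mult_eq_0[OF inf c1 polyfun.mult[OF c2 poly]])
  moreover have "(\<forall>t. p2 (\<Xi> t) = 0) \<or> (\<forall>t. \<Xi> t l = 0)" if "\<And>t. p2 (\<Xi> t) * \<Xi> t l = 0"
    using that by (rule polyfun_mult_eq_0[OF inf c2 poly])
  ultimately show False using p1(3) p2(3) l by blast
qed

section \<open>Bounding chains of irreducible sets from above\<close>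

text \<open>Algebraic independence of the restrictions to \<open>Z\<close>. This stands in for the
  transcendence degree of the coordinate ring of the cone over \<open>Z\<close>.\<close>

definition indep_on :: "('i \<Rightarrow> 'k::field) set \<Rightarrow> nat \<Rightarrow> (nat \<Rightarrow> ('i \<Rightarrow> 'k) \<Rightarrow> 'k) \<Rightarrow> bool" where
  "indep_on Z r f \<longleftrightarrow> (\<forall>H\<in>polyfun {..<r}. (\<forall>z\<in>Z. H (\<lambda>i. f i z) = 0) \<longrightarrow> (\<forall>x. H x = 0))"

text \<open>The cone contains all nonzero multiples of \<open>z\<close>, on which the coordinate
  \<open>l\<close> takes every nonzero value. So even the smallest set of a chain carries one
  independent function.\<close>

lemma indep_on_point:
  fixes Z :: "('i \<Rightarrow> 'k::field) set"
  assumes inf: "infinite (UNIV :: 'k set)" and Z: "proj_closed I Z" and z: "z \<in> Z" "z l \<noteq> 0"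
  shows "indep_on Z (Suc 0) (\<lambda>_ x. x l)"
  unfolding indep_on_def
proof (intro ballI impI allI)
  fix H :: "(nat \<Rightarrow> 'k) \<Rightarrow> 'k" and x :: "nat \<Rightarrow> 'k"
  assume H: "H \<in> polyfun {..<Suc 0}" and 0: "\<forall>z\<in>Z. H (\<lambda>i. z l) = 0"
  have "\<exists>q. \<forall>s::'k. s = poly q s" by (rule exI[of _ "[:0, 1:]"]) simp
  then obtain p where p: "\<forall>s. H (\<lambda>_. s) = poly p s"
    using polyfun_poly[where g = "\<lambda>s _. s", OF H] by blast
  have "poly p s = 0" if "s \<notin> {0}" for s
  proof -
    have "(\<lambda>i. s / z l * z i) \<in> Z" using proj_closed_scale[OF Z z(1), of "s / z l"] z(2) that by simp
    then have "H (\<lambda>i. s / z l * z l) = 0" using 0 by (auto dest: bspec)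
    then show ?thesis using z(2) p by simp
  qed
  then have "p = 0" by (rule poly_eq_0_cofinite[OF inf, rotated]) auto
  then have "H (\<lambda>_. x 0) = 0" using p by simp
  moreover have "H x = H (\<lambda>_. x 0)" by (rule polyfun_cong[OF H]) simp
  ultimately show "H x = 0" by simp
qed

text \<open>A form \<open>g\<close> vanishing on the smaller set is transcendental over functions that are independent
  there: the lowest coefficient of a relation vanishes on \<open>Z\<close>, and \<open>g\<close> may be cancelled on \<open>Z'\<close>.\<close>

lemma indep_on_step:
  fixes Z Z' :: "('i \<Rightarrow> 'k::field) set"
  assumes inf: "infinite (UNIV :: 'k set)" and fin: "finite I" and Z': "proj_irreducible I Z'"
    and sub: "Z \<subseteq> Z'" and f: "\<And>i. i < r \<Longrightarrow> f i \<in> polyfun I" and ind: "indep_on Z r f"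
    and g: "hom_poly I g" "\<forall>z\<in>Z. g z = 0" "\<exists>z\<in>Z'. g z \<noteq> 0"
  shows "indep_on Z' (Suc r) (f(r := g))"
proof -
  have gp: "g \<in> polyfun I" using g(1) hom_deg_polyfun by (auto simp: hom_poly_iff)
  have fg: "(\<lambda>z. (f(r := g)) i z) \<in> polyfun I" if "i < Suc r" for i
    using f gp that by (auto simp: less_Suc_eq)
  have main: "\<forall>e\<le>E. \<forall>x. h e x = 0"
    if "\<And>e. h e \<in> polyfun {..<r}" and "\<forall>z\<in>Z'. (\<Sum>e\<le>E. h e (\<lambda>i. f i z) * g z ^ e) = 0" for E h
    using that
  proof (induction E arbitrary: h)
    case 0
    then have "\<forall>z\<in>Z. h 0 (\<lambda>i. f i z) = 0" using sub by auto
    then show ?case using ind 0(1) unfolding indep_on_def by auto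
  next
    case (Suc E)
    have split: "(\<Sum>e\<le>Suc E. h e (\<lambda>i. f i z) * g z ^ e)
      = h 0 (\<lambda>i. f i z) + (\<Sum>e\<le>E. h (Suc e) (\<lambda>i. f i z) * g z ^ e) * g z" for z
      by (subst sum.atMost_Suc_shift) (simp add: sum_distrib_left mult_ac)
    have "\<forall>z\<in>Z. h 0 (\<lambda>i. f i z) = 0"
    proof
      fix z assume "z \<in> Z"
      then have "z \<in> Z'" "g z = 0" using sub g(2) by auto
      then show "h 0 (\<lambda>i. f i z) = 0" using Suc.prems(2)[rule_format, of z] unfolding split by simp
    qed
    then have h0: "\<forall>x. h 0 x = 0" using ind Suc.prems(1) unfolding indep_on_def by blast
    have "\<forall>z\<in>Z'. (\<Sum>e\<le>E. h (Suc e) (\<lambda>i. f i z) * g z ^ e) = 0"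
    proof (rule irreducible_prime[OF inf fin Z' _ g(1) _ g(3)])
      have "(\<lambda>z. h (Suc e) (\<lambda>i. f i z)) \<in> polyfun I" for e
        using f by (intro polyfun_compose[OF Suc.prems(1)]) auto
      then show "(\<lambda>z. \<Sum>e\<le>E. h (Suc e) (\<lambda>i. f i z) * g z ^ e) \<in> polyfun I"
        using gp by (intro polyfun_sum polyfun.mult polyfun_power)
      show "(\<Sum>e\<le>E. h (Suc e) (\<lambda>i. f i z) * g z ^ e) * g z = 0" if "z \<in> Z'" for z
        using Suc.prems(2)[rule_format, OF that] h0 unfolding split by simp
    qed
    then have "\<forall>e\<le>E. \<forall>x. h (Suc e) x = 0"
      using Suc.IH[of "\<lambda>e. h (Suc e)"] Suc.prems(1) by blast
    then show ?case using h0 by (metis Suc_le_mono not0_implies_Suc)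
  qed
  show ?thesis
    unfolding indep_on_def
  proof (intro ballI impI allI)
    fix H :: "(nat \<Rightarrow> 'k) \<Rightarrow> 'k" and x
    assume H: "H \<in> polyfun {..<Suc r}" and 0: "\<forall>z\<in>Z'. H (\<lambda>i. (f(r := g)) i z) = 0"
    have "H \<in> polyfun (insert r {..<r})" using H by (simp add: lessThan_Suc)
    from polyfun_insert_expansion[OF this] obtain E h where h: "\<And>e. h e \<in> polyfun {..<r}"
      and E: "\<And>x. H x = (\<Sum>e\<le>E. h e x * x r ^ e)" by auto
    have "h e (\<lambda>i. (f(r := g)) i z) = h e (\<lambda>i. f i z)" for e z
      by (rule polyfun_cong[OF h]) auto
    then have "\<forall>z\<in>Z'. (\<Sum>e\<le>E. h e (\<lambda>i. f i z) * g z ^ e) = 0" using 0 by (simp add: E)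
    with main[OF h this] show "H x = 0" by (simp add: E)
  qed
qed

text \<open>The \<open>n + 1\<close> sets of the chain yield \<open>n + 1\<close> functions
  independent on \<open>Z n\<close>. Pulled back along \<open>\<Phi>\<close>, that many polynomials
  in at most \<open>n\<close> variables would be dependent, and the relation would spread to the
  closure of \<open>X\<close>. Hypothesis \<open>van\<close> asks for density of the image only,
  since star configurations with lines lacking an \<open>x0\<close>-term are not in the image of the
  normalised parametrisation.\<close>

lemma irreducible_chain_bound:
  fixes \<Phi> :: "('j \<Rightarrow> 'k::field) \<Rightarrow> 'i \<Rightarrow> 'k"
  assumes inf: "infinite (UNIV :: 'k set)" and fin: "finite I" and J: "finite J"
    and poly: "\<And>i. i \<in> I \<Longrightarrow> (\<lambda>t. \<Phi> t i) \<in> polyfun J" and X: "X \<subseteq> pts I"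
    and scale: "\<And>x c. x \<in> X \<Longrightarrow> c \<noteq> 0 \<Longrightarrow> (\<lambda>i. c * x i) \<in> X"
    and van: "\<And>u x. u \<in> polyfun I \<Longrightarrow> (\<forall>t. u (\<Phi> t) = 0) \<Longrightarrow> x \<in> X \<Longrightarrow> u x = 0"
    and irr: "\<And>j. j \<le> n \<Longrightarrow> proj_irreducible I (Z j)" and chain: "\<And>j. j < n \<Longrightarrow> Z j \<subset> Z (Suc j)"
    and Zn: "Z n \<subseteq> proj_closure I X"
  shows "n < card J"
proof -
  have "\<exists>f. (\<forall>i<Suc j. f i \<in> polyfun I) \<and> indep_on (Z j) (Suc j) f" if "j \<le> n" for j
    using that
  proof (induction j)
    case 0
    have Z0: "proj_closed I (Z 0)" "Z 0 \<noteq> {}" using irr[of 0] by (auto simp: proj_irreducible_def)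
    then obtain z where z: "z \<in> Z 0" by blast
    then have "z \<in> pts I" using Z0 unfolding proj_closed_def by blast
    then obtain l where l: "l \<in> I" "z l \<noteq> 0" unfolding pts_def by (auto simp: fun_eq_iff)
    show ?case
      using indep_on_point[OF inf Z0(1) z l(2)] l(1)
      by (intro exI[of _ "\<lambda>_ x. x l"]) (auto intro: polyfun.var)
  next
    case (Suc j)
    then obtain f where f: "\<forall>i<Suc j. f i \<in> polyfun I" "indep_on (Z j) (Suc j) f" by auto
    have lt: "Z j \<subset> Z (Suc j)" using chain Suc.prems by simp
    have cl: "proj_closed I (Z j)" "proj_closed I (Z (Suc j))"
      using irr Suc.prems by (auto simp: proj_irreducible_def)
    obtain P where P: "\<forall>p\<in>P. hom_poly I p" "Z j = {x \<in> pts I. \<forall>p\<in>P. p x = 0}"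
      using cl(1) unfolding proj_closed_def by blast
    obtain z where z: "z \<in> Z (Suc j)" "z \<notin> Z j" using lt by blast
    moreover have "z \<in> pts I" using z(1) cl(2) unfolding proj_closed_def by blast
    ultimately obtain g where g: "g \<in> P" "g z \<noteq> 0" using P(2) by blast
    have "indep_on (Z (Suc j)) (Suc (Suc j)) (f(Suc j := g))"
      by (rule indep_on_step[OF inf fin irr[OF Suc.prems] _ _ f(2)])
        (use lt f(1) g P z in auto)
    moreover have "g \<in> polyfun I"
      using g(1) P(1) hom_deg_polyfun unfolding hom_poly_iff by blast
    then have "\<forall>i<Suc (Suc j). (f(Suc j := g)) i \<in> polyfun I"
      using f(1) by (auto simp: less_Suc_eq)
    ultimately show ?case by blast
  qed
  then obtain f where f: "\<forall>i<Suc n. f i \<in> polyfun I" "indep_on (Z n) (Suc n) f" by blast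
  show ?thesis
  proof (rule ccontr)
    assume "\<not> n < card J"
    then have card: "card J < card {..<Suc n}" by simp
    have fp: "(\<lambda>t. f i (\<Phi> t)) \<in> polyfun J" if "i \<in> {..<Suc n}" for i
    proof -
      have "f i \<in> polyfun I" using f(1) that by simp
      then show ?thesis by (rule polyfun_compose[OF _ poly])
    qed
    obtain H where H: "H \<in> polyfun {..<Suc n}" "\<exists>x. H x \<noteq> 0" "\<forall>t. H (\<lambda>i. f i (\<Phi> t)) = 0"
      using polyfun_algebraically_dependent[where f = "\<lambda>i t. f i (\<Phi> t)", OF inf finite_lessThan J card fp]
      by blast
    define u where "u = (\<lambda>x. H (\<lambda>i. f i x))"
    have u: "u \<in> polyfun I"
      unfolding u_def using f(1) by (intro polyfun_compose[OF H(1)]) auto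
    have "u x = 0" if "x \<in> X" for x
      using van[OF u _ that] H(3) by (simp add: u_def)
    then have "\<forall>z\<in>Z n. u z = 0"
      using polyfun_vanish_closure[OF inf fin X scale u] Zn by blast
    then show False using f(2) H(1,2) unfolding indep_on_def u_def by blast
  qed
qed

section \<open>Constructing chains of irreducible sets\<close>

text \<open>Vectors are added one at a time. The residue \<open>w\<close> of the new vector, after
  removing what the old functionals read off, is nonzero by independence and supplies the new
  functional; the old ones are then corrected by multiples of it.\<close>

lemma dual_functionals:
  fixes v :: "'j \<Rightarrow> 'i \<Rightarrow> 'k::field"
  assumes I: "finite I" and "finite J"
    and "\<And>c. (\<forall>l\<in>I. (\<Sum>k\<in>J. c k * v k l) = 0) \<Longrightarrow> \<forall>k\<in>J. c k = 0"
  shows "\<exists>\<phi>. \<forall>k\<in>J. \<forall>m\<in>J. (\<Sum>l\<in>I. \<phi> k l * v m l) = (if k = m then 1 else 0)"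
  using assms(2-)
proof (induction J)
  case (insert a J)
  have sum0: "(\<Sum>k\<in>insert a J. c k * v k l) = c a * v a l + (\<Sum>k\<in>J. c k * v k l)" for c l
    using insert.hyps by simp
  have "\<forall>k\<in>J. c k = 0" if "\<forall>l\<in>I. (\<Sum>k\<in>J. c k * v k l) = 0" for c
  proof -
    have "(\<Sum>k\<in>J. (c(a := 0)) k * v k l) = (\<Sum>k\<in>J. c k * v k l)" for l
      using insert.hyps by (intro sum.cong) auto
    then have "\<forall>k\<in>insert a J. (c(a := 0)) k = 0"
      using that by (intro insert.prems) (simp add: sum0)
    then show ?thesis using insert.hyps by (auto split: if_splits)
  qed
  then obtain \<phi> where \<phi>: "\<And>k m. k \<in> J \<Longrightarrow> m \<in> J \<Longrightarrow> (\<Sum>l\<in>I. \<phi> k l * v m l) = (if k = m then 1 else 0)"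
    using insert.IH by blast
  define b where "b k = (\<Sum>l\<in>I. \<phi> k l * v a l)" for k
  define w where "w l = v a l - (\<Sum>k\<in>J. b k * v k l)" for l
  have "\<exists>l\<in>I. w l \<noteq> 0"
  proof (rule ccontr)
    assume "\<not> ?thesis"
    moreover have "(\<Sum>k\<in>J. (if k = a then 1 else - b k) * v k l) = - (\<Sum>k\<in>J. b k * v k l)" for l
      using insert.hyps by (simp flip: sum_negf, intro sum.cong) auto
    ultimately have "\<forall>k\<in>insert a J. (if k = a then 1 else - b k) = 0"
      by (intro insert.prems) (simp add: sum0 w_def)
    then show False by simp
  qed
  then obtain l0 where l0: "l0 \<in> I" "w l0 \<noteq> 0" by blast
  \<comment> \<open>Reads the coordinate \<open>l0\<close> after removing the part along the old
    vectors, normalised to 1 on \<open>v a\<close>.\<close>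
  define \<mu> where "\<mu> l = ((if l = l0 then 1 else 0) - (\<Sum>k\<in>J. v k l0 * \<phi> k l)) / w l0" for l
  have \<mu>: "(\<Sum>l\<in>I. \<mu> l * x l) = (x l0 - (\<Sum>k\<in>J. v k l0 * (\<Sum>l\<in>I. \<phi> k l * x l))) / w l0" for x
  proof -
    have "(\<Sum>l\<in>I. \<mu> l * x l) = (\<Sum>l\<in>I. ((if l = l0 then x l else 0) - (\<Sum>k\<in>J. v k l0 * \<phi> k l * x l)) / w l0)"
      by (intro sum.cong) (auto simp: \<mu>_def left_diff_distrib sum_distrib_right)
    also have "\<dots> = ((\<Sum>l\<in>I. if l = l0 then x l else 0) - (\<Sum>l\<in>I. \<Sum>k\<in>J. v k l0 * \<phi> k l * x l)) / w l0"
      by (simp only: sum_subtractf sum_divide_distrib[symmetric])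
    also have "(\<Sum>l\<in>I. \<Sum>k\<in>J. v k l0 * \<phi> k l * x l) = (\<Sum>k\<in>J. v k l0 * (\<Sum>l\<in>I. \<phi> k l * x l))"
      by (subst sum.swap) (simp add: sum_distrib_left mult.assoc)
    finally show ?thesis using I l0(1) by simp
  qed
  have \<mu>a: "(\<Sum>l\<in>I. \<mu> l * v a l) = 1"
    using l0(2) by (simp add: \<mu> flip: b_def) (simp add: w_def mult.commute)
  have \<mu>J: "(\<Sum>l\<in>I. \<mu> l * v m l) = 0" if "m \<in> J" for m
  proof -
    have "(\<Sum>k\<in>J. v k l0 * (\<Sum>l\<in>I. \<phi> k l * v m l)) = (\<Sum>k\<in>J. if k = m then v k l0 else 0)"
      using that by (intro sum.cong) (auto simp: \<phi>)
    then show ?thesis using that insert.hyps by (simp add: \<mu>)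
  qed
  define \<phi>' where "\<phi>' k l = (if k = a then \<mu> l else \<phi> k l - b k * \<mu> l)" for k l
  have "(\<Sum>l\<in>I. \<phi>' k l * v m l) = (if k = m then 1 else 0)" if "k \<in> insert a J" "m \<in> insert a J" for k m
  proof (cases "k = a")
    case True
    then show ?thesis using that insert.hyps \<mu>a \<mu>J by (auto simp: \<phi>'_def)
  next
    case False
    then have "(\<Sum>l\<in>I. \<phi>' k l * v m l) = (\<Sum>l\<in>I. \<phi> k l * v m l) - b k * (\<Sum>l\<in>I. \<mu> l * v m l)"
      by (simp add: \<phi>'_def left_diff_distrib sum_subtractf sum_distrib_left mult.assoc)
    then show ?thesis
      using that False insert.hyps \<mu>a \<mu>J \<phi> by (auto simp flip: b_def)
  qed
  then show ?case by blast
qed auto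

text \<open>The tangent cone at \<open>a\<close> of the zero set of a nonzero \<open>H\<close> is a proper subset.\<close>

lemma polyfun_eq_0_by_curves:
  fixes H :: "('r \<Rightarrow> 'k::field) \<Rightarrow> 'k"
  assumes inf: "infinite (UNIV :: 'k set)" and R: "finite R" and H: "H \<in> polyfun R"
    and curves: "\<And>v. \<exists>V. (\<forall>r\<in>R. poly (V r) 0 = v r) \<and> (\<forall>s. H (\<lambda>r. a r + s\<^sup>2 * poly (V r) s) = 0)"
  shows "H x = 0"
proof -
  \<comment> \<open>Expansion of \<open>H\<close> at \<open>a\<close>: the variable
    \<open>None\<close> is the distance, the others are the direction. The lowest nonzero
    coefficient in \<open>None\<close> is the equation of the tangent cone.\<close>
  define G where "G z = H (\<lambda>r. a r + z None * z (Some r))" for z :: "'r option \<Rightarrow> 'k"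
  have "G \<in> polyfun (insert None (Some ` R))"
    unfolding G_def[abs_def]
    by (intro polyfun_compose[OF H] polyfun.add polyfun.const polyfun.mult polyfun.var) auto
  then obtain E h where h: "\<And>e. h e \<in> polyfun (Some ` R)"
    and E: "\<And>z. G z = (\<Sum>e\<le>E. h e z * z None ^ e)"
    using polyfun_insert_expansion[of G None "Some ` R"] R by auto
  have "\<forall>e\<le>E. \<forall>z. h e z = 0"
  proof (rule ccontr)
    assume "\<not> ?thesis"
    then have ex: "\<exists>e. e \<le> E \<and> (\<exists>z. h e z \<noteq> 0)" by blast
    define e0 where "e0 = (LEAST e. e \<le> E \<and> (\<exists>z. h e z \<noteq> 0))"
    have e0: "e0 \<le> E" "\<exists>z. h e0 z \<noteq> 0" using LeastI_ex[OF ex] unfolding e0_def by auto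
    have below: "h e z = 0" if "e < e0" for e z
      using not_less_Least[OF that[unfolded e0_def]] that e0(1) by auto
    obtain z where z: "h e0 z \<noteq> 0" using e0(2) by blast
    obtain V where V: "\<forall>r\<in>R. poly (V r) 0 = z (Some r)"
      and VH: "\<forall>s. H (\<lambda>r. a r + s\<^sup>2 * poly (V r) s) = 0"
      using curves[of "\<lambda>r. z (Some r)"] by blast
    \<comment> \<open>The curve leaves \<open>a\<close> at order \<open>s^2\<close>, so
      \<open>None\<close> becomes \<open>s^2\<close> and the direction becomes
      \<open>V\<close>.\<close>
    define \<zeta> where "\<zeta> s = case_option (s\<^sup>2) (\<lambda>r. poly (V r) s)" for s
    have "\<exists>p. \<forall>s. h e (\<zeta> s) = poly p s" for e
      by (rule polyfun_poly[OF h]) (auto simp: \<zeta>_def)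
    then obtain p where p: "\<And>e s. h e (\<zeta> s) = poly (p e) s" by metis
    \<comment> \<open>In degree \<open>2 * e0\<close> only the summand \<open>e0\<close> counts: the
      lower \<open>p e\<close> are zero and the higher ones carry a larger power of
      \<open>s\<close>. What is left is \<open>h e0\<close> at the prescribed direction.\<close>
    define P where "P = (\<Sum>e\<le>E. monom 1 (2 * e) * p e)"
    have "poly P s = 0" for s
    proof -
      have "G (\<zeta> s) = 0" using VH by (simp add: G_def \<zeta>_def)
      moreover have "\<zeta> s None = s\<^sup>2" by (simp add: \<zeta>_def)
      ultimately show ?thesis
        unfolding E P_def by (simp add: p poly_sum poly_monom power_mult mult.commute[of "poly (p _) s"])
    qed
    then have "P = 0" by (intro poly_eq_0_cofinite[OF inf, of "{}"]) auto
    then have "0 = coeff P (2 * e0)" by simp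
    also have "\<dots> = (\<Sum>e\<le>E. if e = e0 then coeff (p e0) 0 else 0)"
      unfolding P_def coeff_sum
    proof (intro sum.cong refl)
      fix e
      have "p e = 0" if "e < e0"
        by (intro poly_eq_0_cofinite[OF inf, of "{}"]) (simp_all add: below[OF that] flip: p)
      then show "coeff (monom 1 (2 * e) * p e) (2 * e0) = (if e = e0 then coeff (p e0) 0 else 0)"
        by (cases "e < e0") (auto simp: coeff_monom_mult)
    qed
    also have "\<dots> = h e0 (\<zeta> 0)" using e0(1) by (simp add: p poly_0_coeff_0)
    also have "\<dots> = h e0 z" by (rule polyfun_cong[OF h]) (use V in \<open>auto simp: \<zeta>_def\<close>)
    finally show False using z by simp
  qed
  \<comment> \<open>Distance 1 in direction \<open>x - a\<close> leads back to
    \<open>x\<close>.\<close>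
  then have "G (case_option 1 (\<lambda>r. x r - a r)) = 0" by (simp add: E)
  then show ?thesis by (simp add: G_def)
qed

text \<open>Setting all parameters outside the first \<open>j\<close> to 0 gives a flag of cones
  \<open>Y j\<close>. If consecutive closures agreed, a relation \<open>H\<close> between
  \<open>j + 2\<close> functionals on \<open>Y j\<close>, a family with \<open>j + 1\<close>
  parameters, would persist on \<open>Y (Suc j)\<close>. There, however, the curves leave the base
  point in every direction spanned by the base vector and the first \<open>j + 1\<close> tangent
  vectors, and \<open>polyfun_eq_0_by_curves\<close> gives \<open>H = 0\<close>. Velocities are
  prescribed at order \<open>s^2\<close> so that second-order directions count too.\<close>

lemma irreducible_chain_exists:
  fixes \<Theta> :: "('j \<Rightarrow> 'k::field) \<Rightarrow> 'i \<Rightarrow> 'k"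
  assumes inf: "infinite (UNIV :: 'k set)" and I: "finite I" and J: "finite J"
    and poly: "\<And>i. (\<lambda>t. \<Theta> t i) \<in> polyfun J" and supp: "\<And>t i. i \<notin> I \<Longrightarrow> \<Theta> t i = 0"
    and indep: "\<And>c0 c. (\<forall>l\<in>I. c0 * \<Theta> (\<lambda>_. 0) l + (\<Sum>k\<in>J. c k * w k l) = 0) \<Longrightarrow> c0 = 0 \<and> (\<forall>k\<in>J. c k = 0)"
    and curve: "\<And>y. \<exists>\<gamma>. (\<forall>s k. y k = 0 \<longrightarrow> \<gamma> s k = 0) \<and> (\<forall>l\<in>I. \<exists>R. \<forall>s. \<Theta> (\<gamma> s) l =
        \<Theta> (\<lambda>_. 0) l + s\<^sup>2 * (\<Sum>k\<in>J. y k * w k l) + s ^ 3 * poly R s)"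
    and X: "\<And>c t. (\<lambda>i. c * \<Theta> t i) \<in> pts I \<Longrightarrow> (\<lambda>i. c * \<Theta> t i) \<in> proj_closure I X"
    and Xp: "X \<subseteq> pts I"
  shows "\<exists>Z. (\<forall>j\<le>card J. proj_irreducible I (Z j)) \<and> (\<forall>j<card J. Z j \<subset> Z (Suc j)) \<and> Z (card J) \<subseteq> proj_closure I X"
proof -
  obtain e where e: "bij_betw e {0..<card J} J" using ex_bij_betw_nat_finite[OF J] by blast
  define V where "V j = e ` {..<j}" for j
  \<comment> \<open>The coordinate \<open>None\<close> is an overall scalar, which makes the image a
    cone.\<close>
  define \<Xi> where "\<Xi> j t = (\<lambda>i. t None * \<Theta> (\<lambda>k. if k \<in> V j then t (Some k) else 0) i)" for j and t :: "'j option \<Rightarrow> 'k"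
  define Y where "Y j = range (\<Xi> j) \<inter> pts I" for j
  define Z where "Z j = proj_closure I (Y j)" for j
  have V: "V j \<subseteq> J" "card (V j) = j" "finite (V j)" if "j \<le> card J" for j
  proof -
    have "{..<j} \<subseteq> {0..<card J}" using that by auto
    then show "V j \<subseteq> J" "card (V j) = j"
      using e by (auto simp: V_def bij_betw_def card_image inj_on_subset)
    show "finite (V j)" by (simp add: V_def)
  qed
  have Vmono: "V j \<subseteq> V (Suc j)" for j by (auto simp: V_def)
  have \<Xi>poly: "(\<lambda>t. \<Xi> j t i) \<in> polyfun (insert None (Some ` V j))" for i j
    unfolding \<Xi>_def
  proof (intro polyfun.mult polyfun_compose[OF poly])
    show "(\<lambda>t. if k \<in> V j then t (Some k) else 0) \<in> polyfun (insert None (Some ` V j))" for k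
      by (cases "k \<in> V j") (auto intro: polyfun.intros)
  qed (auto intro: polyfun.var)
  have \<Xi>supp: "\<Xi> j t i = 0" if "i \<notin> I" for i j t using supp[OF that] by (simp add: \<Xi>_def)
  have "\<exists>l\<in>I. \<Theta> (\<lambda>_. 0) l \<noteq> 0"
    using indep[of 1 "\<lambda>_. 0"] by auto
  then have "(\<lambda>i. 1 * \<Theta> (\<lambda>_. 0) i) \<in> pts I" using supp by (auto simp: pts_def fun_eq_iff)
  then have "\<Xi> j (case_option 1 (\<lambda>_. 0)) \<in> pts I" for j
    by (simp add: \<Xi>_def if_distrib cong: if_cong)
  then have Yne: "Y j \<noteq> {}" for j unfolding Y_def by blast
  have Ysub: "Y j \<subseteq> pts I" for j by (simp add: Y_def)
  have irr: "proj_irreducible I (Z j)" for j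
    unfolding Z_def Y_def
    by (rule irreducible_closure_image[OF inf \<Xi>poly _ \<Xi>supp]) (use Yne[of j] Y_def in auto)
  have in_Y: "(\<lambda>i. c * \<Theta> t i) \<in> Y j" if "(\<lambda>i. c * \<Theta> t i) \<in> pts I" "\<And>k. k \<notin> V j \<Longrightarrow> t k = 0" for c t j
  proof -
    have "(\<lambda>k. if k \<in> V j then case_option c t (Some k) else 0) = t" using that(2) by auto
    then have "\<Xi> j (case_option c t) = (\<lambda>i. c * \<Theta> t i)" by (simp add: \<Xi>_def)
    then show ?thesis using that(1) unfolding Y_def by (metis IntI rangeI)
  qed
  have Ymono: "Y j \<subseteq> Y (Suc j)" for j
  proof
    fix x assume "x \<in> Y j"
    then obtain t where "x = \<Xi> j t" "x \<in> pts I" unfolding Y_def by blast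
    then show "x \<in> Y (Suc j)" using Vmono[of j] unfolding \<Xi>_def by (auto intro!: in_Y)
  qed
  have Yscale: "(\<lambda>i. c * x i) \<in> Y j" if xY: "x \<in> Y j" and c0: "c \<noteq> 0" for x c j
  proof -
    obtain t where t: "x = \<Xi> j t" "x \<in> pts I" using xY unfolding Y_def by blast
    then have "(\<lambda>i. c * x i) = \<Xi> j (t(None := c * t None))"
      by (simp add: \<Xi>_def mult.assoc cong: if_cong)
    moreover have "(\<lambda>i. c * x i) \<in> pts I" using t(2) c0 by (auto simp: pts_def fun_eq_iff)
    ultimately show ?thesis unfolding Y_def by (metis IntI rangeI)
  qed
  \<comment> \<open>The base vector joins the tangent vectors as the direction of scaling.\<close>
  define v where "v = case_option (\<Theta> (\<lambda>_. 0)) w"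
  have fJ: "finite (insert None (Some ` J))" using J by simp
  have "\<exists>\<phi>. \<forall>k\<in>insert None (Some ` J). \<forall>m\<in>insert None (Some ` J).
      (\<Sum>l\<in>I. \<phi> k l * v m l) = (if k = m then 1 else 0)"
  proof (rule dual_functionals[OF I fJ])
    fix c assume *: "\<forall>l\<in>I. (\<Sum>k\<in>insert None (Some ` J). c k * v k l) = 0"
    have "c None * \<Theta> (\<lambda>_. 0) l + (\<Sum>k\<in>J. c (Some k) * w k l) = 0" if "l \<in> I" for l
      using *[rule_format, OF that] J by (simp add: v_def sum.reindex)
    then show "\<forall>k\<in>insert None (Some ` J). c k = 0"
      using indep[of "c None" "\<lambda>k. c (Some k)"] by auto
  qed
  then obtain \<phi> where \<phi>: "\<And>k m. k \<in> insert None (Some ` J) \<Longrightarrow> m \<in> insert None (Some ` J) \<Longrightarrow>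
      (\<Sum>l\<in>I. \<phi> k l * v m l) = (if k = m then 1 else 0)" by blast
  have strict: "Z j \<noteq> Z (Suc j)" if j: "j < card J" for j
  proof
    assume eq: "Z j = Z (Suc j)"
    define R where "R = insert None (Some ` V (Suc j))"
    have R: "finite R" "card R = Suc (Suc j)"
      using V[of "Suc j"] j by (auto simp: R_def card_image)
    have P: "finite (insert None (Some ` V j))" "card (insert None (Some ` V j)) = Suc j"
      using V[of j] j by (auto simp: card_image)
    define F where "F r x = (\<Sum>l\<in>I. \<phi> r l * x l)" for r x
    have "(\<lambda>t. F r (\<Xi> j t)) \<in> polyfun (insert None (Some ` V j))" for r
      unfolding F_def by (intro polyfun_sum polyfun.mult polyfun.const \<Xi>poly)
    then obtain H where H: "H \<in> polyfun R" "\<exists>x. H x \<noteq> 0" "\<forall>t. H (\<lambda>r. F r (\<Xi> j t)) = 0"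
      using polyfun_algebraically_dependent[OF inf R(1) P(1), of "\<lambda>r t. F r (\<Xi> j t)"] R(2) P(2) by auto
    define u where "u x = H (\<lambda>r. F r x)" for x
    have u: "u \<in> polyfun I"
      unfolding u_def[abs_def] F_def
      by (intro polyfun_compose[OF H(1)] polyfun_sum polyfun.mult polyfun.const polyfun.var)
    have "u x = 0" if "x \<in> Y j" for x using that H(3) by (auto simp: Y_def u_def)
    then have "u x = 0" if "x \<in> Z j" for x
      using polyfun_vanish_closure[OF inf I Ysub Yscale u] that unfolding Z_def by blast
    then have uY: "u x = 0" if "x \<in> Y (Suc j)" for x
      using that eq proj_closure_superset[of "Y (Suc j)" I] unfolding Z_def by blast
    \<comment> \<open>\<open>Y j\<close> leaves out the zero vector, but a curve may pass through
      it; the scalar 0 shows that the relation holds there as well.\<close>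
    have "\<Xi> j (\<lambda>_. 0) = (\<lambda>_. 0)" by (simp add: \<Xi>_def)
    then have u0: "u (\<lambda>_. 0) = 0" using H(3) unfolding u_def by metis
    have u\<Theta>: "u (\<lambda>i. c * \<Theta> t i) = 0" if "\<And>k. k \<notin> V (Suc j) \<Longrightarrow> t k = 0" for c t
    proof (cases "(\<lambda>i. c * \<Theta> t i) \<in> pts I")
      case True
      then show ?thesis using uY in_Y that by blast
    next
      case False
      then have "(\<lambda>i. c * \<Theta> t i) = (\<lambda>_. 0)" using supp by (simp add: pts_def)
      then show ?thesis using u0 by simp
    qed
    have "H x = 0" for x
    proof (rule polyfun_eq_0_by_curves[OF inf R(1) H(1)])
      fix y :: "'j option \<Rightarrow> 'k"
      define y' where "y' k = (if k \<in> V (Suc j) then y (Some k) else 0)" for k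
      obtain \<gamma> where \<gamma>: "\<forall>s k. y' k = 0 \<longrightarrow> \<gamma> s k = 0"
        and "\<forall>l\<in>I. \<exists>R. \<forall>s. \<Theta> (\<gamma> s) l = \<Theta> (\<lambda>_. 0) l + s\<^sup>2 * (\<Sum>k\<in>J. y' k * w k l) + s ^ 3 * poly R s"
        using curve[of y'] by blast
      then obtain Q where Q: "\<And>l s. l \<in> I \<Longrightarrow> \<Theta> (\<gamma> s) l = \<Theta> (\<lambda>_. 0) l + s\<^sup>2 * (\<Sum>k\<in>J. y' k * w k l) + s ^ 3 * poly (Q l) s"
        by metis
      define W where "W l = (\<Sum>k\<in>J. y' k * w k l)" for l
      \<comment> \<open>Functional \<open>r\<close> applied to what remains of
        \<open>(1 + s^2 * y None) * \<Theta> (\<gamma> s)\<close> after subtracting the base vector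
        and dividing by \<open>s^2\<close>. By duality its value at 0 is \<open>y r\<close>.\<close>
      define U where "U r = (\<Sum>l\<in>I. smult (\<phi> r l) ([:y None * \<Theta> (\<lambda>_. 0) l + W l:]
          + [:0, 1:] * Q l + [:0, 0, y None * W l:] + [:0, 0, 0, y None:] * Q l))" for r
      have U0: "poly (U r) 0 = y r" if "r \<in> R" for r
      proof -
        have rJ: "r \<in> insert None (Some ` J)" using that V(1)[of "Suc j"] j by (auto simp: R_def)
        have "(\<Sum>l\<in>I. \<phi> r l * W l) = (\<Sum>k\<in>J. y' k * (\<Sum>l\<in>I. \<phi> r l * v (Some k) l))"
          unfolding W_def sum_distrib_left by (subst sum.swap) (simp add: v_def mult_ac)
        also have "\<dots> = (\<Sum>k\<in>J. if r = Some k then y' k else 0)"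
          using rJ by (intro sum.cong) (auto simp: \<phi>)
        also have "\<dots> = (case r of None \<Rightarrow> 0 | Some k \<Rightarrow> y r)"
          using that V(1)[of "Suc j"] j J by (auto simp: R_def y'_def split: option.splits)
        finally have 1: "(\<Sum>l\<in>I. \<phi> r l * W l) = (case r of None \<Rightarrow> 0 | Some k \<Rightarrow> y r)" .
        have "(\<Sum>l\<in>I. \<phi> r l * (y None * \<Theta> (\<lambda>_. 0) l)) = y None * (\<Sum>l\<in>I. \<phi> r l * v None l)"
          by (simp add: v_def sum_distrib_left mult_ac)
        also have "\<dots> = (if r = None then y None else 0)" using \<phi>[OF rJ, of None] by simp
        finally have 2: "(\<Sum>l\<in>I. \<phi> r l * (y None * \<Theta> (\<lambda>_. 0) l)) = (if r = None then y None else 0)" .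
        have "poly (U r) 0 = (\<Sum>l\<in>I. \<phi> r l * (y None * \<Theta> (\<lambda>_. 0) l)) + (\<Sum>l\<in>I. \<phi> r l * W l)"
          by (simp add: U_def poly_sum distrib_left sum.distrib)
        then show ?thesis by (simp add: 1 2 split: option.splits)
      qed
      have FU: "F r (\<lambda>i. (1 + s\<^sup>2 * y None) * \<Theta> (\<gamma> s) i) = F r (\<Theta> (\<lambda>_. 0)) + s\<^sup>2 * poly (U r) s" for r s
      proof -
        have "F r (\<lambda>i. (1 + s\<^sup>2 * y None) * \<Theta> (\<gamma> s) i) = (\<Sum>l\<in>I. \<phi> r l * \<Theta> (\<lambda>_. 0) l +
          s\<^sup>2 * (\<phi> r l * (y None * \<Theta> (\<lambda>_. 0) l + W l + s * poly (Q l) s + s\<^sup>2 * (y None * W l) + s ^ 3 * y None * poly (Q l) s)))"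
          unfolding F_def
          by (intro sum.cong refl) (simp add: Q W_def[symmetric] algebra_simps power2_eq_square power3_eq_cube)
        also have "\<dots> = F r (\<Theta> (\<lambda>_. 0)) + s\<^sup>2 * poly (U r) s"
          unfolding F_def U_def sum.distrib poly_sum sum_distrib_left[symmetric]
          by (intro arg_cong2[of _ _ _ _ "(+)"] arg_cong2[of _ _ _ _ "(*)"] sum.cong refl)
            (simp add: power2_eq_square power3_eq_cube algebra_simps)
        finally show ?thesis .
      qed
      have "u (\<lambda>i. (1 + s\<^sup>2 * y None) * \<Theta> (\<gamma> s) i) = 0" for s
        by (rule u\<Theta>) (use \<gamma> in \<open>auto simp: y'_def\<close>)
      then show "\<exists>V. (\<forall>r\<in>R. poly (V r) 0 = y r) \<and> (\<forall>s. H (\<lambda>r. F r (\<Theta> (\<lambda>_. 0)) + s\<^sup>2 * poly (V r) s) = 0)"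
        using U0 unfolding u_def FU by blast
    qed
    then show False using H(2) by blast
  qed
  have mono: "Z j \<subseteq> Z (Suc j)" for j
    unfolding Z_def
    by (rule proj_closure_least[OF proj_closed_closure[OF Ysub]])
      (use Ymono proj_closure_superset in blast)
  have "Y j \<subseteq> proj_closure I X" for j
    using X unfolding Y_def \<Xi>_def by blast
  then have "Z j \<subseteq> proj_closure I X" for j
    unfolding Z_def by (rule proj_closure_least[OF proj_closed_closure[OF Xp]])
  then show ?thesis using irr mono strict by (intro exI[of _ Z]) blast
qed

lemma proj_dim_eqI:
  assumes "\<exists>Z. (\<forall>j\<le>n. proj_irreducible I (Z j)) \<and> (\<forall>j<n. Z j \<subset> Z (Suc j)) \<and> Z n \<subseteq> proj_closure I X"
    and "\<And>m Z. (\<And>j. j \<le> m \<Longrightarrow> proj_irreducible I (Z j)) \<Longrightarrow> (\<And>j. j < m \<Longrightarrow> Z j \<subset> Z (Suc j)) \<Longrightarrow>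
      Z m \<subseteq> proj_closure I X \<Longrightarrow> m \<le> n"
  shows "proj_dim I X = n"
  unfolding proj_dim_def
  by (rule Greatest_equality) (use assms in blast)+

section \<open>Ternary and binary forms\<close>

definition mon3 :: "nat \<times> nat \<times> nat \<Rightarrow> 'k::field \<times> 'k \<times> 'k \<Rightarrow> 'k" where
  "mon3 m q = fst q ^ fst m * fst (snd q) ^ fst (snd m) * snd (snd q) ^ snd (snd m)"

text \<open>Binary forms in \<open>x1\<close>, \<open>x2\<close> are kept among the ternary ones, so
  that both kinds share one calculus.\<close>

definition bMon :: "nat \<Rightarrow> (nat \<times> nat \<times> nat) set" where
  "bMon d = {m \<in> Mon d. fst m = 0}"

text \<open>Families of forms whose coefficients are polynomial in a parameter \<open>t\<close>;
  \<open>form\<close> is the case of a single form, over an empty set of parameters.\<close>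

definition forms :: "'j set \<Rightarrow> (nat \<times> nat \<times> nat) set \<Rightarrow> (('j \<Rightarrow> 'k::field) \<Rightarrow> 'k \<times> 'k \<times> 'k \<Rightarrow> 'k) set" where
  "forms J A = {f. \<exists>C. (\<forall>m. (\<lambda>t. C t m) \<in> polyfun J) \<and> (\<forall>t q. f t q = (\<Sum>m\<in>A. C t m * mon3 m q))}"

abbreviation form :: "(nat \<times> nat \<times> nat) set \<Rightarrow> ('k::field \<times> 'k \<times> 'k \<Rightarrow> 'k) \<Rightarrow> bool" where
  "form A f \<equiv> (\<lambda>_. f) \<in> forms ({} :: nat set) A"

lemma evalF_eq: "evalF d F q = (\<Sum>m\<in>Mon d. F m * mon3 m q)"
  unfolding evalF_def mon3_def by (cases q) (auto intro!: sum.cong simp: mult.assoc)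

lemma finite_Mon [simp]: "finite (Mon d)"
  by (rule finite_subset[of _ "{..d} \<times> {..d} \<times> {..d}"]) (auto simp: Mon_def)

lemma finite_bMon [simp]: "finite (bMon d)"
  by (simp add: bMon_def)

lemma formsI:
  assumes "\<And>m. (\<lambda>t. C t m) \<in> polyfun J" "\<And>t q. f t q = (\<Sum>m\<in>A. C t m * mon3 m q)"
  shows "f \<in> forms J A"
  using assms unfolding forms_def by blast

lemma forms_zero: "(\<lambda>t q. 0) \<in> forms J A"
  by (rule formsI[of "\<lambda>t m. 0"]) (auto intro: polyfun.const)

lemma forms_add:
  assumes "f \<in> forms J A" "g \<in> forms J A"
  shows "(\<lambda>t q. f t q + g t q) \<in> forms J A"
proof -
  obtain C E where "\<And>m. (\<lambda>t. C t m) \<in> polyfun J" "\<And>t q. f t q = (\<Sum>m\<in>A. C t m * mon3 m q)"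
    "\<And>m. (\<lambda>t. E t m) \<in> polyfun J" "\<And>t q. g t q = (\<Sum>m\<in>A. E t m * mon3 m q)"
    using assms unfolding forms_def by blast
  then show ?thesis
    by (intro formsI[of "\<lambda>t m. C t m + E t m"]) (auto intro: polyfun.add simp: sum.distrib distrib_right)
qed

lemma forms_scale:
  assumes "u \<in> polyfun J" "f \<in> forms J A"
  shows "(\<lambda>t q. u t * f t q) \<in> forms J A"
proof -
  obtain C where "\<And>m. (\<lambda>t. C t m) \<in> polyfun J" "\<And>t q. f t q = (\<Sum>m\<in>A. C t m * mon3 m q)"
    using assms unfolding forms_def by blast
  then show ?thesis
    using assms(1)
    by (intro formsI[of "\<lambda>t m. u t * C t m"]) (auto intro: polyfun.mult simp: sum_distrib_left mult_ac)
qed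

lemma forms_sum:
  "(\<And>x. x \<in> T \<Longrightarrow> f x \<in> forms J A) \<Longrightarrow> (\<lambda>t q. \<Sum>x\<in>T. f x t q) \<in> forms J A"
proof (induction T rule: infinite_finite_induct)
  case (insert x T)
  then have "(\<lambda>t q. f x t q + (\<Sum>x\<in>T. f x t q)) \<in> forms J A" by (intro forms_add) auto
  then show ?case using insert.hyps by simp
qed (auto intro: forms_zero)

lemma forms_mon:
  assumes "m \<in> A" "finite A" shows "(\<lambda>t. mon3 m) \<in> forms J A"
proof (rule formsI[of "\<lambda>t m'. if m' = m then 1 else 0"])
  show "mon3 m q = (\<Sum>m'\<in>A. (if m' = m then 1 else 0) * mon3 m' q)" for q
  proof -
    have "(\<Sum>m'\<in>A. (if m' = m then 1 else 0) * mon3 m' q) = (\<Sum>m'\<in>A. if m' = m then mon3 m q else 0)"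
      by (intro sum.cong) auto
    then show ?thesis using assms by simp
  qed
qed (rule polyfun.const)

lemma forms_expand:
  assumes "f \<in> forms J A"
  obtains C where "\<And>m. (\<lambda>t. C t m) \<in> polyfun J" "f = (\<lambda>t q. \<Sum>m\<in>A. C t m * mon3 m q)"
  using assms unfolding forms_def by blast

lemma forms_subset:
  assumes "f \<in> forms J A" "A \<subseteq> B" "finite B" shows "f \<in> forms J B"
proof -
  obtain C where C: "\<And>m. (\<lambda>t. C t m) \<in> polyfun J" "f = (\<lambda>t q. \<Sum>m\<in>A. C t m * mon3 m q)"
    using assms(1) by (rule forms_expand) blast
  show ?thesis
    unfolding C(2) using assms by (intro forms_sum forms_scale C(1) forms_mon) auto
qed

lemma forms_uminus: "f \<in> forms J A \<Longrightarrow> (\<lambda>t q. - f t q) \<in> forms J A"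
  using forms_scale[OF polyfun.const[of "-1"]] by fastforce

lemma forms_diff: "f \<in> forms J A \<Longrightarrow> g \<in> forms J A \<Longrightarrow> (\<lambda>t q. f t q - g t q) \<in> forms J A"
  using forms_add[OF _ forms_uminus] by fastforce

definition madd :: "nat \<times> nat \<times> nat \<Rightarrow> nat \<times> nat \<times> nat \<Rightarrow> nat \<times> nat \<times> nat" where
  "madd m n = (fst m + fst n, fst (snd m) + fst (snd n), snd (snd m) + snd (snd n))"

lemma mon3_madd: "mon3 (madd m n) q = mon3 m q * mon3 n q"
  by (simp add: mon3_def madd_def power_add mult_ac)

lemma forms_mult_aux:
  assumes "f \<in> forms J A" "g \<in> forms J B" "finite C"
    and sub: "\<And>m n. m \<in> A \<Longrightarrow> n \<in> B \<Longrightarrow> madd m n \<in> C"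
  shows "(\<lambda>t q. f t q * g t q) \<in> forms J C"
proof -
  obtain X where X: "\<And>m. (\<lambda>t. X t m) \<in> polyfun J" "f = (\<lambda>t q. \<Sum>m\<in>A. X t m * mon3 m q)"
    using assms(1) by (rule forms_expand) blast
  obtain Y where Y: "\<And>m. (\<lambda>t. Y t m) \<in> polyfun J" "g = (\<lambda>t q. \<Sum>m\<in>B. Y t m * mon3 m q)"
    using assms(2) by (rule forms_expand) blast
  have "(\<lambda>t q. f t q * g t q) = (\<lambda>t q. \<Sum>m\<in>A. \<Sum>n\<in>B. (X t m * Y t n) * mon3 (madd m n) q)"
    unfolding X(2) Y(2) sum_product by (simp add: mon3_madd mult_ac)
  also have "\<dots> \<in> forms J C"
    using assms(3) sub by (intro forms_sum forms_scale[OF polyfun.mult[OF X(1) Y(1)]] forms_mon)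
  finally show ?thesis .
qed

lemma madd_Mon: "m \<in> Mon d \<Longrightarrow> n \<in> Mon e \<Longrightarrow> madd m n \<in> Mon (d + e)"
  by (auto simp: Mon_def madd_def)

lemma madd_bMon: "m \<in> bMon d \<Longrightarrow> n \<in> bMon e \<Longrightarrow> madd m n \<in> bMon (d + e)"
  by (auto simp: Mon_def bMon_def madd_def)

lemma forms_mult: "f \<in> forms J (Mon d) \<Longrightarrow> g \<in> forms J (Mon e) \<Longrightarrow> (\<lambda>t q. f t q * g t q) \<in> forms J (Mon (d + e))"
  by (rule forms_mult_aux[OF _ _ finite_Mon madd_Mon])

lemma bforms_mult: "f \<in> forms J (bMon d) \<Longrightarrow> g \<in> forms J (bMon e) \<Longrightarrow> (\<lambda>t q. f t q * g t q) \<in> forms J (bMon (d + e))"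
  by (rule forms_mult_aux[OF _ _ finite_bMon madd_bMon])

lemma bforms_forms: "f \<in> forms J (bMon d) \<Longrightarrow> f \<in> forms J (Mon d)"
  by (rule forms_subset) (auto simp: bMon_def)

lemma mon3_simps [simp]:
  "mon3 (0, 0, 0) q = 1" "mon3 (Suc 0, 0, 0) q = fst q" "mon3 (0, Suc 0, 0) q = fst (snd q)"
  "mon3 (0, 0, Suc 0) q = snd (snd q)"
  by (simp_all add: mon3_def)

lemma forms_const: "u \<in> polyfun J \<Longrightarrow> (\<lambda>t q. u t) \<in> forms J (bMon 0)"
  using forms_scale[of u J "\<lambda>_. mon3 (0, 0, 0)"] forms_mon[of "(0, 0, 0)" "bMon 0" J]
  by (simp add: Mon_def bMon_def)

lemma forms_blinear:
  assumes "u \<in> polyfun J" "v \<in> polyfun J"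
  shows "(\<lambda>t q. u t * fst (snd q) + v t * snd (snd q)) \<in> forms J (bMon 1)"
proof -
  have "(\<lambda>t q. u t * mon3 (0, Suc 0, 0) q + v t * mon3 (0, 0, Suc 0) q) \<in> forms J (bMon 1)"
    using assms by (intro forms_add forms_scale forms_mon finite_bMon) (auto simp: Mon_def bMon_def)
  then show ?thesis by simp
qed

lemma forms_linear:
  assumes "u \<in> polyfun J" "v \<in> polyfun J" "w \<in> polyfun J"
  shows "(\<lambda>t q. u t * fst q + v t * fst (snd q) + w t * snd (snd q)) \<in> forms J (Mon 1)"
proof -
  have "(\<lambda>t q. u t * mon3 (Suc 0, 0, 0) q + v t * mon3 (0, Suc 0, 0) q + w t * mon3 (0, 0, Suc 0) q) \<in> forms J (Mon 1)"
    using assms by (intro forms_add forms_scale forms_mon finite_Mon) (auto simp: Mon_def)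
  then show ?thesis by simp
qed

lemma forms_prod:
  "finite T \<Longrightarrow> (\<And>x. x \<in> T \<Longrightarrow> f x \<in> forms J (Mon 1)) \<Longrightarrow> (\<lambda>t q. \<Prod>x\<in>T. f x t q) \<in> forms J (Mon (card T))"
proof (induction T rule: finite_induct)
  case empty
  show ?case using bforms_forms[OF forms_const[OF polyfun.const[of 1]]] by simp
next
  case (insert x T)
  then have "(\<lambda>t q. f x t q * (\<Prod>x\<in>T. f x t q)) \<in> forms J (Mon (1 + card T))" by (intro forms_mult) auto
  then show ?case using insert.hyps by simp
qed

lemma forms_power:
  assumes "f \<in> forms J (Mon 1)" shows "(\<lambda>t q. f t q ^ n) \<in> forms J (Mon n)"
  using forms_prod[of "{..<n}" "\<lambda>_. f"] assms by simp

lemma bforms_power: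
  assumes "f \<in> forms J (bMon 1)" shows "(\<lambda>t q. f t q ^ n) \<in> forms J (bMon n)"
proof (induction n)
  case 0
  show ?case using forms_const[OF polyfun.const[of 1]] by simp
next
  case (Suc n)
  show ?case using bforms_mult[OF assms Suc] by simp
qed

lemma form_forms: 
  assumes "form A f" shows "(\<lambda>_. f) \<in> forms J A"
proof -
  obtain C where C: "\<And>m. (\<lambda>t. C t m) \<in> polyfun ({} :: nat set)" "(\<lambda>_. f) = (\<lambda>t q. \<Sum>m\<in>A. C t m * mon3 m q)"
    using assms by (rule forms_expand) blast
  have "f = (\<lambda>q. \<Sum>m\<in>A. C (\<lambda>_. 0) m * mon3 m q)" using C(2) by meson
  then show ?thesis by (intro formsI[of "\<lambda>_. C (\<lambda>_. 0)"] polyfun.const) simp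
qed

lemma forms_form:
  assumes "f \<in> forms J A" shows "form A (f t)"
proof -
  obtain C where "f = (\<lambda>t q. \<Sum>m\<in>A. C t m * mon3 m q)"
    using assms by (rule forms_expand) blast
  then show ?thesis by (intro formsI[of "\<lambda>_. C t"] polyfun.const) simp
qed

lemma form_expand:
  assumes "form A f" obtains c where "\<And>q. f q = (\<Sum>m\<in>A. c m * mon3 m q)"
  using assms by (elim forms_expand) meson

text \<open>Kronecker substitution: \<open>(s^(d+1), s, 1)\<close> sends distinct monomials of
  degree \<open>d\<close> to distinct powers of \<open>s\<close>, because the exponent of
  \<open>x1\<close> is at most \<open>d\<close>.\<close>

lemma form_coeff_0:
  fixes c :: "nat \<times> nat \<times> nat \<Rightarrow> 'k::field"
  assumes inf: "infinite (UNIV :: 'k set)" and "A \<subseteq> Mon d"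
    and z: "\<And>q. (\<Sum>m\<in>A. c m * mon3 m q) = 0" and m: "m \<in> A"
  shows "c m = 0"
proof -
  have fin: "finite A" using assms(2) finite_Mon finite_subset by blast
  define e where "e m = fst m * Suc d + fst (snd m)" for m :: "nat \<times> nat \<times> nat"
  have e: "e m = e n \<longleftrightarrow> m = n" if "m \<in> A" "n \<in> A" for m n
  proof
    assume "e m = e n"
    moreover have "e n div Suc d = fst n \<and> e n mod Suc d = fst (snd n)" if "n \<in> A" for n
    proof -
      have "fst (snd n) < Suc d" using that assms(2) by (auto simp: Mon_def)
      then show ?thesis unfolding e_def by (simp only: div_mult_self3 mod_mult_self3 div_less mod_less) auto
    qed
    ultimately have "fst m = fst n" "fst (snd m) = fst (snd n)" using that by metis+
    moreover have "m \<in> Mon d" "n \<in> Mon d" using that assms(2) by auto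
    ultimately show "m = n" by (cases m, cases n) (auto simp: Mon_def)
  qed simp
  define p where "p = (\<Sum>m\<in>A. monom (c m) (e m))"
  have "poly p s = 0" for s
  proof -
    have "mon3 m (s ^ Suc d, s, 1) = s ^ e m" for m
      by (simp add: mon3_def e_def power_add flip: power_mult power_Suc) (simp add: mult.commute)
    then show ?thesis using z[of "(s ^ Suc d, s, 1)"] by (simp add: p_def poly_sum poly_monom)
  qed
  then have "p = 0" by (intro poly_eq_0_cofinite[OF inf, of "{}"]) auto
  then have "0 = coeff p (e m)" by simp
  also have "\<dots> = (\<Sum>n\<in>A. if n = m then c m else 0)"
    unfolding p_def coeff_sum using e m by (intro sum.cong) auto
  also have "\<dots> = c m" using m fin by simp
  finally show ?thesis by simp
qed

text \<open>Passes from a form as a function to its vector of coefficients, unique over an infinite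
  field. Vanishing outside \<open>Mon d\<close> is the convention of \<open>pts\<close>.\<close>

definition cf :: "nat \<Rightarrow> ('k::field \<times> 'k \<times> 'k \<Rightarrow> 'k) \<Rightarrow> nat \<times> nat \<times> nat \<Rightarrow> 'k" where
  "cf d f = (THE F. (\<forall>m. m \<notin> Mon d \<longrightarrow> F m = 0) \<and> (\<forall>q. f q = evalF d F q))"

lemma cf_eqI:
  fixes F :: "nat \<times> nat \<times> nat \<Rightarrow> 'k::field"
  assumes inf: "infinite (UNIV :: 'k set)"
    and F: "\<And>m. m \<notin> Mon d \<Longrightarrow> F m = 0" "\<And>q. f q = evalF d F q"
  shows "cf d f = F"
  unfolding cf_def
proof (rule the_equality)
  fix G assume G: "(\<forall>m. m \<notin> Mon d \<longrightarrow> G m = 0) \<and> (\<forall>q. f q = evalF d G q)"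
  have "(\<Sum>m\<in>Mon d. (G m - F m) * mon3 m q) = 0" for q
    using G[THEN conjunct2, rule_format, of q] F(2)[of q]
    by (simp add: evalF_eq left_diff_distrib sum_subtractf)
  then have "G m - F m = 0" if "m \<in> Mon d" for m
    using form_coeff_0[OF inf subset_refl, where c = "\<lambda>m. G m - F m"] that by blast
  then show "G = F" using G F(1) by (intro ext) (metis eq_iff_diff_eq_0)
qed (use F in auto)

lemma cf_forms:
  fixes f :: "('j \<Rightarrow> 'k::field) \<Rightarrow> 'k \<times> 'k \<times> 'k \<Rightarrow> 'k"
  assumes inf: "infinite (UNIV :: 'k set)" and f: "f \<in> forms J (Mon d)"
  shows "(\<lambda>t. cf d (f t) m) \<in> polyfun J" "\<And>q. evalF d (cf d (f t)) q = f t q"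
    "m \<notin> Mon d \<Longrightarrow> cf d (f t) m = 0"
proof -
  obtain C where C: "\<And>m. (\<lambda>t. C t m) \<in> polyfun J" "f = (\<lambda>t q. \<Sum>m\<in>Mon d. C t m * mon3 m q)"
    using f by (rule forms_expand) blast
  define C' where "C' t m = (if m \<in> Mon d then C t m else 0)" for t m
  have eq: "cf d (f t) = C' t" for t
    by (rule cf_eqI[OF inf]) (auto simp: C'_def C(2) evalF_eq)
  show "(\<lambda>t. cf d (f t) m) \<in> polyfun J"
    unfolding eq C'_def using C(1) by (cases "m \<in> Mon d") (auto intro: polyfun.const)
  show "evalF d (cf d (f t)) q = f t q" for q
  proof -
    have "f t q = (\<Sum>m\<in>Mon d. C t m * mon3 m q)" by (simp add: C(2))
    then show ?thesis unfolding eq evalF_eq by (simp add: C'_def)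
  qed
  show "m \<notin> Mon d \<Longrightarrow> cf d (f t) m = 0"
    by (simp add: eq C'_def)
qed

lemma cf_form:
  fixes f :: "'k::field \<times> 'k \<times> 'k \<Rightarrow> 'k"
  assumes "infinite (UNIV :: 'k set)" "form (Mon d) f"
  shows "evalF d (cf d f) q = f q" "m \<notin> Mon d \<Longrightarrow> cf d f m = 0"
  using cf_forms(2,3)[OF assms] by blast+

section \<open>Counting monomials and dividing forms by linear forms\<close>

lemma Mon_Suc: "Mon (Suc d) = bMon (Suc d) \<union> (\<lambda>m. madd (Suc 0, 0, 0) m) ` Mon d"
proof (intro equalityI subsetI)
  fix m assume m: "m \<in> Mon (Suc d)"
  obtain a b c where abc: "m = (a, b, c)" by (cases m)
  show "m \<in> bMon (Suc d) \<union> (\<lambda>m. madd (Suc 0, 0, 0) m) ` Mon d"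
  proof (cases a)
    case (Suc a')
    then have "m = madd (Suc 0, 0, 0) (a', b, c)" "(a', b, c) \<in> Mon d"
      using m abc by (auto simp: madd_def Mon_def)
    then show ?thesis by blast
  qed (use m abc in \<open>auto simp: bMon_def\<close>)
qed (auto simp: bMon_def madd_def Mon_def)

lemma bMon_Suc:
  "bMon (Suc d) = insert (0, 0, Suc d) ((\<lambda>m. madd (0, Suc 0, 0) m) ` bMon d)"
  "bMon (Suc d) = insert (0, Suc d, 0) ((\<lambda>m. madd (0, 0, Suc 0) m) ` bMon d)"
proof -
  have "m \<in> insert (0, 0, Suc d) ((\<lambda>m. madd (0, Suc 0, 0) m) ` bMon d)"
    and "m \<in> insert (0, Suc d, 0) ((\<lambda>m. madd (0, 0, Suc 0) m) ` bMon d)" if m: "m \<in> bMon (Suc d)" for m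
  proof -
    obtain b c where bc: "m = (0, b, c)" "b + c = Suc d" using m by (cases m) (auto simp: bMon_def Mon_def)
    show "m \<in> insert (0, 0, Suc d) ((\<lambda>m. madd (0, Suc 0, 0) m) ` bMon d)"
    proof (cases b)
      case (Suc b')
      then have "m = madd (0, Suc 0, 0) (0, b', c)" "(0, b', c) \<in> bMon d"
        using bc by (auto simp: madd_def Mon_def bMon_def)
      then show ?thesis by blast
    qed (use bc in auto)
    show "m \<in> insert (0, Suc d, 0) ((\<lambda>m. madd (0, 0, Suc 0) m) ` bMon d)"
    proof (cases c)
      case (Suc c')
      then have "m = madd (0, 0, Suc 0) (0, b, c')" "(0, b, c') \<in> bMon d"
        using bc by (auto simp: madd_def Mon_def bMon_def)
      then show ?thesis by blast
    qed (use bc in auto)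
  qed
  note sub = this
  show "bMon (Suc d) = insert (0, 0, Suc d) ((\<lambda>m. madd (0, Suc 0, 0) m) ` bMon d)"
    by (intro equalityI subsetI, erule sub(1)) (auto simp: bMon_def madd_def Mon_def)
  show "bMon (Suc d) = insert (0, Suc d, 0) ((\<lambda>m. madd (0, 0, Suc 0) m) ` bMon d)"
    by (intro equalityI subsetI, erule sub(2)) (auto simp: bMon_def madd_def Mon_def)
qed

lemma inj_madd: "inj_on (madd k) A"
  by (auto simp: inj_on_def madd_def prod_eq_iff)

lemma card_bMon: "card (bMon d) = d + 1"
proof (induction d)
  case 0
  have "bMon 0 = {(0, 0, 0)}" by (auto simp: bMon_def Mon_def)
  then show ?case by simp
next
  case (Suc d)
  have "(0, 0, Suc d) \<notin> madd (0, Suc 0, 0) ` bMon d" by (auto simp: madd_def)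
  then show ?case using Suc by (simp add: bMon_Suc(1) card_image[OF inj_madd])
qed

lemma card_Mon: "card (Mon d) = (d + 2) choose 2"
proof (induction d)
  case 0
  have "Mon 0 = {(0, 0, 0)}" by (auto simp: Mon_def)
  then show ?case by (simp add: numeral_2_eq_2)
next
  case (Suc d)
  have "bMon (Suc d) \<inter> madd (Suc 0, 0, 0) ` Mon d = {}" by (auto simp: madd_def bMon_def)
  then have "card (Mon (Suc d)) = (d + 2) + card (Mon d)"
    by (simp add: Mon_Suc card_Un_disjoint card_image[OF inj_madd] card_bMon)
  also have "\<dots> = (d + 2) + ((d + 2) choose 2)" using Suc by simp
  also have "\<dots> = (Suc d + 2) choose 2" by (simp add: numeral_2_eq_2)
  finally show ?case .
qed

lemma form_split:
  assumes "form (Mon (Suc d)) f"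
  shows "\<exists>g r. form (Mon d) g \<and> form (bMon (Suc d)) r \<and> (\<forall>q. f q = fst q * g q + r q)"
proof -
  obtain c where c: "\<And>q. f q = (\<Sum>m\<in>Mon (Suc d). c m * mon3 m q)"
    using assms by (rule form_expand) blast
  define g where "g q = (\<Sum>m\<in>Mon d. c (madd (Suc 0, 0, 0) m) * mon3 m q)" for q
  define r where "r q = (\<Sum>m\<in>bMon (Suc d). c m * mon3 m q)" for q
  have "bMon (Suc d) \<inter> madd (Suc 0, 0, 0) ` Mon d = {}" by (auto simp: madd_def bMon_def)
  then have "f q = fst q * g q + r q" for q
    unfolding c Mon_Suc g_def r_def
    by (subst sum.union_disjoint)
      (auto simp: sum.reindex[OF inj_madd] mon3_madd sum_distrib_left mult_ac intro!: sum.cong)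
  moreover have "form (Mon d) g" "form (bMon (Suc d)) r"
    unfolding g_def[abs_def] r_def[abs_def]
    by (intro forms_sum forms_scale polyfun.const forms_mon finite_Mon finite_bMon; assumption)+
  ultimately show ?thesis by blast
qed

lemma bform_split:
  assumes "form (bMon (Suc d)) f"
  shows "\<exists>g \<rho>. form (bMon d) g \<and> (\<forall>q. f q = fst (snd q) * g q + \<rho> * snd (snd q) ^ Suc d)"
    and "\<exists>g \<rho>. form (bMon d) g \<and> (\<forall>q. f q = snd (snd q) * g q + \<rho> * fst (snd q) ^ Suc d)"
proof -
  obtain c where c: "\<And>q. f q = (\<Sum>m\<in>bMon (Suc d). c m * mon3 m q)"
    using assms by (rule form_expand) blast
  have g: "form (bMon d) (\<lambda>q. \<Sum>m\<in>bMon d. c (madd k m) * mon3 m q)" for k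
    by (intro forms_sum forms_scale polyfun.const forms_mon finite_bMon)
  have "(0, 0, Suc d) \<notin> madd (0, Suc 0, 0) ` bMon d" by (auto simp: madd_def)
  then have 1: "f q = fst (snd q) * (\<Sum>m\<in>bMon d. c (madd (0, Suc 0, 0) m) * mon3 m q)
    + c (0, 0, Suc d) * snd (snd q) ^ Suc d" for q
    unfolding c bMon_Suc(1)
    by (subst sum.insert)
      (auto simp: sum.reindex[OF inj_madd] mon3_madd sum_distrib_left mult_ac mon3_def[of "(0, 0, Suc d)"] intro!: sum.cong)
  then show "\<exists>g \<rho>. form (bMon d) g \<and> (\<forall>q. f q = fst (snd q) * g q + \<rho> * snd (snd q) ^ Suc d)"
    using g by blast
  have "(0, Suc d, 0) \<notin> madd (0, 0, Suc 0) ` bMon d" by (auto simp: madd_def)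
  then have 2: "f q = snd (snd q) * (\<Sum>m\<in>bMon d. c (madd (0, 0, Suc 0) m) * mon3 m q)
    + c (0, Suc d, 0) * fst (snd q) ^ Suc d" for q
    unfolding c bMon_Suc(2)
    by (subst sum.insert)
      (auto simp: sum.reindex[OF inj_madd] mon3_madd sum_distrib_left mult_ac mon3_def[of "(0, Suc d, 0)"] intro!: sum.cong)
  then show "\<exists>g \<rho>. form (bMon d) g \<and> (\<forall>q. f q = snd (snd q) * g q + \<rho> * fst (snd q) ^ Suc d)"
    using g by blast
qed

text \<open>The linear form is monic in \<open>x0\<close>, so division by it leaves a remainder free
  of \<open>x0\<close>, which is the restriction of \<open>f\<close> to the line in the coordinates
  \<open>x1\<close>, \<open>x2\<close>.\<close>

lemma form_division:
  fixes b c :: "'k::field"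
  assumes "form (Mon (Suc d)) f"
  shows "\<exists>g r. form (Mon d) g \<and> form (bMon (Suc d)) r
    \<and> (\<forall>q. f q = (fst q + b * fst (snd q) + c * snd (snd q)) * g q + r q)"
  using assms
proof (induction d arbitrary: f)
  case 0
  then obtain g r where gr: "form (Mon 0) g" "form (bMon (Suc 0)) r" "\<forall>q. f q = fst q * g q + r q"
    using form_split by blast
  have "Mon 0 = bMon 0" by (auto simp: Mon_def bMon_def)
  then have "form (bMon (Suc 0)) (\<lambda>q. (b * fst (snd q) + c * snd (snd q)) * g q)"
    using bforms_mult[OF forms_blinear[OF polyfun.const polyfun.const]] gr(1) by fastforce
  then have "form (bMon (Suc 0)) (\<lambda>q. r q - (b * fst (snd q) + c * snd (snd q)) * g q)"
    by (rule forms_diff[OF gr(2)])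
  then show ?case
    using gr(1,3)
    by (intro exI[of _ g] exI[of _ "\<lambda>q. r q - (b * fst (snd q) + c * snd (snd q)) * g q"])
      (auto simp: algebra_simps)
next
  case (Suc d)
  then obtain g r where gr: "form (Mon (Suc d)) g" "form (bMon (Suc (Suc d))) r" "\<forall>q. f q = fst q * g q + r q"
    using form_split by blast
  obtain g1 r1 where gr1: "form (Mon d) g1" "form (bMon (Suc d)) r1"
    "\<forall>q. g q = (fst q + b * fst (snd q) + c * snd (snd q)) * g1 q + r1 q"
    using Suc.IH[OF gr(1)] by blast
  have "form (bMon (Suc (Suc d))) (\<lambda>q. (b * fst (snd q) + c * snd (snd q)) * r1 q)"
    using bforms_mult[OF forms_blinear[OF polyfun.const polyfun.const] gr1(2)] by fastforce
  then have 1: "form (bMon (Suc (Suc d))) (\<lambda>q. r q - (b * fst (snd q) + c * snd (snd q)) * r1 q)"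
    by (rule forms_diff[OF gr(2)])
  have "form (Mon 1) (\<lambda>q :: 'k \<times> 'k \<times> 'k. fst q)"
    using forms_linear[OF polyfun.const[of 1] polyfun.const[of 0] polyfun.const[of 0]] by simp
  from forms_mult[OF this gr1(1)] have "form (Mon (Suc d)) (\<lambda>q. fst q * g1 q + r1 q)"
    by (intro forms_add[OF _ bforms_forms[OF gr1(2)]]) simp
  then show ?case
    using 1 gr(3) gr1(3)
    by (intro exI[of _ "\<lambda>q. fst q * g1 q + r1 q"]
        exI[of _ "\<lambda>q. r q - (b * fst (snd q) + c * snd (snd q)) * r1 q"]) (auto simp: algebra_simps)
qed

lemma bform_division:
  fixes \<beta> \<gamma> :: "'k::field"
  assumes "form (bMon (Suc d)) f" and b: "\<beta> \<noteq> 0"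
  shows "\<exists>g \<rho>. form (bMon d) g
    \<and> (\<forall>q. f q = (\<beta> * fst (snd q) + \<gamma> * snd (snd q)) * g q + \<rho> * snd (snd q) ^ Suc d)"
  using assms(1)
proof (induction d arbitrary: f)
  case 0
  then obtain g \<rho> where g: "form (bMon 0) g" "\<forall>q. f q = fst (snd q) * g q + \<rho> * snd (snd q) ^ Suc 0"
    using bform_split(1) by blast
  have "bMon 0 = {(0, 0, 0)}" by (auto simp: Mon_def bMon_def)
  then obtain k where k: "\<And>q. g q = k" using g(1) by (elim form_expand) simp
  have "form (bMon 0) (\<lambda>q. k / \<beta>)" by (rule forms_const) (rule polyfun.const)
  then show ?case
    using g(2) k b by (intro exI[of _ "\<lambda>q. k / \<beta>"] exI[of _ "\<rho> - \<gamma> * k / \<beta>"]) (auto simp: field_simps)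
next
  case (Suc d)
  then obtain g \<rho> where g: "form (bMon (Suc d)) g" "\<forall>q. f q = fst (snd q) * g q + \<rho> * snd (snd q) ^ Suc (Suc d)"
    using bform_split(1) by blast
  obtain h \<rho>1 where h: "form (bMon d) h"
    "\<forall>q. g q = (\<beta> * fst (snd q) + \<gamma> * snd (snd q)) * h q + \<rho>1 * snd (snd q) ^ Suc d"
    using Suc.IH[OF g(1)] by blast
  have x1: "form (bMon 1) (\<lambda>q. fst (snd q))" and x2: "form (bMon 1) (\<lambda>q. snd (snd q))"
    using forms_blinear[OF polyfun.const[of 1] polyfun.const[of 0]]
      forms_blinear[OF polyfun.const[of 0] polyfun.const[of 1]] by auto
  have "form (bMon (Suc d)) (\<lambda>q. fst (snd q) * h q + \<rho>1 / \<beta> * snd (snd q) ^ Suc d)"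
    using bforms_mult[OF x1 h(1)] by (intro forms_add forms_scale polyfun.const bforms_power x2) simp
  then show ?case
    using g(2) h(2) b
    by (intro exI[of _ "\<lambda>q. fst (snd q) * h q + \<rho>1 / \<beta> * snd (snd q) ^ Suc d"] exI[of _ "\<rho> - \<gamma> * \<rho>1 / \<beta>"])
      (auto simp: field_simps)
qed

lemma bform_root:
  fixes \<beta> \<gamma> :: "'k::field"
  assumes f: "form (bMon (Suc d)) f" and nz: "\<beta> \<noteq> 0 \<or> \<gamma> \<noteq> 0" and z: "f (0, - \<gamma>, \<beta>) = 0"
  shows "\<exists>g. form (bMon d) g \<and> (\<forall>q. f q = (\<beta> * fst (snd q) + \<gamma> * snd (snd q)) * g q)"
proof (cases "\<beta> = 0")
  case False
  then obtain g \<rho> where g: "form (bMon d) g"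
    "\<forall>q. f q = (\<beta> * fst (snd q) + \<gamma> * snd (snd q)) * g q + \<rho> * snd (snd q) ^ Suc d"
    using bform_division[OF f] by blast
  then have "\<rho> = 0" using z False by simp
  then show ?thesis using g by auto
next
  case True
  then have c: "\<gamma> \<noteq> 0" using nz by simp
  obtain g \<rho> where g: "form (bMon d) g" "\<forall>q. f q = snd (snd q) * g q + \<rho> * fst (snd q) ^ Suc d"
    using bform_split(2)[OF f] by blast
  then have "\<rho> = 0" using z True c by simp
  moreover have "form (bMon d) (\<lambda>q. 1 / \<gamma> * g q)" by (intro forms_scale polyfun.const g(1))
  ultimately show ?thesis using g(2) True c by (intro exI[of _ "\<lambda>q. 1 / \<gamma> * g q"]) auto
qed

text \<open>The linear factors are pairwise not proportional, so dividing by one of them keeps the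
  zeros of the others.\<close>

lemma bform_roots:
  fixes \<beta> \<gamma> :: "'a \<Rightarrow> 'k::field"
  assumes "finite T" "form (bMon (d + card T)) f"
    and "\<And>i. i \<in> T \<Longrightarrow> \<beta> i \<noteq> 0 \<or> \<gamma> i \<noteq> 0"
    and "\<And>i j. i \<in> T \<Longrightarrow> j \<in> T \<Longrightarrow> i \<noteq> j \<Longrightarrow> \<beta> i * \<gamma> j \<noteq> \<beta> j * \<gamma> i"
    and "\<And>i. i \<in> T \<Longrightarrow> f (0, - \<gamma> i, \<beta> i) = 0"
  shows "\<exists>g. form (bMon d) g \<and> (\<forall>q. f q = g q * (\<Prod>i\<in>T. \<beta> i * fst (snd q) + \<gamma> i * snd (snd q)))"
  using assms
proof (induction T arbitrary: f rule: finite_induct)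
  case (insert x T)
  have "form (bMon (Suc (d + card T))) f" using insert.prems(1) insert.hyps by simp
  then obtain h where h: "form (bMon (d + card T)) h" "\<forall>q. f q = (\<beta> x * fst (snd q) + \<gamma> x * snd (snd q)) * h q"
    using bform_root insert.prems(2)[of x] insert.prems(4)[of x] by blast
  have "h (0, - \<gamma> i, \<beta> i) = 0" if i: "i \<in> T" for i
  proof -
    have "\<beta> x * - \<gamma> i + \<gamma> x * \<beta> i \<noteq> 0"
    proof -
      have "x \<noteq> i" using i insert.hyps by auto
      then have "\<beta> x * \<gamma> i \<noteq> \<beta> i * \<gamma> x" using insert.prems(3)[of x i] i by simp
      then show ?thesis by (simp add: mult.commute)
    qed
    moreover have "(\<beta> x * - \<gamma> i + \<gamma> x * \<beta> i) * h (0, - \<gamma> i, \<beta> i) = 0"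
      using insert.prems(4)[of i] i h(2) by simp
    ultimately show ?thesis by (metis mult_eq_0_iff)
  qed
  then obtain g where "form (bMon d) g" "\<forall>q. h q = g q * (\<Prod>i\<in>T. \<beta> i * fst (snd q) + \<gamma> i * snd (snd q))"
    using insert.IH[OF h(1)] insert.prems by auto
  then show ?case using h(2) insert.hyps by (intro exI[of _ g]) (auto simp: mult_ac)
qed auto

section \<open>Generators of the ideal of a star configuration\<close>

lemma bform_cong:
  assumes "form (bMon d) f" shows "f (x, y, z) = f (x', y, z)"
proof -
  obtain c where "\<And>q. f q = (\<Sum>m\<in>bMon d. c m * mon3 m q)" using assms by (rule form_expand) blast
  then show ?thesis by (auto simp: bMon_def mon3_def intro!: sum.cong)
qed

text \<open>Modulo \<open>g\<close> the two products agree. This lifts a product of lines restricted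
  to the line \<open>g\<close> back to the product of the lines themselves.\<close>

lemma prod_diff_form:
  assumes "finite T" "\<And>i. i \<in> T \<Longrightarrow> form (Mon 1) (f i)" "form (Mon 1) g" "card T = Suc n"
  shows "\<exists>h. form (Mon n) h \<and> (\<forall>q. (\<Prod>i\<in>T. f i q - g q) = (\<Prod>i\<in>T. f i q) + g q * h q)"
  using assms
proof (induction T arbitrary: n rule: finite_induct)
  case (insert x T)
  show ?case
  proof (cases n)
    case 0
    then have "T = {}" using insert by simp
    moreover have "form (Mon 0) (\<lambda>q. - 1)" by (intro bforms_forms forms_const polyfun.const)
    ultimately show ?thesis using 0 by (intro exI[of _ "\<lambda>q. -1"]) simp
  next
    case (Suc k)
    then obtain h where h: "form (Mon k) h" "\<forall>q. (\<Prod>i\<in>T. f i q - g q) = (\<Prod>i\<in>T. f i q) + g q * h q"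
      using insert.IH[of k] insert by auto
    have "form (Mon 1) (\<lambda>q. f x q - g q)" using insert.prems by (intro forms_diff) auto
    from forms_mult[OF this h(1)] have 1: "form (Mon n) (\<lambda>q. (f x q - g q) * h q)" by (simp add: Suc)
    have "form (Mon (card T)) (\<lambda>q. \<Prod>i\<in>T. f i q)" using insert by (intro forms_prod) auto
    moreover have "card T = n" using insert by simp
    ultimately have "form (Mon n) (\<lambda>q. (f x q - g q) * h q - (\<Prod>i\<in>T. f i q))"
      using 1 by (intro forms_diff) auto
    then show ?thesis
      using h(2) insert.hyps
      by (intro exI[of _ "\<lambda>q. (f x q - g q) * h q - (\<Prod>i\<in>T. f i q)"]) (auto simp: algebra_simps)
  qed
qed auto

abbreviation nline :: "(nat \<Rightarrow> 'k::field) \<Rightarrow> (nat \<Rightarrow> 'k) \<Rightarrow> nat \<Rightarrow> 'k \<times> 'k \<times> 'k \<Rightarrow> 'k" where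
  "nline b c i q \<equiv> fst q + b i * fst (snd q) + c i * snd (snd q)"

text \<open>Peel off the lines one at a time: on the last line the curve restricts to a binary form divisible
  by the restrictions of the other lines, and the quotient extends to a form in \<open>x1, x2\<close>.\<close>

lemma star_ideal_generators:
  fixes b c :: "nat \<Rightarrow> 'k::field"
  assumes "form (Mon (d + l)) F"
    and "\<And>i j. i \<le> l \<Longrightarrow> j \<le> l \<Longrightarrow> i \<noteq> j \<Longrightarrow> b i \<noteq> b j \<or> c i \<noteq> c j"
    and "\<And>i j k q. i \<le> l \<Longrightarrow> j \<le> l \<Longrightarrow> k \<le> l \<Longrightarrow> i \<noteq> j \<Longrightarrow> j \<noteq> k \<Longrightarrow> i \<noteq> k \<Longrightarrow> q \<noteq> (0, 0, 0) \<Longrightarrow>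
      nline b c i q = 0 \<Longrightarrow> nline b c j q = 0 \<Longrightarrow> nline b c k q \<noteq> 0"
    and "\<And>i j q. i \<le> l \<Longrightarrow> j \<le> l \<Longrightarrow> i \<noteq> j \<Longrightarrow> q \<noteq> (0, 0, 0) \<Longrightarrow>
      nline b c i q = 0 \<Longrightarrow> nline b c j q = 0 \<Longrightarrow> F q = 0"
  shows "\<exists>a. form (Mon d) (a 0) \<and> (\<forall>i. 0 < i \<longrightarrow> i \<le> l \<longrightarrow> form (bMon d) (a i)) \<and>
    (\<forall>q. F q = (\<Sum>i\<le>l. a i q * (\<Prod>j\<in>{..l} - {i}. nline b c j q)))"
  using assms
proof (induction l arbitrary: F)
  case 0
  then show ?case by (intro exI[of _ "\<lambda>_. F"]) auto
next
  case (Suc l)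
  let ?n = "Suc l"
  have lin: "form (Mon 1) (nline b c i)" for i
    using forms_linear[OF polyfun.const[of 1] polyfun.const[of "b i"] polyfun.const[of "c i"]] by simp
  have "form (Mon (Suc (d + l))) F" using Suc.prems(1) by simp
  then obtain g r where gr: "form (Mon (d + l)) g" "form (bMon (Suc (d + l))) r"
    "\<forall>q. F q = nline b c ?n q * g q + r q"
    using form_division[where b = "b ?n" and c = "c ?n"] by blast
  define \<beta> where "\<beta> j = b j - b ?n" for j
  define \<gamma> where "\<gamma> j = c j - c ?n" for j
  have nl: "nline b c j q = nline b c ?n q + (\<beta> j * fst (snd q) + \<gamma> j * snd (snd q))" for j q
    by (simp add: \<beta>_def \<gamma>_def algebra_simps)
  have diff: "nline b c j q - nline b c ?n q = \<beta> j * fst (snd q) + \<gamma> j * snd (snd q)" for j q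
    by (simp add: \<beta>_def \<gamma>_def algebra_simps)
  \<comment> \<open>Intersection of line \<open>j\<close> with the last line: the zero of the
    difference of their equations, lifted to the last line.\<close>
  define P where "P j = (b ?n * \<gamma> j - c ?n * \<beta> j, - \<gamma> j, \<beta> j)" for j
  have Pn: "nline b c ?n (P j) = 0" for j by (simp add: P_def algebra_simps)
  have Pj: "nline b c j (P j) = 0" for j unfolding nl[where j = j] Pn by (simp add: P_def)
  have bg: "\<beta> j \<noteq> 0 \<or> \<gamma> j \<noteq> 0" if "j \<in> {..l}" for j
    using Suc.prems(2)[of j ?n] that by (auto simp: \<beta>_def \<gamma>_def)
  then have P0: "P j \<noteq> (0, 0, 0)" if "j \<in> {..l}" for j using that by (auto simp: P_def)
  have "\<exists>a. form (bMon d) a \<and> (\<forall>q. r q = a q * (\<Prod>i\<in>{..l}. \<beta> i * fst (snd q) + \<gamma> i * snd (snd q)))"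
  proof (rule bform_roots)
    show "form (bMon (d + card {..l})) r" using gr(2) by simp
    show "\<beta> i * \<gamma> j \<noteq> \<beta> j * \<gamma> i" if ij: "i \<in> {..l}" "j \<in> {..l}" "i \<noteq> j" for i j
    proof
      assume "\<beta> i * \<gamma> j = \<beta> j * \<gamma> i"
      then have "nline b c j (P i) = 0" unfolding nl[where j = j] Pn by (simp add: P_def algebra_simps)
      then show False using Suc.prems(3)[of i ?n j "P i"] Pn Pj P0 ij by auto
    qed
    show "r (0, - \<gamma> j, \<beta> j) = 0" if "j \<in> {..l}" for j
    proof -
      have "F (P j) = 0" using Suc.prems(4)[of j ?n "P j"] Pn Pj P0 that by auto
      then have "r (P j) = 0" using gr(3) Pn[of j] by simp
      then show ?thesis using bform_cong[OF gr(2)] unfolding P_def by metis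
    qed
  qed (use bg in auto)
  then obtain an where an: "form (bMon d) an"
    "\<forall>q. r q = an q * (\<Prod>i\<in>{..l}. nline b c i q - nline b c ?n q)"
    unfolding diff by blast
  obtain h where h: "form (Mon l) h"
    "\<forall>q. (\<Prod>i\<in>{..l}. nline b c i q - nline b c ?n q) = (\<Prod>i\<in>{..l}. nline b c i q) + nline b c ?n q * h q"
    using prod_diff_form[of "{..l}" "nline b c" "nline b c ?n" l] lin by auto
  \<comment> \<open>Replacing the restricted product by the product of the full lines costs
    \<open>an * h\<close> times the last line, which is absorbed into the quotient.\<close>
  define F' where "F' q = g q + an q * h q" for q
  have F: "F q = an q * (\<Prod>i\<le>l. nline b c i q) + nline b c ?n q * F' q" for q
    unfolding F'_def gr(3)[rule_format] an(2)[rule_format] h(2)[rule_format] by (simp add: algebra_simps)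
  have F'form: "form (Mon (d + l)) F'"
    unfolding F'_def[abs_def] by (intro forms_add[OF gr(1)] forms_mult bforms_forms an(1) h(1))
  have F'0: "F' q = 0" if ij: "i \<le> l" "j \<le> l" "i \<noteq> j" and q: "q \<noteq> (0, 0, 0)" "nline b c i q = 0" "nline b c j q = 0" for i j q
  proof -
    have "F q = 0" using Suc.prems(4)[of i j q] ij q by auto
    moreover have "(\<Prod>i\<le>l. nline b c i q) = 0" using ij(1) q(2) by (intro prod_zero) auto
    moreover have "nline b c ?n q \<noteq> 0" using Suc.prems(3)[of i j ?n q] ij q by auto
    ultimately show ?thesis using F[of q] by simp
  qed
  have ih2: "b i \<noteq> b j \<or> c i \<noteq> c j" if "i \<le> l" "j \<le> l" "i \<noteq> j" for i j
    using Suc.prems(2)[OF le_SucI le_SucI] that by blast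
  have ih3: "nline b c k q \<noteq> 0" if "i \<le> l" "j \<le> l" "k \<le> l" "i \<noteq> j" "j \<noteq> k" "i \<noteq> k" "q \<noteq> (0, 0, 0)"
    "nline b c i q = 0" "nline b c j q = 0" for i j k q
    using Suc.prems(3)[OF le_SucI le_SucI le_SucI] that by blast
  have "\<exists>a. form (Mon d) (a 0) \<and> (\<forall>i. 0 < i \<longrightarrow> i \<le> l \<longrightarrow> form (bMon d) (a i)) \<and>
    (\<forall>q. F' q = (\<Sum>i\<le>l. a i q * (\<Prod>j\<in>{..l} - {i}. nline b c j q)))"
  proof (rule Suc.IH[OF F'form])
    show "b i \<noteq> b j \<or> c i \<noteq> c j" if "i \<le> l" "j \<le> l" "i \<noteq> j" for i j
      using that by (rule ih2)
    show "nline b c k q \<noteq> 0" if "i \<le> l" "j \<le> l" "k \<le> l" "i \<noteq> j" "j \<noteq> k" "i \<noteq> k" "q \<noteq> (0, 0, 0)"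
      "nline b c i q = 0" "nline b c j q = 0" for i j k q
      using that by (rule ih3)
    show "F' q = 0" if "i \<le> l" "j \<le> l" "i \<noteq> j" "q \<noteq> (0, 0, 0)" "nline b c i q = 0" "nline b c j q = 0" for i j q
      using that by (rule F'0)
  qed
  then obtain a where a: "form (Mon d) (a 0)" "\<forall>i. 0 < i \<longrightarrow> i \<le> l \<longrightarrow> form (bMon d) (a i)"
    "\<forall>q. F' q = (\<Sum>i\<le>l. a i q * (\<Prod>j\<in>{..l} - {i}. nline b c j q))" by blast
  define a' where "a' = a(?n := an)"
  have set: "{..Suc l} - {Suc l} = {..l}" "i \<le> l \<Longrightarrow> {..Suc l} - {i} = insert (Suc l) ({..l} - {i})" for i
    by auto
  have "F q = (\<Sum>i\<le>?n. a' i q * (\<Prod>j\<in>{..?n} - {i}. nline b c j q))" for q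
  proof -
    have "(\<Sum>i\<le>l. a' i q * (\<Prod>j\<in>{..?n} - {i}. nline b c j q)) = nline b c ?n q * F' q"
      unfolding a(3)[rule_format] sum_distrib_left
      by (intro sum.cong refl) (auto simp: set(2) a'_def)
    then show ?thesis by (simp add: F set(1)) (simp add: a'_def)
  qed
  then show ?case
    using a(1,2) an(1) by (intro exI[of _ a']) (auto simp: a'_def le_Suc_eq)
qed

section \<open>The parametrisation by lines and multipliers\<close>

text \<open>A multiple of line \<open>i\<close> in the multiplier \<open>a_i\<close> contributes a
  multiple of the product of all six lines, which can be moved into the multiplier 0. So multipliers
  with \<open>i > 0\<close> may be taken free of \<open>x0\<close>, and only the first one is a
  general form.\<close>

definition amon :: "nat \<Rightarrow> nat \<Rightarrow> (nat \<times> nat \<times> nat) set" where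
  "amon e i = (if i = 0 then Mon e else bMon e)"

text \<open>\<open>Inl (i, m)\<close> stands for the coefficient of the monomial \<open>m\<close> in
  multiplier \<open>i\<close>; \<open>Inr (i, 1)\<close> and \<open>Inr (i, 2)\<close> for the
  coefficients of \<open>x1\<close> and \<open>x2\<close> in line \<open>i\<close>, whose
  \<open>x0\<close>-coefficient is 1.\<close>

definition pars :: "nat \<Rightarrow> (nat \<times> nat \<times> nat \<times> nat + nat \<times> nat) set" where
  "pars e = (SIGMA i:{..<6}. amon e i) <+> ({..<6} \<times> {1, 2})"

definition mult_form :: "nat \<Rightarrow> (nat \<times> nat \<times> nat \<times> nat + nat \<times> nat \<Rightarrow> 'k::field) \<Rightarrow> nat \<Rightarrow> 'k \<times> 'k \<times> 'k \<Rightarrow> 'k" where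
  "mult_form e t i q = (\<Sum>m\<in>amon e i. t (Inl (i, m)) * mon3 m q)"

definition line_form :: "(nat \<times> nat \<times> nat \<times> nat + nat \<times> nat \<Rightarrow> 'k::field) \<Rightarrow> nat \<Rightarrow> 'k \<times> 'k \<times> 'k \<Rightarrow> 'k" where
  "line_form t = nline (\<lambda>i. t (Inr (i, 1))) (\<lambda>i. t (Inr (i, 2)))"

definition star_form :: "nat \<Rightarrow> (nat \<times> nat \<times> nat \<times> nat + nat \<times> nat \<Rightarrow> 'k::field) \<Rightarrow> 'k \<times> 'k \<times> 'k \<Rightarrow> 'k" where
  "star_form e t q = (\<Sum>i<6. mult_form e t i q * (\<Prod>j\<in>{..<6} - {i}. line_form t j q))"

lemma finite_amon [simp]: "finite (amon e i)"
  by (simp add: amon_def)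

lemma finite_pars [simp]: "finite (pars e)"
  by (simp add: pars_def)

text \<open>With \<open>d = e + 5\<close> the multipliers account for
  \<open>binom(d+2,2) - 15\<close>, one condition for each of the fifteen points, and the lines add
  12.\<close>

lemma card_pars: "card (pars e) = ((e + 5) + 2 choose 2) - 3"
proof -
  have "card (SIGMA i:{..<6}. amon e i) = (\<Sum>i<6. card (amon e i))"
    by (subst card_SigmaI) auto
  also have "\<dots> = card (Mon e) + 5 * (e + 1)"
    by (simp add: amon_def card_bMon eval_nat_numeral)
  finally have "card (SIGMA i:{..<6}. amon e i) = ((e + 2) choose 2) + 5 * (e + 1)"
    by (simp add: card_Mon)
  then have 1: "card (pars e) = ((e + 2) choose 2) + 5 * (e + 1) + 12"
    unfolding pars_def by (subst card_Plus) (auto simp: card_cartesian_product)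
  have step: "(Suc n choose 2) = n + (n choose 2)" for n by (simp add: numeral_2_eq_2)
  have "(e + 5) + 2 = Suc (Suc (Suc (Suc (Suc (e + 2)))))" by simp
  then have "((e + 5) + 2 choose 2) = ((e + 2) choose 2) + 5 * e + 20"
    by (simp only: step)
  then show ?thesis using 1 by simp
qed

lemma mult_form_forms:
  "i < 6 \<Longrightarrow> (\<lambda>t. mult_form e t i) \<in> forms (pars e) (Mon e)"
proof -
  assume i: "i < 6"
  have "(\<lambda>t q. \<Sum>m\<in>amon e i. t (Inl (i, m)) * mon3 m q) \<in> forms (pars e) (amon e i)"
    using i by (intro forms_sum forms_scale forms_mon polyfun.var) (auto simp: pars_def)
  then show ?thesis
    unfolding mult_form_def[abs_def]
    by (rule forms_subset) (auto simp: amon_def bMon_def)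
qed

lemma line_form_forms:
  assumes "i < 6" shows "(\<lambda>t. line_form t i) \<in> forms (pars e) (Mon 1)"
proof -
  have "(\<lambda>t q. 1 * fst q + t (Inr (i, 1)) * fst (snd q) + t (Inr (i, 2)) * snd (snd q)) \<in> forms (pars e) (Mon 1)"
    using assms by (intro forms_linear polyfun.var polyfun.const) (auto simp: pars_def)
  then show ?thesis by (simp add: line_form_def)
qed

lemma star_form_forms: "star_form e \<in> forms (pars e) (Mon (e + 5))"
proof -
  have "(\<lambda>t q. \<Prod>j\<in>{..<6} - {i}. line_form t j q) \<in> forms (pars e) (Mon 5)" if "i < 6" for i
  proof -
    have "card ({..<6} - {i}) = 5" using that by simp
    moreover have "(\<lambda>t q. \<Prod>j\<in>{..<6} - {i}. line_form t j q) \<in> forms (pars e) (Mon (card ({..<6} - {i})))"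
      by (intro forms_prod line_form_forms) auto
    ultimately show ?thesis by simp
  qed
  then have "(\<lambda>t q. \<Sum>i<6. mult_form e t i q * (\<Prod>j\<in>{..<6} - {i}. line_form t j q)) \<in> forms (pars e) (Mon (e + 5))"
    by (intro forms_sum forms_mult mult_form_forms) auto
  then show ?thesis by (simp add: star_form_def[abs_def])
qed

section \<open>The upper bound\<close>

lemma star_form_complete:
  fixes b c :: "nat \<Rightarrow> 'k::field"
  assumes "form (Mon (e + 5)) F"
    and "\<And>i j. i < 6 \<Longrightarrow> j < 6 \<Longrightarrow> i \<noteq> j \<Longrightarrow> b i \<noteq> b j \<or> c i \<noteq> c j"
    and "\<And>i j k q. i < 6 \<Longrightarrow> j < 6 \<Longrightarrow> k < 6 \<Longrightarrow> i \<noteq> j \<Longrightarrow> j \<noteq> k \<Longrightarrow> i \<noteq> k \<Longrightarrow> q \<noteq> (0, 0, 0) \<Longrightarrow>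
      nline b c i q = 0 \<Longrightarrow> nline b c j q = 0 \<Longrightarrow> nline b c k q \<noteq> 0"
    and "\<And>i j q. i < 6 \<Longrightarrow> j < 6 \<Longrightarrow> i \<noteq> j \<Longrightarrow> q \<noteq> (0, 0, 0) \<Longrightarrow>
      nline b c i q = 0 \<Longrightarrow> nline b c j q = 0 \<Longrightarrow> F q = 0"
  shows "\<exists>t. F = star_form e t"
proof -
  have six: "i \<le> 5 \<longleftrightarrow> i < 6" for i :: nat by auto
  have six': "{..5::nat} = {..<6}" by auto
  have "\<exists>a. form (Mon e) (a 0) \<and> (\<forall>i. 0 < i \<longrightarrow> i \<le> 5 \<longrightarrow> form (bMon e) (a i)) \<and>
    (\<forall>q. F q = (\<Sum>i\<le>5. a i q * (\<Prod>j\<in>{..5} - {i}. nline b c j q)))"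
  proof (rule star_ideal_generators[OF assms(1)])
    show "b i \<noteq> b j \<or> c i \<noteq> c j" if "i \<le> 5" "j \<le> 5" "i \<noteq> j" for i j
      using assms(2) that by (simp add: six)
    show "nline b c k q \<noteq> 0" if "i \<le> 5" "j \<le> 5" "k \<le> 5" "i \<noteq> j" "j \<noteq> k" "i \<noteq> k" "q \<noteq> (0, 0, 0)"
      "nline b c i q = 0" "nline b c j q = 0" for i j k q
      using that unfolding six by (rule assms(3))
    show "F q = 0" if "i \<le> 5" "j \<le> 5" "i \<noteq> j" "q \<noteq> (0, 0, 0)" "nline b c i q = 0" "nline b c j q = 0" for i j q
      using that unfolding six by (rule assms(4))
  qed
  then obtain a where a: "form (Mon e) (a 0)" "\<forall>i. 0 < i \<longrightarrow> i < 6 \<longrightarrow> form (bMon e) (a i)"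
    and F: "\<And>q. F q = (\<Sum>i<6. a i q * (\<Prod>j\<in>{..<6} - {i}. nline b c j q))"
    unfolding six six' by blast
  have "\<exists>C. \<forall>q. a i q = (\<Sum>m\<in>amon e i. C m * mon3 m q)" if "i < 6" for i
  proof -
    have "form (amon e i) (a i)" using a that by (cases "i = 0") (auto simp: amon_def)
    then show ?thesis by (elim form_expand) blast
  qed
  then obtain C where C: "\<And>i q. i < 6 \<Longrightarrow> a i q = (\<Sum>m\<in>amon e i. C i m * mon3 m q)" by metis
  define t where "t = case_sum (\<lambda>p. C (fst p) (snd p)) (\<lambda>p. if snd p = (1::nat) then b (fst p) else c (fst p))"
  have "mult_form e t i q = a i q" if "i < 6" for i q
    using C[OF that] by (simp add: mult_form_def t_def)
  moreover have "line_form t = nline b c" by (simp add: line_form_def t_def)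
  ultimately have "F = star_form e t" unfolding star_form_def[abs_def] by (intro ext) (simp add: F)
  then show ?thesis by blast
qed

lemma evalF_subst_forms:
  assumes "x \<in> forms J (Mon 1)" "y \<in> forms J (Mon 1)" "z \<in> forms J (Mon 1)"
  shows "(\<lambda>t q. evalF d F (x t q, y t q, z t q)) \<in> forms J (Mon d)"
  unfolding evalF_eq
proof (intro forms_sum forms_scale polyfun.const)
  fix m assume m: "m \<in> Mon d"
  have "(\<lambda>t q. x t q ^ fst m * y t q ^ fst (snd m) * z t q ^ snd (snd m)) \<in> forms J (Mon (fst m + fst (snd m) + snd (snd m)))"
    using assms by (intro forms_mult forms_power)
  moreover have "fst m + fst (snd m) + snd (snd m) = d" using m by (cases m) (simp add: Mon_def)
  ultimately show "(\<lambda>t q. mon3 m (x t q, y t q, z t q)) \<in> forms J (Mon d)"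
    by (simp add: mon3_def)
qed

text \<open>On the conic of points \<open>(1, s, s^2)\<close> each line becomes a nonzero polynomial
  in \<open>s\<close>, so finitely many lines leave a parameter free.\<close>

lemma exists_point_off_lines:
  fixes L :: "nat \<Rightarrow> 'k::field \<times> 'k \<times> 'k"
  assumes inf: "infinite (UNIV :: 'k set)" and L: "\<And>i. i < n \<Longrightarrow> L i \<noteq> (0, 0, 0)"
  shows "\<exists>q. \<forall>i<n. dot3 (L i) q \<noteq> 0"
proof -
  define p where "p i = [:fst (L i), fst (snd (L i)), snd (snd (L i)):]" for i
  have "p i \<noteq> 0" if "i < n" for i using L[OF that] by (cases "L i") (auto simp: p_def)
  then have "prod p {..<n} \<noteq> 0" by simp
  then obtain s where "poly (prod p {..<n}) s \<noteq> 0"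
    using poly_eq_0_cofinite[OF inf, of "{}"] by blast
  then have s: "poly (p i) s \<noteq> 0" if "i < n" for i using that by (simp add: poly_prod)
  have "dot3 (L i) (1, s, s * s) = poly (p i) s" for i
    by (cases "L i") (simp add: p_def dot3_def algebra_simps)
  then show ?thesis using s by metis
qed

text \<open>A star configuration is moved into the chart where all lines have nonzero \<open>x0\<close>-coefficient by the
  substitution \<open>e0 \<mapsto> e0 + s q0\<close>, which is the identity at \<open>s = 0\<close>.\<close>

lemma vanish_on_image_imp_vanish_on_S:
  fixes u :: "(nat \<times> nat \<times> nat \<Rightarrow> 'k::field) \<Rightarrow> 'k"
  assumes inf: "infinite (UNIV :: 'k set)" and u: "u \<in> polyfun (Mon (e + 5))"
    and van: "\<forall>t. u (cf (e + 5) (star_form e t)) = 0" and F: "F \<in> S (e + 5) 6"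
  shows "u F = 0"
proof -
  let ?d = "e + 5"
  obtain L :: "nat \<Rightarrow> 'k \<times> 'k \<times> 'k" where L: "L \<in> D 6" and Fpts: "F \<in> pts (Mon ?d)" and star: "\<forall>q\<in>star 6 L. evalF ?d F q = 0"
    using F unfolding S_def by blast
  have L0: "\<And>i. i < 6 \<Longrightarrow> L i \<noteq> (0, 0, 0)"
    and L1: "\<And>i j t. i < 6 \<Longrightarrow> j < 6 \<Longrightarrow> i \<noteq> j \<Longrightarrow> L i \<noteq> smult3 t (L j)"
    and L2: "\<And>i j k q. i < 6 \<Longrightarrow> j < 6 \<Longrightarrow> k < 6 \<Longrightarrow> i \<noteq> j \<Longrightarrow> j \<noteq> k \<Longrightarrow> i \<noteq> k \<Longrightarrow> q \<noteq> (0, 0, 0) \<Longrightarrow>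
        dot3 (L i) q = 0 \<Longrightarrow> dot3 (L j) q = 0 \<Longrightarrow> dot3 (L k) q \<noteq> 0"
    using L unfolding D_def by blast+
  obtain p where p: "\<And>i. i < 6 \<Longrightarrow> dot3 (L i) p \<noteq> 0" using exists_point_off_lines[where L = L, OF inf L0] by blast
  obtain p0 p1 p2 where p012: "p = (p0, p1, p2)" by (cases p)
  \<comment> \<open>Adding \<open>s * q0 * p\<close> to \<open>q\<close> changes the
    \<open>x0\<close>-coefficient of a line \<open>a\<close> to \<open>a0 + s * dot3 a p\<close>. As
    \<open>p\<close> lies on none of the lines, each of these vanishes for a single
    \<open>s\<close>.\<close>
  define g where "g s q = (fst q + s * p0 * fst q, fst (snd q) + s * p1 * fst q, snd (snd q) + s * p2 * fst q)" for s and q :: "'k \<times> 'k \<times> 'k"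
  define G where "G t q = evalF ?d F (g (t ()) q)" for t :: "unit \<Rightarrow> 'k" and q
  have G: "G \<in> forms {()} (Mon ?d)"
  proof -
    have v: "(\<lambda>t. t () * k) \<in> polyfun {()}" for k :: 'k by (intro polyfun.mult polyfun.var polyfun.const) simp
    have c: "(\<lambda>t. k) \<in> polyfun {()}" for k :: 'k by (rule polyfun.const)
    have "(\<lambda>t q. fst q + t () * p0 * fst q) \<in> forms {()} (Mon 1)"
      using forms_linear[OF polyfun.add[OF c[of 1] v[of p0]] c[of 0] c[of 0]] by (simp add: algebra_simps)
    moreover have "(\<lambda>t q. fst (snd q) + t () * p1 * fst q) \<in> forms {()} (Mon 1)"
      using forms_linear[OF v[of p1] c[of 1] c[of 0]] by (simp add: algebra_simps)
    moreover have "(\<lambda>t q. snd (snd q) + t () * p2 * fst q) \<in> forms {()} (Mon 1)"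
      using forms_linear[OF v[of p2] c[of 0] c[of 1]] by (simp add: algebra_simps)
    ultimately show ?thesis unfolding G_def[abs_def] g_def by (rule evalF_subst_forms)
  qed
  define A where "A i s = fst (L i) + s * dot3 (L i) p" for i s
  \<comment> \<open>The last set contains the value of \<open>s\<close> at which the substitution is
    singular.\<close>
  define B where "B = (\<Union>i<6. {s. A i s = 0}) \<union> {s. 1 + s * p0 = 0}"
  have finB: "finite B"
  proof -
    have "finite {s. a + s * k = 0}" if "k \<noteq> 0 \<or> a \<noteq> 0" for a k :: 'k
    proof -
      have "{s. a + s * k = 0} = {s. poly [:a, k:] s = 0}" by auto
      then show ?thesis using poly_roots_finite[of "[:a, k:]"] that by auto
    qed
    then show ?thesis using p by (auto simp: B_def A_def)
  qed
  have good: "u (cf ?d (G (\<lambda>_. s))) = 0" if s: "s \<notin> B" for s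
  proof -
    have A0: "A i s \<noteq> 0" if "i < 6" for i using s that by (auto simp: B_def)
    have s0: "1 + s * p0 \<noteq> 0" using s by (auto simp: B_def)
    define b where "b i = fst (snd (L i)) / A i s" for i
    define c where "c i = snd (snd (L i)) / A i s" for i
    have nl: "nline b c i q = dot3 (L i) (g s q) / A i s" if "i < 6" for i q
    proof -
      obtain x y z where xyz: "L i = (x, y, z)" by (cases "L i")
      have "A i s * fst q + y * fst (snd q) + z * snd (snd q) = dot3 (L i) (g s q)"
        by (simp add: A_def xyz dot3_def g_def p012 algebra_simps)
      moreover have "nline b c i q = (A i s * fst q + y * fst (snd q) + z * snd (snd q)) / A i s"
        using A0[OF that] by (simp add: b_def c_def xyz add_divide_distrib)
      ultimately show ?thesis by simp
    qed
    have nl0: "nline b c i q = 0 \<longleftrightarrow> dot3 (L i) (g s q) = 0" if "i < 6" for i q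
      using nl[OF that] A0[OF that] by simp
    have gq: "g s q \<noteq> (0, 0, 0)" if "q \<noteq> (0, 0, 0)" for q
    proof
      assume "g s q = (0, 0, 0)"
      then have "(1 + s * p0) * fst q = 0" "fst (snd q) + s * p1 * fst q = 0" "snd (snd q) + s * p2 * fst q = 0"
        by (auto simp: g_def algebra_simps)
      then have "fst q = 0" "fst (snd q) = 0" "snd (snd q) = 0" using s0 by auto
      then show False using that by (cases q) auto
    qed
    have "\<exists>t. G (\<lambda>_. s) = star_form e t"
    proof (rule star_form_complete)
      show "form (Mon ?d) (G (\<lambda>_. s))" by (rule forms_form[OF G])
      show "b i \<noteq> b j \<or> c i \<noteq> c j" if ij: "i < 6" "j < 6" "i \<noteq> j" for i j
      proof (rule ccontr)
        assume eq: "\<not> ?thesis"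
        define k where "k = A i s / A j s"
        obtain x y z where xyz: "L i = (x, y, z)" by (cases "L i")
        obtain x' y' z' where xyz': "L j = (x', y', z')" by (cases "L j")
        have yz: "y = k * y'" "z = k * z'"
          using eq A0 ij by (auto simp: b_def c_def k_def xyz xyz' field_simps)
        have "A i s = k * A j s" using A0 ij by (simp add: k_def)
        then have "(x - k * x') * (1 + s * p0) = 0"
          by (simp add: A_def xyz xyz' dot3_def p012 yz algebra_simps)
        then have "x = k * x'" using s0 by simp
        then have "L i = smult3 k (L j)" using yz by (simp add: xyz xyz' smult3_def)
        then show False using L1 ij by blast
      qed
      show "nline b c k q \<noteq> 0" if "i < 6" "j < 6" "k < 6" "i \<noteq> j" "j \<noteq> k" "i \<noteq> k" "q \<noteq> (0, 0, 0)"
        "nline b c i q = 0" "nline b c j q = 0" for i j k q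
        using L2[of i j k "g s q"] that nl0 gq by simp
      show "G (\<lambda>_. s) q = 0" if "i < 6" "j < 6" "i \<noteq> j" "q \<noteq> (0, 0, 0)" "nline b c i q = 0" "nline b c j q = 0" for i j q
      proof -
        have "g s q \<in> star 6 L" unfolding star_def using that nl0 gq by auto
        then show ?thesis using star by (simp add: G_def)
      qed
    qed
    then show ?thesis using van by auto
  qed
  have "(\<lambda>t. u (cf ?d (G t))) \<in> polyfun {()}"
    by (rule polyfun_compose[OF u]) (rule cf_forms(1)[OF inf G])
  moreover have "\<exists>r. \<forall>s::'k. s = poly r s" by (rule exI[of _ "[:0, 1:]"]) simp
  ultimately obtain r where r: "\<forall>s. u (cf ?d (G (\<lambda>_. s))) = poly r s"
    using polyfun_poly[where g = "\<lambda>s _. s" and f = "\<lambda>t. u (cf ?d (G t))"] by blast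
  have "r = 0" by (rule poly_eq_0_cofinite[OF inf finB]) (use r good in auto)
  then have "u (cf ?d (G (\<lambda>_. 0))) = 0" using r by simp
  moreover have "cf ?d (G (\<lambda>_. 0)) = F"
    by (rule cf_eqI[OF inf]) (use Fpts in \<open>auto simp: pts_def G_def g_def\<close>)
  ultimately show ?thesis by simp
qed

lemma S_scale:
  assumes "F \<in> S d l" "c \<noteq> 0" shows "(\<lambda>m. c * F m) \<in> S d l"
proof -
  have "evalF d (\<lambda>m. c * F m) q = c * evalF d F q" for q
    by (simp add: evalF_eq sum_distrib_left mult.assoc)
  moreover have "(\<lambda>m. c * F m) \<in> pts (Mon d)" using assms by (auto simp: S_def pts_def fun_eq_iff)
  ultimately show ?thesis using assms(1) unfolding S_def by auto
qed

text \<open>\<open>pars e\<close> parametrises a cone, one dimension more than the projective set;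
  the strict inequality \<open>n < card (pars e)\<close> accounts for it.\<close>

lemma S_chain_bound:
  fixes Z :: "nat \<Rightarrow> (nat \<times> nat \<times> nat \<Rightarrow> 'k::field) set"
  assumes inf: "infinite (UNIV :: 'k set)"
    and "\<And>j. j \<le> n \<Longrightarrow> proj_irreducible (Mon (e + 5)) (Z j)" "\<And>j. j < n \<Longrightarrow> Z j \<subset> Z (Suc j)"
    and "Z n \<subseteq> proj_closure (Mon (e + 5)) (S (e + 5) 6)"
  shows "n \<le> (e + 5 + 2 choose 2) - 4"
proof -
  have "n < card (pars e)"
  proof (rule irreducible_chain_bound[where \<Phi> = "\<lambda>t. cf (e + 5) (star_form e t)" and X = "S (e + 5) 6" and Z = Z,
        OF inf finite_Mon finite_pars _ _ S_scale _ assms(2-4)])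
    show "(\<lambda>t :: _ \<Rightarrow> 'k. cf (e + 5) (star_form e t) i) \<in> polyfun (pars e)" for i
      by (rule cf_forms(1)[OF inf star_form_forms])
    show "S (e + 5) 6 \<subseteq> pts (Mon (e + 5))" by (auto simp: S_def)
    show "u x = 0" if "u \<in> polyfun (Mon (e + 5))" "\<forall>t. u (cf (e + 5) (star_form e t)) = 0" "x \<in> S (e + 5) 6"
      for u and x :: "_ \<Rightarrow> 'k"
      using that by (rule vanish_on_image_imp_vanish_on_S[OF inf])
  qed
  then show ?thesis by (simp add: card_pars)
qed

section \<open>The lower bound\<close>

text \<open>Third elementary symmetric polynomial in six values.\<close>

definition E3 :: "(nat \<Rightarrow> 'k::field) \<Rightarrow> 'k" where
  "E3 l = (\<Sum>i<6. \<Sum>j<i. \<Sum>k<j. l i * l j * l k)"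

text \<open>Partial derivative of the fifth elementary symmetric polynomial by the value
  \<open>l j\<close>.\<close>

definition E4 :: "(nat \<Rightarrow> 'k::field) \<Rightarrow> nat \<Rightarrow> 'k" where
  "E4 l j = (\<Sum>i\<in>{..<6} - {j}. \<Prod>m\<in>{..<6} - {i, j}. l m)"

lemma lessThan_small:
  "{..<2::nat} = {0, 1}" "{..<3::nat} = {0, 1, 2}" "{..<4::nat} = {0, 1, 2, 3}"
  "{..<5::nat} = {0, 1, 2, 3, 4}" "{..<6::nat} = {0, 1, 2, 3, 4, 5}"
  by auto

lemma coeff_mult_012:
  "coeff (p * q) 0 = coeff p 0 * coeff q 0"
  "coeff (p * q) (Suc 0) = coeff p 0 * coeff q (Suc 0) + coeff p (Suc 0) * coeff q 0"
  "coeff (p * q) 2 = coeff p 0 * coeff q 2 + coeff p (Suc 0) * coeff q (Suc 0) + coeff p 2 * coeff q 0"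
  by (simp_all add: coeff_mult numeral_2_eq_2)

lemma coeff_quadratic:
  "coeff [:a, b, c:] 0 = a" "coeff [:a, b, c:] (Suc 0) = b" "coeff [:a, b, c:] 2 = c"
  by (simp_all add: numeral_2_eq_2)

text \<open>Counting: a product of four of the \<open>l\<close> arises twice at order 1, once for
  each of the two remaining indices being the omitted \<open>i\<close>; a product of three arises
  three times with \<open>n^2\<close> at order 2. The assumption on \<open>n\<close> covers both
  characteristic 2 and \<open>n = 0\<close>.\<close>

lemma star_curve_coeff:
  fixes l l' a' :: "nat \<Rightarrow> 'k::field" and m n :: 'k
  assumes n: "2 * n = 0"
  defines "G \<equiv> (\<Sum>i<6. [:m, 0, a' i:] * (\<Prod>j\<in>{..<6} - {i}. [:l j, n, l' j:]))"
  shows "coeff G 0 = (\<Sum>i<6. m * (\<Prod>j\<in>{..<6} - {i}. l j))" (is ?c0)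
    and "coeff G (Suc 0) = 0" (is ?c1)
    and "coeff G 2 = (\<Sum>i<6. a' i * (\<Prod>j\<in>{..<6} - {i}. l j)) + m * ((\<Sum>j<6. l' j * E4 l j) + 3 * n\<^sup>2 * E3 l)" (is ?c2)
proof -
  show ?c0
    unfolding G_def
    by (simp add: coeff_sum lessThan_small insert_Diff_if coeff_mult_012 coeff_quadratic del: mult_pCons_left mult_pCons_right)
  have "coeff G (Suc 0) = 2 * n * (m * (\<Sum>i<6. \<Sum>j<i. \<Prod>k\<in>{..<6} - {i} - {j}. l k))"
    unfolding G_def
    apply (simp add: coeff_sum lessThan_small insert_Diff_if coeff_mult_012 coeff_quadratic del: mult_pCons_left mult_pCons_right)
    apply algebra
    done
  then show ?c1 using n by simp
  show ?c2
    unfolding G_def E4_def E3_def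
    apply (simp add: coeff_sum lessThan_small insert_Diff_if coeff_mult_012 coeff_quadratic del: mult_pCons_left mult_pCons_right)
    apply algebra
    done
qed

text \<open>A product of four of the six values avoids both zeros only if the omitted pair is
  \<open>{j, k}\<close>. At an intersection point, therefore, only the motion of the two lines
  through it is visible.\<close>

lemma sum_E4_double_zero:
  assumes jk: "j < 6" "k < 6" "j \<noteq> k" and z: "l j = 0" "l k = (0 :: 'k::field)"
  shows "(\<Sum>i<6. l' i * E4 l i) = (l' j + l' k) * (\<Prod>m\<in>{..<6} - {j, k}. l m)"
proof -
  have p0: "(\<Prod>m\<in>{..<6} - {i, i'}. l m) = 0" if "{i, i'} \<noteq> {j, k}" "i \<noteq> i'" for i i'
  proof -
    have "j \<notin> {i, i'} \<or> k \<notin> {i, i'}" using that jk(3) by auto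
    then have "\<exists>m\<in>{..<6} - {i, i'}. l m = 0" using jk z by auto
    then show ?thesis by (intro prod_zero) auto
  qed
  have E4: "E4 l i = (if i = j \<or> i = k then (\<Prod>m\<in>{..<6} - {j, k}. l m) else 0)" if "i < 6" for i
  proof -
    have "E4 l i = (\<Sum>i'\<in>{..<6} - {i}. if {i, i'} = {j, k} then (\<Prod>m\<in>{..<6} - {j, k}. l m) else 0)"
      unfolding E4_def
    proof (intro sum.cong refl)
      fix i' assume "i' \<in> {..<6} - {i}"
      then show "(\<Prod>m\<in>{..<6} - {i', i}. l m) = (if {i, i'} = {j, k} then (\<Prod>m\<in>{..<6} - {j, k}. l m) else 0)"
        using p0[of i' i] by (cases "{i, i'} = {j, k}") (simp_all add: insert_commute)
    qed
    also have "\<dots> = (\<Sum>i'\<in>{..<6} - {i}. if i' = (if i = j then k else j) \<and> (i = j \<or> i = k) then (\<Prod>m\<in>{..<6} - {j, k}. l m) else 0)"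
      using jk by (intro sum.cong refl if_cong) (auto simp: doubleton_eq_iff)
    also have "\<dots> = (if i = j \<or> i = k then (\<Prod>m\<in>{..<6} - {j, k}. l m) else 0)"
      using jk by (cases "i = j \<or> i = k") auto
    finally show ?thesis .
  qed
  have "(\<Sum>i<6. l' i * E4 l i) = (\<Sum>i<6. (if i = j then l' j * (\<Prod>m\<in>{..<6} - {j, k}. l m) else 0)
      + (if i = k then l' k * (\<Prod>m\<in>{..<6} - {j, k}. l m) else 0))"
    using jk by (intro sum.cong refl) (auto simp: E4)
  also have "\<dots> = (l' j + l' k) * (\<Prod>m\<in>{..<6} - {j, k}. l m)"
    using jk by (simp add: sum.distrib distrib_right)
  finally show ?thesis .
qed

lemma polyfun_prod_eq_0:
  fixes f :: "'a \<Rightarrow> ('i \<Rightarrow> 'k::field) \<Rightarrow> 'k"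
  assumes inf: "infinite (UNIV :: 'k set)" and "finite T" "\<And>x. x \<in> T \<Longrightarrow> f x \<in> polyfun I" "\<And>t. (\<Prod>x\<in>T. f x t) = 0"
  shows "\<exists>x\<in>T. \<forall>t. f x t = 0"
  using assms(2-)
proof (induction T rule: finite_induct)
  case (insert x T)
  have "f x t * (\<Prod>x\<in>T. f x t) = 0" for t using insert.prems(2)[of t] insert.hyps by simp
  moreover have "(\<lambda>t. \<Prod>x\<in>T. f x t) \<in> polyfun I" using insert.prems(1) by (intro polyfun_prod) auto
  ultimately have "(\<forall>t. f x t = 0) \<or> (\<forall>t. (\<Prod>x\<in>T. f x t) = 0)"
    using insert.prems(1) by (intro polyfun_mult_eq_0[OF inf, of _ I]) auto
  then show ?case using insert.IH insert.prems(1) by auto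
qed simp

lemma form_polyfun:
  assumes "form A f" "X \<in> polyfun J" "Y \<in> polyfun J" "Z \<in> polyfun J"
  shows "(\<lambda>t. f (X t, Y t, Z t)) \<in> polyfun J"
proof -
  obtain c where c: "\<And>q. f q = (\<Sum>m\<in>A. c m * mon3 m q)" using assms(1) by (rule form_expand) blast
  show ?thesis
    unfolding c mon3_def using assms(2-)
    by (auto intro!: polyfun_sum polyfun.mult polyfun.const polyfun_power)
qed

lemma forms_dot3:
  fixes X :: "('j \<Rightarrow> 'k::field) \<Rightarrow> 'k \<times> 'k \<times> 'k"
  assumes "(\<lambda>t. fst (X t)) \<in> polyfun J" "(\<lambda>t. fst (snd (X t))) \<in> polyfun J" "(\<lambda>t. snd (snd (X t))) \<in> polyfun J"
  shows "(\<lambda>t. dot3 (X t)) \<in> forms J (Mon 1)"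
proof -
  have "(\<lambda>t. dot3 (X t)) = (\<lambda>t q. fst (X t) * fst q + fst (snd (X t)) * fst (snd q) + snd (snd (X t)) * snd (snd q))"
    by (auto simp: dot3_def fun_eq_iff split: prod.splits)
  then show ?thesis using forms_linear[OF assms] by simp
qed

section \<open>General position of lines by determinants\<close>

definition det3 :: "'k::field \<times> 'k \<times> 'k \<Rightarrow> 'k \<times> 'k \<times> 'k \<Rightarrow> 'k \<times> 'k \<times> 'k \<Rightarrow> 'k" where
  "det3 u v w = fst u * (fst (snd v) * snd (snd w) - snd (snd v) * fst (snd w))
    - fst (snd u) * (fst v * snd (snd w) - snd (snd v) * fst w)
    + snd (snd u) * (fst v * fst (snd w) - fst (snd v) * fst w)"

lemma det3_zero:
  assumes "det3 u v w \<noteq> 0" "dot3 u q = 0" "dot3 v q = 0" "dot3 w q = 0"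
  shows "q = (0, 0, 0)"
proof -
  obtain a b c where q: "q = (a, b, c)" by (cases q)
  obtain u0 u1 u2 v0 v1 v2 w0 w1 w2 where uvw: "u = (u0, u1, u2)" "v = (v0, v1, v2)" "w = (w0, w1, w2)"
    by (cases u, cases v, cases w)
  have e: "u0 * a + u1 * b + u2 * c = 0" "v0 * a + v1 * b + v2 * c = 0" "w0 * a + w1 * b + w2 * c = 0"
    using assms(2-4) by (simp_all add: dot3_def q uvw)
  have "det3 u v w * a = 0" "det3 u v w * b = 0" "det3 u v w * c = 0"
    unfolding det3_def uvw fst_conv snd_conv using e by algebra+
  then show ?thesis using assms(1) q by simp
qed

lemma det3_smult3: "det3 (smult3 t v) v w = 0"
  by (cases v, cases w) (simp add: det3_def smult3_def algebra_simps)

lemma det3_zero_left: "det3 (0, 0, 0) v w = 0"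
  by (simp add: det3_def)

lemma exists_third: "\<exists>k<6. k \<noteq> i \<and> k \<noteq> j" for i j :: nat
proof -
  have "0 \<notin> {i, j} \<or> 1 \<notin> {i, j} \<or> 2 \<notin> {i, j}" by auto
  then show ?thesis
    by (elim disjE) (rule exI[of _ 0], simp, rule exI[of _ 1], simp, rule exI[of _ 2], simp)
qed

text \<open>A zero line or two proportional ones, completed by a further index, would give a
  vanishing determinant; triple points are excluded by Cramer's rule.\<close>

lemma D_if_det3:
  assumes "\<And>i j k. i < 6 \<Longrightarrow> j < 6 \<Longrightarrow> k < 6 \<Longrightarrow> i \<noteq> j \<Longrightarrow> j \<noteq> k \<Longrightarrow> i \<noteq> k \<Longrightarrow> det3 (L i) (L j) (L k) \<noteq> 0"
  shows "L \<in> D 6"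
proof -
  have "L i \<noteq> smult3 t (L j)" if "i < 6" "j < 6" "i \<noteq> j" for i j t
    using assms[of i j] exists_third[of i j] that det3_smult3[of t "L j"] by metis
  moreover have "L i \<noteq> (0, 0, 0)" if "i < 6" for i
  proof -
    obtain j where "j < 6" "j \<noteq> i" using exists_third[of i i] by auto
    then show ?thesis using assms[of i j] exists_third[of i j] that det3_zero_left by metis
  qed
  ultimately show ?thesis
    unfolding D_def using assms det3_zero by blast
qed

text \<open>Additivity of Frobenius. It makes the square of a combined translation linear in the
  squares of its parameters.\<close>

lemma square_sum_char_2:
  fixes f :: "'a \<Rightarrow> 'k::field"
  assumes "(2 :: 'k) = 0"
  shows "(\<Sum>x\<in>A. f x)\<^sup>2 = (\<Sum>x\<in>A. (f x)\<^sup>2)"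
  by (induction A rule: infinite_finite_induct) (simp_all add: power2_sum assms)

text \<open>The base point consists of the lines \<open>lam i (x0 + b i x1 + c i x2)\<close> and of six equal multipliers
  \<open>M ^ e\<close>. The lines move in the coordinate directions, except that the directions indexed by \<open>K\<close>
  are replaced by common translations of all six lines. To first order such a translation by \<open>n\<close>
  changes the form by \<open>2 n E4\<close>; in characteristic 2 it counts through its second-order term \<open>n\<^sup>2 E3\<close>.\<close>

definition base_line :: "(nat \<Rightarrow> 'k::field) \<Rightarrow> (nat \<Rightarrow> 'k) \<Rightarrow> (nat \<Rightarrow> 'k) \<Rightarrow> nat \<Rightarrow> 'k \<times> 'k \<times> 'k" where
  "base_line lam b c i = (lam i, lam i * b i, lam i * c i)"

text \<open>Cross product of \<open>(1, b j, c j)\<close> and \<open>(1, b k, c k)\<close>, hence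
  the intersection point of lines \<open>j\<close> and \<open>k\<close>; the weights
  \<open>lam\<close> do not affect it.\<close>

definition cross :: "(nat \<Rightarrow> 'k::field) \<Rightarrow> (nat \<Rightarrow> 'k) \<Rightarrow> nat \<Rightarrow> nat \<Rightarrow> 'k \<times> 'k \<times> 'k" where
  "cross b c j k = (b j * c k - c j * b k, c j - c k, b k - b j)"

definition dir_line :: "(nat \<times> nat) set \<Rightarrow> (nat \<times> nat \<Rightarrow> 'k::field) \<Rightarrow> nat \<Rightarrow> 'k \<times> 'k \<times> 'k" where
  "dir_line K y j = (0, if (j, 1) \<in> K then 0 else y (j, 1), if (j, 2) \<in> K then 0 else y (j, 2))"

text \<open>The demands on the base point. \<open>M\<close> keeps \<open>x1 + r x2\<close> nonzero
  at the fifteen points, so that its power can be cancelled there. \<open>key\<close> concerns the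
  values of a tangent vector at these points, where all multiplier terms have dropped out and only
  the two lines through the point and the second-order term remain. \<open>char\<close> admits
  translations only in characteristic 2, where their first-order term vanishes and squaring is
  additive.\<close>

locale star_base =
  fixes e :: nat and lam b c :: "nat \<Rightarrow> 'k::field" and r :: 'k
    and K :: "(nat \<times> nat) set" and \<nu> :: "nat \<times> nat \<Rightarrow> 'k \<times> 'k \<times> 'k"
  assumes inf: "infinite (UNIV :: 'k set)"
    and det: "\<And>i j k. i < 6 \<Longrightarrow> j < 6 \<Longrightarrow> k < 6 \<Longrightarrow> i \<noteq> j \<Longrightarrow> j \<noteq> k \<Longrightarrow> i \<noteq> k \<Longrightarrow>
        det3 (base_line lam b c i) (base_line lam b c j) (base_line lam b c k) \<noteq> 0"
    and M: "\<And>j k. j < 6 \<Longrightarrow> k < 6 \<Longrightarrow> j \<noteq> k \<Longrightarrow> c j - c k + r * (b k - b j) \<noteq> 0"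
    and K: "K \<subseteq> {..<6} \<times> {1, 2}"
    and char: "K = {} \<or> (2 :: 'k) = 0"
    and sqrt: "\<And>x :: 'k. \<exists>y. y\<^sup>2 = x"
    and key: "\<And>y. (\<And>j k. j < 6 \<Longrightarrow> k < 6 \<Longrightarrow> j \<noteq> k \<Longrightarrow>
          (dot3 (dir_line K y j) (cross b c j k) + dot3 (dir_line K y k) (cross b c j k))
            * (\<Prod>m\<in>{..<6} - {j, k}. dot3 (base_line lam b c m) (cross b c j k))
          + 3 * (\<Sum>\<kappa>\<in>K. y \<kappa> * (dot3 (\<nu> \<kappa>) (cross b c j k))\<^sup>2) * E3 (\<lambda>m. dot3 (base_line lam b c m) (cross b c j k)) = 0)
        \<Longrightarrow> \<forall>\<kappa>\<in>{..<6} \<times> {1, 2}. y \<kappa> = 0"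
begin

section \<open>Displacements, translations and tangent vectors at the base point\<close>

abbreviation bl :: "nat \<Rightarrow> 'k \<times> 'k \<times> 'k \<Rightarrow> 'k" where
  "bl i \<equiv> dot3 (base_line lam b c i)"

definition Mf :: "'k \<times> 'k \<times> 'k \<Rightarrow> 'k" where
  "Mf q = fst (snd q) + r * snd (snd q)"

definition trans :: "(nat \<times> nat \<Rightarrow> 'k) \<Rightarrow> 'k \<times> 'k \<times> 'k" where
  "trans y = (\<Sum>\<kappa>\<in>K. y \<kappa> * fst (\<nu> \<kappa>), \<Sum>\<kappa>\<in>K. y \<kappa> * fst (snd (\<nu> \<kappa>)), \<Sum>\<kappa>\<in>K. y \<kappa> * snd (snd (\<nu> \<kappa>)))"

definition moved_line :: "(nat \<times> nat \<Rightarrow> 'k) \<Rightarrow> nat \<Rightarrow> 'k \<times> 'k \<times> 'k" where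
  "moved_line y i = (lam i + fst (trans y),
     lam i * b i + fst (snd (dir_line K y i)) + fst (snd (trans y)),
     lam i * c i + snd (snd (dir_line K y i)) + snd (snd (trans y)))"

text \<open>The parameters are displacements, so \<open>t = 0\<close> is the base point. As
  \<open>Mf\<close> is binary, the multipliers stay in the normal form of
  \<open>amon\<close>.\<close>

definition moved_form :: "(nat \<times> nat \<times> nat \<times> nat + nat \<times> nat \<Rightarrow> 'k) \<Rightarrow> 'k \<times> 'k \<times> 'k \<Rightarrow> 'k" where
  "moved_form t q = (\<Sum>i<6. (Mf q ^ e + mult_form e t i q) * (\<Prod>j\<in>{..<6} - {i}. dot3 (moved_line (\<lambda>\<kappa>. t (Inr \<kappa>)) j) q))"

text \<open>The base form lies in the span of the multiplier directions, so one of these is dropped.\<close>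

definition dropped :: "nat \<times> nat \<times> nat \<times> nat + nat \<times> nat" where
  "dropped = Inl (0, 0, e, 0)"

text \<open>Coefficient of \<open>s^2\<close> in the moved form along the curves of lemma
  \<open>curve\<close>: for a translation in \<open>K\<close> a second-order term, for every other
  direction the ordinary derivative.\<close>

definition tangent :: "nat \<times> nat \<times> nat \<times> nat + nat \<times> nat \<Rightarrow> 'k \<times> 'k \<times> 'k \<Rightarrow> 'k" where
  "tangent k q = (case k of Inl (i, m) \<Rightarrow> mon3 m q * (\<Prod>j\<in>{..<6} - {i}. bl j q)
    | Inr (j, x) \<Rightarrow> Mf q ^ e * (if (j, x) \<in> K then 3 * (dot3 (\<nu> (j, x)) q)\<^sup>2 * E3 (\<lambda>m. bl m q)
        else (if x = 1 then fst (snd q) else snd (snd q)) * E4 (\<lambda>m. bl m q) j))"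

lemma dot3_moved_line: "dot3 (moved_line y i) q = bl i q + dot3 (dir_line K y i) q + dot3 (trans y) q"
  by (cases q) (simp add: moved_line_def base_line_def dot3_def dir_line_def trans_def algebra_simps)

lemma dot3_trans: "dot3 (trans y) q = (\<Sum>\<kappa>\<in>K. y \<kappa> * dot3 (\<nu> \<kappa>) q)"
  by (cases q) (simp add: trans_def dot3_def sum_distrib_right distrib_left mult.assoc sum.distrib case_prod_unfold)

lemma base_line_forms: "form (Mon 1) (bl i)"
  by (intro forms_dot3 polyfun.const)

lemma Mf_forms: "form (bMon 1) Mf"
  using forms_blinear[OF polyfun.const[of 1] polyfun.const[of r]] by (simp add: Mf_def[abs_def])

lemma moved_line_forms:
  assumes "i < 6" shows "(\<lambda>t. dot3 (moved_line (\<lambda>\<kappa>. t (Inr \<kappa>)) i)) \<in> forms (pars e) (Mon 1)"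
proof -
  have K': "Inr \<kappa> \<in> pars e" if "\<kappa> \<in> K" for \<kappa> using K that by (auto simp: pars_def)
  have I: "Inr (i, 1) \<in> pars e" "Inr (i, 2) \<in> pars e" using assms by (auto simp: pars_def)
  show ?thesis
    unfolding moved_line_def trans_def dir_line_def using K' I
    by (intro forms_dot3; cases "(i, 1) \<in> K"; cases "(i, 2) \<in> K") (auto intro!: polyfun_sum polyfun.intros)
qed

lemma moved_form_forms: "moved_form \<in> forms (pars e) (Mon (e + 5))"
proof -
  have "(\<lambda>t q. \<Prod>j\<in>{..<6} - {i}. dot3 (moved_line (\<lambda>\<kappa>. t (Inr \<kappa>)) j) q) \<in> forms (pars e) (Mon 5)" if "i < 6" for i
  proof -
    have "card ({..<6} - {i}) = 5" using that by simp
    moreover have "(\<lambda>t q. \<Prod>j\<in>{..<6} - {i}. dot3 (moved_line (\<lambda>\<kappa>. t (Inr \<kappa>)) j) q) \<in> forms (pars e) (Mon (card ({..<6} - {i})))"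
      by (intro forms_prod moved_line_forms) auto
    ultimately show ?thesis by simp
  qed
  moreover have "(\<lambda>t q. Mf q ^ e) \<in> forms (pars e) (Mon e)"
    by (intro bforms_forms bforms_power form_forms[OF Mf_forms])
  ultimately have "(\<lambda>t q. \<Sum>i<6. (Mf q ^ e + mult_form e t i q) * (\<Prod>j\<in>{..<6} - {i}. dot3 (moved_line (\<lambda>\<kappa>. t (Inr \<kappa>)) j) q)) \<in> forms (pars e) (Mon (e + 5))"
    by (intro forms_sum forms_mult forms_add mult_form_forms) auto
  then show ?thesis by (simp add: moved_form_def[abs_def])
qed

lemma bl_prod_form: "i < 6 \<Longrightarrow> form (Mon 5) (\<lambda>q. \<Prod>j\<in>{..<6} - {i}. bl j q)"
  using forms_prod[where T = "{..<6} - {i}", OF _ base_line_forms] by simp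

lemma tangent_forms:
  assumes "k \<in> pars e" shows "form (Mon (e + 5)) (tangent k)"
proof (cases k)
  case (Inl p)
  obtain i m where p: "p = (i, m)" by (cases p)
  then have im: "i < 6" "m \<in> Mon e" using assms Inl by (auto simp: pars_def amon_def bMon_def split: if_splits)
  have "form (Mon (e + 5)) (\<lambda>q. mon3 m q * (\<Prod>j\<in>{..<6} - {i}. bl j q))"
    using im by (intro forms_mult forms_mon bl_prod_form) auto
  then show ?thesis by (simp add: tangent_def[abs_def] Inl p)
next
  case (Inr p)
  obtain j x where p: "p = (j, x)" by (cases p)
  then have j: "j < 6" using assms Inr by (auto simp: pars_def)
  have b: "form (Mon 1) (\<lambda>q. bl i q)" for i by (rule base_line_forms)
  have "form (Mon (1 + 1 + 1)) (\<lambda>q. bl i q * bl j q * bl k q)" for i j k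
    by (intro forms_mult b)
  then have e3: "form (Mon 3) (\<lambda>q. E3 (\<lambda>m. bl m q))"
    unfolding E3_def by (intro forms_sum) (simp add: numeral_3_eq_3)
  have "form (Mon (card ({..<6} - {i, j}))) (\<lambda>q. \<Prod>m\<in>{..<6} - {i, j}. bl m q)" for i
    by (intro forms_prod b) auto
  moreover have "card ({..<6} - {i, j}) = 4" if "i \<in> {..<6} - {j}" for i
    using that j by (subst card_Diff_subset) auto
  ultimately have e4: "form (Mon 4) (\<lambda>q. E4 (\<lambda>m. bl m q) j)"
    unfolding E4_def by (intro forms_sum) (metis (no_types, lifting))
  have "form (Mon 2) (\<lambda>q. (dot3 (\<nu> (j, x)) q)\<^sup>2)"
    by (intro forms_power forms_dot3 polyfun.const)
  from forms_mult[OF forms_scale[OF polyfun.const[of 3] this] e3]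
  have 1: "form (Mon 5) (\<lambda>q. 3 * (dot3 (\<nu> (j, x)) q)\<^sup>2 * E3 (\<lambda>m. bl m q))" by simp
  have "form (Mon 1) (\<lambda>q. if x = 1 then fst (snd q) else snd (snd q))"
    using forms_linear[OF polyfun.const[of 0] polyfun.const[of 1] polyfun.const[of 0]]
      forms_linear[OF polyfun.const[of 0] polyfun.const[of 0] polyfun.const[of 1]] by (cases "x = 1") auto
  from forms_mult[OF this e4]
  have 2: "form (Mon 5) (\<lambda>q. (if x = 1 then fst (snd q) else snd (snd q)) * E4 (\<lambda>m. bl m q) j)" by simp
  have "form (Mon e) (\<lambda>q. Mf q ^ e)" by (intro bforms_forms bforms_power Mf_forms)
  from forms_mult[OF this 1] forms_mult[OF this 2] show ?thesis
    by (cases "(j, x) \<in> K") (simp_all add: tangent_def[abs_def] Inr p)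
qed

lemma sum_tangent:
  "(\<Sum>k\<in>pars e. y k * tangent k q) = (\<Sum>i<6. mult_form e y i q * (\<Prod>j\<in>{..<6} - {i}. bl j q))
    + Mf q ^ e * ((\<Sum>j<6. dot3 (dir_line K (\<lambda>\<kappa>. y (Inr \<kappa>)) j) q * E4 (\<lambda>m. bl m q) j)
      + 3 * (\<Sum>\<kappa>\<in>K. y (Inr \<kappa>) * (dot3 (\<nu> \<kappa>) q)\<^sup>2) * E3 (\<lambda>m. bl m q))"
proof -
  let ?y = "\<lambda>\<kappa>. y (Inr \<kappa>)"
  let ?x = "\<lambda>x::nat. if x = 1 then fst (snd q) else snd (snd q)"
  have "(\<Sum>k\<in>pars e. y k * tangent k q) = (\<Sum>p\<in>(SIGMA i:{..<6}. amon e i). y (Inl p) * tangent (Inl p) q)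
      + (\<Sum>\<kappa>\<in>{..<6} \<times> {1, 2}. ?y \<kappa> * tangent (Inr \<kappa>) q)"
    unfolding pars_def by (subst sum.Plus) auto
  also have "(\<Sum>p\<in>(SIGMA i:{..<6}. amon e i). y (Inl p) * tangent (Inl p) q)
      = (\<Sum>i<6. \<Sum>m\<in>amon e i. y (Inl (i, m)) * tangent (Inl (i, m)) q)"
    by (subst sum.Sigma) (auto simp: case_prod_unfold)
  also have "\<dots> = (\<Sum>i<6. mult_form e y i q * (\<Prod>j\<in>{..<6} - {i}. bl j q))"
    by (simp add: tangent_def mult_form_def sum_distrib_right mult.assoc)
  also have "(\<Sum>\<kappa>\<in>{..<6} \<times> {1, 2}. ?y \<kappa> * tangent (Inr \<kappa>) q)
      = (\<Sum>\<kappa>\<in>{..<6} \<times> {1, 2}. Mf q ^ e * ((if \<kappa> \<in> K then 0 else ?y \<kappa>) * (?x (snd \<kappa>) * E4 (\<lambda>m. bl m q) (fst \<kappa>)))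
        + Mf q ^ e * (if \<kappa> \<in> K then 3 * (?y \<kappa> * (dot3 (\<nu> \<kappa>) q)\<^sup>2) * E3 (\<lambda>m. bl m q) else 0))"
    by (intro sum.cong refl) (auto simp: tangent_def split: prod.splits)
  also have "\<dots> = Mf q ^ e * (\<Sum>\<kappa>\<in>{..<6} \<times> {1, 2}. (if \<kappa> \<in> K then 0 else ?y \<kappa>) * (?x (snd \<kappa>) * E4 (\<lambda>m. bl m q) (fst \<kappa>)))
        + Mf q ^ e * (\<Sum>\<kappa>\<in>{..<6} \<times> {1, 2}. if \<kappa> \<in> K then 3 * (?y \<kappa> * (dot3 (\<nu> \<kappa>) q)\<^sup>2) * E3 (\<lambda>m. bl m q) else 0)"
    by (simp add: sum.distrib sum_distrib_left)
  also have "(\<Sum>\<kappa>\<in>{..<6} \<times> {1, 2}. (if \<kappa> \<in> K then 0 else ?y \<kappa>) * (?x (snd \<kappa>) * E4 (\<lambda>m. bl m q) (fst \<kappa>)))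
      = (\<Sum>j<6. \<Sum>x\<in>{1, 2}. (if (j, x) \<in> K then 0 else ?y (j, x)) * (?x x * E4 (\<lambda>m. bl m q) j))"
    by (subst sum.cartesian_product) (auto simp: case_prod_unfold intro!: sum.cong)
  also have "\<dots> = (\<Sum>j<6. dot3 (dir_line K ?y j) q * E4 (\<lambda>m. bl m q) j)"
    by (intro sum.cong refl, cases q) (simp add: dir_line_def dot3_def algebra_simps)
  also have "(\<Sum>\<kappa>\<in>{..<6} \<times> {1, 2}. if \<kappa> \<in> K then 3 * (?y \<kappa> * (dot3 (\<nu> \<kappa>) q)\<^sup>2) * E3 (\<lambda>m. bl m q) else 0)
      = (\<Sum>\<kappa>\<in>K. 3 * (?y \<kappa> * (dot3 (\<nu> \<kappa>) q)\<^sup>2) * E3 (\<lambda>m. bl m q))"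
    using K by (intro sum.mono_neutral_cong_right) auto
  finally show ?thesis
    by (simp add: distrib_left sum_distrib_left sum_distrib_right)
qed

lemma bl_cross: "bl j (cross b c j k) = 0 \<and> bl k (cross b c j k) = 0"
  by (simp_all add: base_line_def cross_def dot3_def algebra_simps)

lemma Mf_cross: "j < 6 \<Longrightarrow> k < 6 \<Longrightarrow> j \<noteq> k \<Longrightarrow> Mf (cross b c j k) \<noteq> 0"
  using M by (simp add: Mf_def cross_def)

lemma bl_nonzero_on_line:
  assumes "i < 6" "j < 6" "i \<noteq> j"
  shows "\<exists>k<6. bl j (cross b c i k) \<noteq> 0"
proof -
  obtain k where k: "k < 6" "k \<noteq> i" "k \<noteq> j" using exists_third[of i j] by blast
  have "cross b c i k \<noteq> (0, 0, 0)"
  proof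
    assume "cross b c i k = (0, 0, 0)"
    moreover have "Mf (0, 0, 0) = 0" by (simp add: Mf_def)
    ultimately show False using Mf_cross[of i k] assms k by simp
  qed
  then have "bl j (cross b c i k) \<noteq> 0"
    using det3_zero[OF det[of j i k]] bl_cross[of i k] assms k by metis
  then show ?thesis using k by blast
qed

text \<open>On line \<open>i > 0\<close> only the summand \<open>i\<close> survives, and no other
  line vanishes identically there. The line is a graph over \<open>(x1, x2)\<close>, so a binary
  form is determined by its restriction to it. With these multipliers gone, the multiplier 0 stands
  alone before a nonzero product.\<close>

lemma multipliers_zero:
  assumes a0: "form (Mon e) (a 0)" and a: "\<And>i. 0 < i \<Longrightarrow> i < 6 \<Longrightarrow> form (bMon e) (a i)"
    and z: "\<And>q. (\<Sum>i<6. a i q * (\<Prod>j\<in>{..<6} - {i}. bl j q)) = 0" and i: "i < 6"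
  shows "a i q = 0"
proof -
  have pos: "\<forall>q. a i q = 0" if i: "0 < i" "i < 6" for i
  proof -
    define Q where "Q t = (0 - (b i * t 1 + c i * t 2), t 1, t 2)" for t :: "nat \<Rightarrow> 'k"
    have Qpoly: "(\<lambda>t. f (Q t)) \<in> polyfun UNIV" if "form A f" for f A
      unfolding Q_def
      by (intro form_polyfun[OF that] polyfun_diff polyfun.add polyfun.mult polyfun.const polyfun.var UNIV_I)
    have Q0: "bl i (Q t) = 0" for t by (simp add: Q_def base_line_def dot3_def algebra_simps)
    have "a i (Q t) * (\<Prod>j\<in>{..<6} - {i}. bl j (Q t)) = 0" for t
    proof -
      have "(\<Sum>i'<6. a i' (Q t) * (\<Prod>j\<in>{..<6} - {i'}. bl j (Q t)))
        = (\<Sum>i'<6. if i' = i then a i (Q t) * (\<Prod>j\<in>{..<6} - {i}. bl j (Q t)) else 0)"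
      proof (intro sum.cong refl)
        fix i' assume "i' \<in> {..<6::nat}"
        have "(\<Prod>j\<in>{..<6} - {i'}. bl j (Q t)) = 0" if "i' \<noteq> i"
          using that i Q0 by (intro prod_zero) auto
        then show "a i' (Q t) * (\<Prod>j\<in>{..<6} - {i'}. bl j (Q t))
          = (if i' = i then a i (Q t) * (\<Prod>j\<in>{..<6} - {i}. bl j (Q t)) else 0)" by auto
      qed
      then show ?thesis using z[of "Q t"] i by simp
    qed
    then have "(\<forall>t. a i (Q t) = 0) \<or> (\<forall>t. (\<Prod>j\<in>{..<6} - {i}. bl j (Q t)) = 0)"
      by (intro polyfun_mult_eq_0[OF inf, of _ UNIV] polyfun_prod Qpoly[OF a[OF i]] Qpoly[OF base_line_forms])
    moreover have "\<not> (\<forall>t. (\<Prod>j\<in>{..<6} - {i}. bl j (Q t)) = 0)"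
    proof
      assume "\<forall>t. (\<Prod>j\<in>{..<6} - {i}. bl j (Q t)) = 0"
      then obtain j where j: "j \<in> {..<6} - {i}" "\<forall>t. bl j (Q t) = 0"
        using polyfun_prod_eq_0[OF inf, of "{..<6} - {i}" "\<lambda>j t. bl j (Q t)" UNIV] Qpoly[OF base_line_forms] by auto
      obtain k where "bl j (cross b c i k) \<noteq> 0" using bl_nonzero_on_line[of i j] i j(1) by auto
      moreover have "cross b c i k = Q (\<lambda>x. if x = 1 then c i - c k else b k - b i)"
        by (simp add: Q_def cross_def algebra_simps)
      ultimately show False using j(2) by metis
    qed
    ultimately have 0: "a i (Q t) = 0" for t by blast
    have "a i (x, y, w) = a i (Q (\<lambda>x. if x = 1 then y else w))" for x y w
      unfolding Q_def using bform_cong[OF a[OF i]] by simp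
    then show ?thesis using 0 by auto
  qed
  have "a 0 q * (\<Prod>j\<in>{..<6} - {0}. bl j q) = 0" for q
  proof -
    have "(\<Sum>i<6. a i q * (\<Prod>j\<in>{..<6} - {i}. bl j q))
      = (\<Sum>i<6::nat. if i = 0 then a 0 q * (\<Prod>j\<in>{..<6} - {0}. bl j q) else 0)"
    proof (intro sum.cong refl)
      fix i :: nat assume "i \<in> {..<6}"
      then have "i \<noteq> 0 \<Longrightarrow> a i q = 0" using pos by blast
      then show "a i q * (\<Prod>j\<in>{..<6} - {i}. bl j q) = (if i = 0 then a 0 q * (\<Prod>j\<in>{..<6} - {0}. bl j q) else 0)"
      proof (cases "i = 0")
        case False
        then have "a i q = 0" using \<open>i \<noteq> 0 \<Longrightarrow> a i q = 0\<close> by blast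
        then show ?thesis using False by (simp only: if_False mult_zero_left)
      qed simp
    qed
    then show ?thesis using z[of q] by simp
  qed
  then have "(\<forall>t :: nat \<Rightarrow> 'k. a 0 (t 0, t 1, t 2) = 0) \<or> (\<forall>t :: nat \<Rightarrow> 'k. (\<Prod>j\<in>{..<6} - {0}. bl j (t 0, t 1, t 2)) = 0)"
    by (intro polyfun_mult_eq_0[OF inf, of _ UNIV] polyfun_prod form_polyfun[OF a0] form_polyfun[OF base_line_forms] polyfun.var) auto
  moreover have "\<not> (\<forall>t :: nat \<Rightarrow> 'k. (\<Prod>j\<in>{..<6} - {0}. bl j (t 0, t 1, t 2)) = 0)"
  proof
    assume *: "\<forall>t :: nat \<Rightarrow> 'k. (\<Prod>j\<in>{..<6} - {0}. bl j (t 0, t 1, t 2)) = 0"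
    have "\<exists>j\<in>{..<6} - {0}. \<forall>t :: nat \<Rightarrow> 'k. bl j (t 0, t 1, t 2) = 0"
      by (rule polyfun_prod_eq_0[OF inf, where I = UNIV])
        (use * in \<open>auto intro!: form_polyfun[OF base_line_forms] polyfun.var simp del: prod_zero_iff\<close>)
    then obtain j where j: "j \<in> {..<6} - {0}" "\<forall>t :: nat \<Rightarrow> 'k. bl j (t 0, t 1, t 2) = 0"
      by blast
    obtain k where "bl j (cross b c 0 k) \<noteq> 0" using bl_nonzero_on_line[of 0 j] j(1) by auto
    moreover have "bl j (x, y, w) = 0" for x y w
      using j(2)[rule_format, of "\<lambda>n. if n = 0 then x else if n = 1 then y else w"] by simp
    ultimately show False by (metis prod.collapse)
  qed
  ultimately have 0: "\<forall>t :: nat \<Rightarrow> 'k. a 0 (t 0, t 1, t 2) = 0" by blast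
  have "a 0 (x, y, w) = 0" for x y w
    using 0[rule_format, of "\<lambda>n. if n = 0 then x else if n = 1 then y else w"] by simp
  then show ?thesis using pos[of i] i by (cases "i = 0"; cases q) auto
qed

section \<open>The parametrisation in the remaining coordinates\<close>

definition J :: "(nat \<times> nat \<times> nat \<times> nat + nat \<times> nat) set" where
  "J = pars e - {dropped}"

definition \<Theta> :: "(nat \<times> nat \<times> nat \<times> nat + nat \<times> nat \<Rightarrow> 'k) \<Rightarrow> nat \<times> nat \<times> nat \<Rightarrow> 'k" where
  "\<Theta> t = cf (e + 5) (moved_form (t(dropped := 0)))"

lemma dropped_in_pars: "dropped \<in> pars e"
  by (auto simp: dropped_def pars_def amon_def Mon_def)

lemma finite_J: "finite J"
  by (simp add: J_def)

lemma card_J: "card J = (e + 5 + 2 choose 2) - 4"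
  using dropped_in_pars by (simp add: J_def card_pars)

lemma \<Theta>_polyfun: "(\<lambda>t. \<Theta> t m) \<in> polyfun J"
  unfolding \<Theta>_def
proof (rule polyfun_compose[OF cf_forms(1)[OF inf moved_form_forms]])
  show "(\<lambda>t. (t(dropped := 0)) k) \<in> polyfun J" if "k \<in> pars e" for k
    using that by (cases "k = dropped") (auto simp: J_def intro: polyfun.intros)
qed

lemma \<Theta>_support: "m \<notin> Mon (e + 5) \<Longrightarrow> \<Theta> t m = 0"
  unfolding \<Theta>_def by (rule cf_forms(3)[OF inf moved_form_forms])

lemma evalF_\<Theta>: "evalF (e + 5) (\<Theta> t) q = moved_form (t(dropped := 0)) q"
  unfolding \<Theta>_def by (rule cf_forms(2)[OF inf moved_form_forms])

lemma moved_line_0: "moved_line (\<lambda>_. 0) i = base_line lam b c i"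
  by (simp add: moved_line_def trans_def dir_line_def base_line_def)

lemma evalF_\<Theta>_0: "evalF (e + 5) (\<Theta> (\<lambda>_. 0)) q = (\<Sum>i<6. Mf q ^ e * (\<Prod>j\<in>{..<6} - {i}. bl j q))"
proof -
  have "mult_form e (\<lambda>_. 0) i q = 0" for i by (simp add: mult_form_def)
  moreover have "(\<lambda>_. 0)(dropped := 0) = (\<lambda>_. 0 :: 'k)" by auto
  ultimately show ?thesis by (simp add: evalF_\<Theta> moved_form_def moved_line_0)
qed

lemma evalF_tangent:
  "evalF (e + 5) (\<lambda>m. \<Sum>k\<in>J. y k * cf (e + 5) (tangent k) m) q = (\<Sum>k\<in>pars e. (y(dropped := 0)) k * tangent k q)"
proof -
  have "evalF (e + 5) (\<lambda>m. \<Sum>k\<in>J. y k * cf (e + 5) (tangent k) m) q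
    = (\<Sum>k\<in>J. y k * evalF (e + 5) (cf (e + 5) (tangent k)) q)"
    unfolding evalF_eq sum_distrib_right sum_distrib_left by (subst sum.swap) (simp add: mult.assoc)
  also have "\<dots> = (\<Sum>k\<in>J. y k * tangent k q)"
    by (intro sum.cong refl) (simp add: cf_form(1)[OF inf tangent_forms] J_def)
  also have "\<dots> = (\<Sum>k\<in>pars e. (y(dropped := 0)) k * tangent k q)"
    by (rule sum.mono_neutral_cong_left) (auto simp: J_def)
  finally show ?thesis .
qed

text \<open>At the fifteen points the base form and all multiplier directions vanish, and
  \<open>key\<close> makes the line parameters zero. What is left is a relation between multipliers
  of fixed lines, excluded by \<open>multipliers_zero\<close>.\<close>

lemma tangent_independent:
  assumes "\<forall>m\<in>Mon (e + 5). c0 * \<Theta> (\<lambda>_. 0) m + (\<Sum>k\<in>J. y k * cf (e + 5) (tangent k) m) = 0"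
  shows "c0 = 0 \<and> (\<forall>k\<in>J. y k = 0)"
proof -
  define z where "z = y(dropped := 0)"
  let ?z = "\<lambda>\<kappa>. z (Inr \<kappa>)"
  have all: "c0 * (\<Sum>i<6. Mf q ^ e * (\<Prod>j\<in>{..<6} - {i}. bl j q)) + (\<Sum>k\<in>pars e. z k * tangent k q) = 0" for q
  proof -
    have "c0 * evalF (e + 5) (\<Theta> (\<lambda>_. 0)) q + evalF (e + 5) (\<lambda>m. \<Sum>k\<in>J. y k * cf (e + 5) (tangent k) m) q
      = (\<Sum>m\<in>Mon (e + 5). (c0 * \<Theta> (\<lambda>_. 0) m + (\<Sum>k\<in>J. y k * cf (e + 5) (tangent k) m)) * mon3 m q)"
      by (simp add: evalF_eq sum_distrib_left distrib_right sum.distrib mult.assoc)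
    also have "\<dots> = 0" using assms by simp
    finally show ?thesis unfolding evalF_\<Theta>_0 evalF_tangent z_def .
  qed
  have z0: "\<forall>\<kappa>\<in>{..<6} \<times> {1, 2}. z (Inr \<kappa>) = 0"
  proof (rule key)
    fix j k :: nat assume jk: "j < 6" "k < 6" "j \<noteq> k"
    let ?P = "cross b c j k"
    have p0: "(\<Prod>m\<in>{..<6} - {i}. bl m ?P) = 0" for i
      using jk bl_cross[of j k] by (cases "i = j") (auto intro!: prod_zero)
    have "Mf ?P ^ e * ((\<Sum>j<6. dot3 (dir_line K ?z j) ?P * E4 (\<lambda>m. bl m ?P) j)
      + 3 * (\<Sum>\<kappa>\<in>K. z (Inr \<kappa>) * (dot3 (\<nu> \<kappa>) ?P)\<^sup>2) * E3 (\<lambda>m. bl m ?P)) = 0"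
      using all[of ?P] unfolding sum_tangent p0 by simp
    then have "(\<Sum>j<6. dot3 (dir_line K ?z j) ?P * E4 (\<lambda>m. bl m ?P) j)
      + 3 * (\<Sum>\<kappa>\<in>K. z (Inr \<kappa>) * (dot3 (\<nu> \<kappa>) ?P)\<^sup>2) * E3 (\<lambda>m. bl m ?P) = 0"
      using Mf_cross[OF jk] by simp
    then show "(dot3 (dir_line K ?z j) ?P + dot3 (dir_line K ?z k) ?P) * (\<Prod>m\<in>{..<6} - {j, k}. bl m ?P)
      + 3 * (\<Sum>\<kappa>\<in>K. z (Inr \<kappa>) * (dot3 (\<nu> \<kappa>) ?P)\<^sup>2) * E3 (\<lambda>m. bl m ?P) = 0"
      using sum_E4_double_zero[OF jk, of "\<lambda>m. bl m ?P" "\<lambda>i. dot3 (dir_line K ?z i) ?P"] bl_cross[of j k] by simp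
  qed
  have "dot3 (dir_line K ?z j) q = 0" if "j < 6" for j q
    using z0 that by (cases q) (simp add: dir_line_def dot3_def)
  moreover have "(\<Sum>\<kappa>\<in>K. z (Inr \<kappa>) * (dot3 (\<nu> \<kappa>) q)\<^sup>2) = 0" for q
    using z0 K by (intro sum.neutral) auto
  ultimately have "(\<Sum>k\<in>pars e. z k * tangent k q) = (\<Sum>i<6. mult_form e z i q * (\<Prod>j\<in>{..<6} - {i}. bl j q))" for q
    unfolding sum_tangent by simp
  then have mz: "(\<Sum>i<6. (c0 * Mf q ^ e + mult_form e z i q) * (\<Prod>j\<in>{..<6} - {i}. bl j q)) = 0" for q
    using all[of q] by (simp add: distrib_right sum.distrib sum_distrib_left mult.assoc)
  have mf: "form (amon e i) (mult_form e z i)" for i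
    unfolding mult_form_def[abs_def] by (intro forms_sum forms_scale polyfun.const forms_mon) auto
  have Mfe: "form (bMon e) (\<lambda>q. c0 * Mf q ^ e)"
    by (intro forms_scale polyfun.const bforms_power Mf_forms)
  have a: "c0 * Mf q ^ e + mult_form e z i q = 0" if "i < 6" for i q
  proof (rule multipliers_zero[OF _ _ mz that])
    show "form (Mon e) (\<lambda>q. c0 * Mf q ^ e + mult_form e z 0 q)"
      using mf[of 0] by (intro forms_add bforms_forms[OF Mfe]) (simp add: amon_def)
    show "form (bMon e) (\<lambda>q. c0 * Mf q ^ e + mult_form e z i q)" if "0 < i" for i
      using mf[of i] that by (intro forms_add Mfe) (simp add: amon_def)
  qed
  \<comment> \<open>At \<open>(0, 1, 0)\<close> only the monomial \<open>x1^e\<close> is seen. Its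
    direction has been dropped, while it has coefficient 1 in \<open>Mf^e\<close>; this isolates
    \<open>c0\<close>.\<close>
  have "mult_form e z 0 (0, 1, 0) = (\<Sum>m\<in>Mon e. if m = (0, e, 0) then z dropped else 0)"
    unfolding mult_form_def by (intro sum.cong) (auto simp: amon_def mon3_def dropped_def Mon_def)
  also have "\<dots> = 0" by (simp add: z_def)
  finally have c0: "c0 = 0" using a[of 0 "(0, 1, 0)"] by (simp add: Mf_def)
  have "z k = 0" if k: "k \<in> pars e" for k
  proof (cases k)
    case (Inl p)
    then obtain i m where im: "p = (i, m)" "i < 6" "m \<in> amon e i" using k by (auto simp: pars_def)
    have "amon e i \<subseteq> Mon e" by (auto simp: amon_def bMon_def)
    moreover have "(\<Sum>m\<in>amon e i. z (Inl (i, m)) * mon3 m q) = 0" for q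
      using a[OF im(2), of q] c0 by (simp add: mult_form_def)
    ultimately have "z (Inl (i, m)) = 0"
      using form_coeff_0[OF inf, of "amon e i" e "\<lambda>m. z (Inl (i, m))"] im(3) by blast
    then show ?thesis using Inl im(1) by simp
  next
    case (Inr \<kappa>)
    then show ?thesis using z0 k by (auto simp: pars_def)
  qed
  then have "y k = 0" if "k \<in> J" for k
    using that unfolding J_def z_def by (metis DiffE fun_upd_other insertI1)
  then show ?thesis using c0 by blast
qed

text \<open>Parameters in \<open>K\<close> move as \<open>s * \<rho>\<close> with
  \<open>\<rho>^2 = y\<close>, all others as \<open>s^2 * y\<close>. The term of order
  \<open>s\<close> carries the factor \<open>2 * N\<close> and vanishes; at order \<open>s^2\<close>
  the translations enter through \<open>N^2\<close>, which Frobenius makes linear in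
  \<open>y\<close>, and mixed terms come later.\<close>

lemma curve:
  "\<exists>\<gamma>. (\<forall>s k. y k = 0 \<longrightarrow> \<gamma> s k = 0) \<and> (\<forall>m\<in>Mon (e + 5). \<exists>R. \<forall>s. \<Theta> (\<gamma> s) m =
      \<Theta> (\<lambda>_. 0) m + s\<^sup>2 * (\<Sum>k\<in>J. y k * cf (e + 5) (tangent k) m) + s ^ 3 * poly R s)"
proof -
  obtain \<rho> where \<rho>: "\<And>\<kappa>. (\<rho> \<kappa>)\<^sup>2 = y (Inr \<kappa>)"
  proof -
    have "\<forall>\<kappa>. \<exists>x. x\<^sup>2 = y (Inr \<kappa>)" using sqrt by blast
    then show ?thesis using that by metis
  qed
  define \<gamma> where "\<gamma> s k = (case k of Inl _ \<Rightarrow> s\<^sup>2 * y k | Inr \<kappa> \<Rightarrow> if \<kappa> \<in> K then s * \<rho> \<kappa> else s\<^sup>2 * y k)" for s k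
  have "\<rho> \<kappa> = 0" if "y (Inr \<kappa>) = 0" for \<kappa> using \<rho>[of \<kappa>] that by simp
  then have \<gamma>0: "\<gamma> s k = 0" if "y k = 0" for s k
    using that by (auto simp: \<gamma>_def split: sum.splits)
  define z where "z = y(dropped := 0)"
  define N where "N q = dot3 (trans \<rho>) q" for q
  \<comment> \<open>The moved form along the curve at a fixed \<open>q\<close>, as a polynomial in
    \<open>s\<close>.\<close>
  define G where "G q = (\<Sum>i<6. [:Mf q ^ e, 0, mult_form e z i q:] * (\<Prod>j\<in>{..<6} - {i}. [:bl j q, N q, dot3 (dir_line K (\<lambda>\<kappa>. y (Inr \<kappa>)) j) q:]))" for q
  have N2: "2 * N q = 0" for q
    using char unfolding N_def dot3_trans by auto
  have Nsq: "(N q)\<^sup>2 = (\<Sum>\<kappa>\<in>K. y (Inr \<kappa>) * (dot3 (\<nu> \<kappa>) q)\<^sup>2)" for q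
    using char
  proof
    assume "(2 :: 'k) = 0"
    then show ?thesis unfolding N_def dot3_trans by (simp add: square_sum_char_2 power_mult_distrib \<rho>)
  next
    assume "K = {}"
    then show ?thesis unfolding N_def dot3_trans by simp
  qed
  have mf: "moved_form ((\<gamma> s)(dropped := 0)) q = poly (G q) s" for s q
  proof -
    have 1: "mult_form e ((\<gamma> s)(dropped := 0)) i q = s\<^sup>2 * mult_form e z i q" for i
      unfolding mult_form_def sum_distrib_left by (intro sum.cong refl) (auto simp: \<gamma>_def z_def)
    have 2: "((\<gamma> s)(dropped := 0)) (Inr \<kappa>) = \<gamma> s (Inr \<kappa>)" for \<kappa> by (simp add: dropped_def)
    have 3: "dot3 (dir_line K (\<lambda>\<kappa>. \<gamma> s (Inr \<kappa>)) j) q = s\<^sup>2 * dot3 (dir_line K (\<lambda>\<kappa>. y (Inr \<kappa>)) j) q" for j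
      by (cases q) (simp add: dir_line_def dot3_def \<gamma>_def algebra_simps)
    have 4: "dot3 (trans (\<lambda>\<kappa>. \<gamma> s (Inr \<kappa>))) q = s * N q"
      unfolding N_def dot3_trans sum_distrib_left by (intro sum.cong refl) (simp add: \<gamma>_def)
    show ?thesis
      unfolding moved_form_def 2 dot3_moved_line 1 3 4 G_def poly_sum poly_mult poly_prod
      by (intro sum.cong refl arg_cong2[of _ _ _ _ "(*)"] prod.cong) (simp_all add: power2_eq_square algebra_simps)
  qed
  have "\<exists>p. \<forall>s. \<gamma> s k = poly p s" for k
  proof -
    have "\<gamma> s k = poly (case k of Inl _ \<Rightarrow> [:0, 0, y k:] | Inr \<kappa> \<Rightarrow> if \<kappa> \<in> K then [:0, \<rho> \<kappa>:] else [:0, 0, y k:]) s" for s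
      by (simp add: \<gamma>_def power2_eq_square split: sum.splits)
    then show ?thesis by blast
  qed
  then have "\<exists>p. \<forall>s. \<Theta> (\<gamma> s) m = poly p s" for m
    by (intro polyfun_poly[OF \<Theta>_polyfun])
  then obtain p where p: "\<And>m s. \<Theta> (\<gamma> s) m = poly (p m) s" by metis
  have coeffs: "(\<Sum>m\<in>Mon (e + 5). coeff (p m) n * mon3 m q) = coeff (G q) n" for n q
  proof -
    have "(\<Sum>m\<in>Mon (e + 5). smult (mon3 m q) (p m)) - G q = 0"
    proof (rule poly_eq_0_cofinite[OF inf, of "{}"])
      fix s
      have "(\<Sum>m\<in>Mon (e + 5). mon3 m q * poly (p m) s) = evalF (e + 5) (\<Theta> (\<gamma> s)) q"
        by (simp add: evalF_eq p mult.commute)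
      then show "poly ((\<Sum>m\<in>Mon (e + 5). smult (mon3 m q) (p m)) - G q) s = 0"
        by (simp add: poly_sum evalF_\<Theta> mf)
    qed simp
    then have "G q = (\<Sum>m\<in>Mon (e + 5). smult (mon3 m q) (p m))" by simp
    then show ?thesis by (simp add: coeff_sum mult.commute)
  qed
  have uniq: "coeff (p m) n = F m" if "\<And>q. coeff (G q) n = evalF (e + 5) F q" "m \<in> Mon (e + 5)" for n F m
  proof -
    have "(\<Sum>m\<in>Mon (e + 5). (coeff (p m) n - F m) * mon3 m q) = 0" for q
      using coeffs[of n q] that(1)[of q] by (simp add: evalF_eq left_diff_distrib sum_subtractf)
    then have "coeff (p m) n - F m = 0"
      using form_coeff_0[OF inf subset_refl, where c = "\<lambda>m. coeff (p m) n - F m"] that(2) by blast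
    then show ?thesis by simp
  qed
  have "\<exists>R. \<forall>s. \<Theta> (\<gamma> s) m = \<Theta> (\<lambda>_. 0) m + s\<^sup>2 * (\<Sum>k\<in>J. y k * cf (e + 5) (tangent k) m) + s ^ 3 * poly R s"
    if m: "m \<in> Mon (e + 5)" for m
  proof -
    have 0: "coeff (p m) 0 = \<Theta> (\<lambda>_. 0) m"
      by (rule uniq[OF _ m]) (simp only: G_def star_curve_coeff(1)[OF N2] evalF_\<Theta>_0)
    have 1: "coeff (p m) (Suc 0) = (\<lambda>_. 0) m"
      by (rule uniq[OF _ m]) (simp only: G_def star_curve_coeff(2)[OF N2] evalF_eq mult_zero_left sum.neutral_const)
    have 2: "coeff (p m) 2 = (\<Sum>k\<in>J. y k * cf (e + 5) (tangent k) m)"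
    proof (rule uniq[OF _ m])
      fix q
      have "z (Inr \<kappa>) = y (Inr \<kappa>)" for \<kappa> by (simp add: z_def dropped_def)
      then show "coeff (G q) 2 = evalF (e + 5) (\<lambda>m. \<Sum>k\<in>J. y k * cf (e + 5) (tangent k) m) q"
        unfolding G_def star_curve_coeff(3)[OF N2] evalF_tangent z_def[symmetric] sum_tangent Nsq by simp
    qed
    obtain x0 x1 x2 R where R: "p m = pCons x0 (pCons x1 (pCons x2 R))" by (metis pCons_cases)
    then have "x0 = coeff (p m) 0" "x1 = coeff (p m) (Suc 0)" "x2 = coeff (p m) 2"
      by (simp_all add: numeral_2_eq_2)
    then have "poly (p m) s = \<Theta> (\<lambda>_. 0) m + s\<^sup>2 * (\<Sum>k\<in>J. y k * cf (e + 5) (tangent k) m) + s ^ 3 * poly R s" for s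
      unfolding 0 1 2 by (simp add: R power2_eq_square power3_eq_cube algebra_simps)
    then show ?thesis unfolding p by blast
  qed
  then show ?thesis using \<gamma>0 by blast
qed

text \<open>Tuples outside general position are zeros of the polynomial \<open>\<delta>\<close>,
  which is nonzero at the base point. A form vanishing on \<open>S\<close> vanishes wherever
  \<open>\<delta>\<close> does not, hence on the whole image.\<close>

lemma \<Theta>_in_closure:
  assumes x: "(\<lambda>m. a * \<Theta> t m) \<in> pts (Mon (e + 5))"
  shows "(\<lambda>m. a * \<Theta> t m) \<in> proj_closure (Mon (e + 5)) (S (e + 5) 6)"
proof -
  define T :: "(nat \<times> nat \<times> nat) set" where "T = {(i, j, k). i < 6 \<and> j < 6 \<and> k < 6 \<and> i \<noteq> j \<and> j \<noteq> k \<and> i \<noteq> k}"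
  have T: "finite T" by (rule finite_subset[of _ "{..<6} \<times> {..<6} \<times> {..<6}"]) (auto simp: T_def)
  define ml where "ml t = moved_line (\<lambda>\<kappa>. t (Inr \<kappa>))" for t :: "nat \<times> nat \<times> nat \<times> nat + nat \<times> nat \<Rightarrow> 'k"
  define \<delta> where "\<delta> t = (\<Prod>p\<in>T. det3 (ml t (fst p)) (ml t (fst (snd p))) (ml t (snd (snd p))))" for t
  have if0: "(\<lambda>t. if Q then 0 else t k) \<in> polyfun UNIV" for Q and k :: "nat \<times> nat \<times> nat \<times> nat + nat \<times> nat"
    by (cases Q) (auto intro: polyfun.intros)
  have ml: "(\<lambda>t. fst (ml t i)) \<in> polyfun UNIV" "(\<lambda>t. fst (snd (ml t i))) \<in> polyfun UNIV"
    "(\<lambda>t. snd (snd (ml t i))) \<in> polyfun UNIV" for i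
    unfolding ml_def moved_line_def trans_def dir_line_def fst_conv snd_conv
    by (intro polyfun.add polyfun_sum polyfun.mult polyfun.const if0 polyfun.var UNIV_I)+
  have \<delta>: "\<delta> \<in> polyfun UNIV"
    unfolding \<delta>_def[abs_def] det3_def
    by (intro polyfun_prod polyfun.add polyfun_diff polyfun.mult ml)
  have \<delta>0: "\<delta> (\<lambda>_. 0) \<noteq> 0"
    unfolding \<delta>_def ml_def moved_line_0 using T det by (auto simp: T_def)
  have inS: "(\<lambda>m. a * \<Theta> t m) \<in> S (e + 5) 6" if "\<delta> t \<noteq> 0" "(\<lambda>m. a * \<Theta> t m) \<in> pts (Mon (e + 5))" for t
  proof -
    have "det3 (ml t i) (ml t j) (ml t k) \<noteq> 0" if "i < 6" "j < 6" "k < 6" "i \<noteq> j" "j \<noteq> k" "i \<noteq> k" for i j k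
      using \<open>\<delta> t \<noteq> 0\<close> T that unfolding \<delta>_def by (auto simp: T_def)
    then have D: "ml t \<in> D 6" by (rule D_if_det3)
    have "evalF (e + 5) (\<lambda>m. a * \<Theta> t m) q = 0" if q: "q \<in> star 6 (ml t)" for q
    proof -
      obtain i j where ij: "i < 6" "j < 6" "i \<noteq> j" "dot3 (ml t i) q = 0" "dot3 (ml t j) q = 0"
        using q unfolding star_def by blast
      have p0: "(\<Prod>m\<in>{..<6} - {n}. dot3 (ml t m) q) = 0" for n
        using ij by (cases "n = i") (auto intro!: prod_zero)
      have dr: "(t(dropped := 0)) (Inr \<kappa>) = t (Inr \<kappa>)" for \<kappa> by (simp add: dropped_def)
      have "moved_form (t(dropped := 0)) q = 0" unfolding moved_form_def dr p0[unfolded ml_def] by simp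
      moreover have "evalF (e + 5) (\<lambda>m. a * \<Theta> t m) q = a * evalF (e + 5) (\<Theta> t) q"
        by (simp add: evalF_eq sum_distrib_left mult.assoc)
      ultimately show ?thesis by (simp add: evalF_\<Theta>)
    qed
    then show ?thesis using D that(2) unfolding S_def by blast
  qed
  obtain l where l: "a * \<Theta> t l \<noteq> 0" using x by (auto simp: pts_def fun_eq_iff)
  have "p (\<lambda>m. a * \<Theta> t m) = 0" if p: "hom_poly (Mon (e + 5)) p" "\<forall>F\<in>S (e + 5) 6. p F = 0" for p
  proof -
    have "p \<in> polyfun (Mon (e + 5))" using p(1) hom_deg_polyfun unfolding hom_poly_iff by blast
    then have P: "(\<lambda>t. p (\<lambda>m. a * \<Theta> t m)) \<in> polyfun UNIV"
      by (rule polyfun_compose) (intro polyfun.mult polyfun.const polyfun_mono[OF \<Theta>_polyfun] subset_UNIV)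
    have L: "(\<lambda>t. a * \<Theta> t l) \<in> polyfun UNIV"
      by (intro polyfun.mult polyfun.const polyfun_mono[OF \<Theta>_polyfun] subset_UNIV)
    \<comment> \<open>The last factor disposes of the parameters at which the vector is
      zero.\<close>
    have "p (\<lambda>m. a * \<Theta> t m) * (\<delta> t * (a * \<Theta> t l)) = 0" for t
    proof (cases "(\<lambda>m. a * \<Theta> t m) \<in> pts (Mon (e + 5))")
      case True
      then show ?thesis using inS[of t] p(2) by (cases "\<delta> t = 0") auto
    next
      case False
      then have "(\<lambda>m. a * \<Theta> t m) = (\<lambda>_. 0)" using \<Theta>_support by (simp add: pts_def)
      then have "a * \<Theta> t l = 0" by (rule fun_cong)
      then show ?thesis by simp
    qed
    then have "(\<forall>t. p (\<lambda>m. a * \<Theta> t m) = 0) \<or> (\<forall>t. \<delta> t * (a * \<Theta> t l) = 0)"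
      by (rule polyfun_mult_eq_0[OF inf P polyfun.mult[OF \<delta> L]])
    moreover have "(\<forall>t. \<delta> t = 0) \<or> (\<forall>t. a * \<Theta> t l = 0)" if "\<And>t. \<delta> t * (a * \<Theta> t l) = 0"
      using that by (rule polyfun_mult_eq_0[OF inf \<delta> L])
    ultimately show ?thesis using \<delta>0 l by blast
  qed
  moreover have "S (e + 5) 6 \<subseteq> pts (Mon (e + 5))" by (auto simp: S_def)
  ultimately show ?thesis using x by (subst proj_closure_eq) auto
qed

lemma S_chain_exists:
  "\<exists>Z. (\<forall>j\<le>(e + 5 + 2 choose 2) - 4. proj_irreducible (Mon (e + 5)) (Z j))
    \<and> (\<forall>j<(e + 5 + 2 choose 2) - 4. Z j \<subset> Z (Suc j))
    \<and> Z ((e + 5 + 2 choose 2) - 4) \<subseteq> proj_closure (Mon (e + 5)) (S (e + 5) 6 :: (_ \<Rightarrow> 'k) set)"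
  unfolding card_J[symmetric]
proof (rule irreducible_chain_exists[OF inf finite_Mon finite_J \<Theta>_polyfun \<Theta>_support _ curve \<Theta>_in_closure])
  show "c0 = 0 \<and> (\<forall>k\<in>J. y k = 0)"
    if "\<forall>m\<in>Mon (e + 5). c0 * \<Theta> (\<lambda>_. 0) m + (\<Sum>k\<in>J. y k * cf (e + 5) (tangent k) m) = 0" for c0 y
    using that by (rule tangent_independent)
qed (auto simp: S_def)

end

section \<open>Two base configurations\<close>

text \<open>With \<open>base_c\<close> the lines are \<open>(1,0,0)\<close>, \<open>(1,1,0)\<close>,
  \<open>(1,0,1)\<close>, \<open>(1,s,-s)\<close>, \<open>(1,1,-s)\<close>, \<open>(1,-s,1)\<close>.
  Up to sign their 3 by 3 minors are products of factors of \<open>s^5 - s\<close>, so one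
  inequality on \<open>s\<close> gives general position in every characteristic.\<close>

definition base_b :: "'k::field \<Rightarrow> nat \<Rightarrow> 'k" where
  "base_b s i = [0, 1, 0, s, 1, - s] ! i"

definition base_c :: "'k::field \<Rightarrow> nat \<Rightarrow> 'k" where
  "base_c s i = [0, 0, 1, - s, - s, 1] ! i"

definition base_lam :: "'k::field \<Rightarrow> nat \<Rightarrow> 'k" where
  "base_lam a i = (if i = 0 then a else 1)"

lemmas base_defs = base_b_def base_c_def base_lam_def

lemma less_six_cases: "i < 6 \<Longrightarrow> i = 0 \<or> i = 1 \<or> i = 2 \<or> i = 3 \<or> i = 4 \<or> i = (5::nat)"
  by auto

lemma det3_swap: "det3 v u w = - det3 u v w" "det3 u w v = - det3 u v w"
  by (simp_all add: det3_def algebra_simps)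

lemma det3_base_line:
  "det3 (base_line lam b c i) (base_line lam b c j) (base_line lam b c k)
    = lam i * lam j * lam k * det3 (1, b i, c i) (1, b j, c j) (1, b k, c k)"
  by (simp add: det3_def base_line_def algebra_simps)

lemma det3_cross: "det3 (base_line lam b c m) (base_line lam b c j) (base_line lam b c k)
    = lam j * lam k * dot3 (base_line lam b c m) (cross b c j k)"
  by (simp add: det3_def base_line_def cross_def dot3_def algebra_simps)

lemma base_det:
  fixes s a :: "'k::field"
  assumes a: "a \<noteq> 0" and s: "s ^ 5 \<noteq> s" and ijk: "i < 6" "j < 6" "k < 6" "i \<noteq> j" "j \<noteq> k" "i \<noteq> k"
  shows "det3 (base_line (base_lam a) (base_b s) (base_c s) i) (base_line (base_lam a) (base_b s) (base_c s) j)
    (base_line (base_lam a) (base_b s) (base_c s) k) \<noteq> 0"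
proof -
  let ?l = "\<lambda>i. (1, base_b s i, base_c s i)"
  have "s ^ 5 - s = s * (1 - s) * (1 + s) * (- 1 - s * s)"
    by (simp add: algebra_simps eval_nat_numeral)
  then have "s * (1 - s) * (1 + s) * (- 1 - s * s) \<noteq> 0" using s by auto
  then have nz: "s \<noteq> 0" "1 - s \<noteq> 0" "1 + s \<noteq> 0" "- 1 - s * s \<noteq> 0"
    by (simp_all only: mult_eq_0_iff de_Morgan_disj simp_thms)
  \<comment> \<open>Reordering a triple changes only the sign, so the twenty increasing triples
    suffice.\<close>
  have sorted: "det3 (?l i) (?l j) (?l k) \<noteq> 0" if ijk: "i < j" "j < k" "k < 6" for i j k
  proof -
    have "i < 6" "j < 6" using ijk by auto
    from less_six_cases[OF this(1)] less_six_cases[OF this(2)] less_six_cases[OF ijk(3)] ijk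
    have "det3 (?l i) (?l j) (?l k) \<in> {1, - 1, s, - s, s * (1 - s), (1 - s) * (1 + s), - 1 - s * s, - s * (1 + s)}"
      by (elim disjE) (simp_all add: det3_def base_defs algebra_simps)
    then show ?thesis using nz by (elim insertE emptyE) (simp_all only: mult_eq_0_iff neg_equal_0_iff_equal one_neq_zero simp_thms)
  qed
  have "i < j \<and> j < k \<or> i < k \<and> k < j \<or> j < i \<and> i < k \<or> j < k \<and> k < i \<or> k < i \<and> i < j \<or> k < j \<and> j < i"
    using ijk by linarith
  then have "det3 (?l i) (?l j) (?l k) \<noteq> 0"
    using sorted[of i j k] sorted[of i k j] sorted[of j i k] sorted[of j k i] sorted[of k i j] sorted[of k j i] ijk(1-3)
      det3_swap(1)[of "?l i" "?l j"] det3_swap(1)[of "?l i" "?l k"] det3_swap(1)[of "?l j" "?l k"]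
      det3_swap(2)[of _ "?l i" "?l j"] det3_swap(2)[of _ "?l i" "?l k"] det3_swap(2)[of _ "?l j" "?l k"]
    by (metis neg_equal_0_iff_equal)
  then show ?thesis using a by (simp add: det3_base_line base_lam_def)
qed

text \<open>The equation for \<open>j\<close>, \<open>k\<close> says that the displacements of the
  two lines cancel at their intersection. Twelve equations eliminate the twelve unknowns one by one.
  A factor 2 shows up three times, in accordance with the three translations that enter the kernel
  in characteristic 2.\<close>

lemma base_key_char_not_2:
  fixes s :: "'k::field"
  assumes s: "s ^ 5 \<noteq> s" and two: "(2 :: 'k) \<noteq> 0"
    and H: "\<And>j k. j < 6 \<Longrightarrow> k < 6 \<Longrightarrow> j \<noteq> k \<Longrightarrow>
      dot3 (dir_line {} y j) (cross (base_b s) (base_c s) j k) + dot3 (dir_line {} y k) (cross (base_b s) (base_c s) j k) = 0"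
  shows "\<forall>\<kappa>\<in>{..<6} \<times> {1, 2}. y \<kappa> = 0"
proof -
  have s0: "s \<noteq> 0" "s \<noteq> 1" "1 + s \<noteq> 0" using s by (auto simp: eval_nat_numeral add_eq_0_iff)
  note defs = base_defs dir_line_def cross_def dot3_def
  have e01: "y (1, 2) = - y (0, 2)" using H[of 0 1] by (simp add: defs eq_neg_iff_add_eq_0 add.commute)
  have e02: "y (2, 1) = - y (0, 1)" using H[of 0 2] by (simp add: defs eq_neg_iff_add_eq_0 add.commute)
  have e12: "y (2, 2) = y (0, 1) + y (0, 2) - y (1, 1)"
    using H[of 1 2] e01 e02 by (simp add: defs) algebra
  have "s * (y (1, 1) + y (4, 1)) = 0" using H[of 1 4] by (simp add: defs) algebra
  then have e14: "y (4, 1) = - y (1, 1)" using s0 by (simp add: eq_neg_iff_add_eq_0 add.commute)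
  have "(1 - s) * (y (3, 2) + y (4, 2)) = 0" using H[of 3 4] by (simp add: defs) algebra
  then have e34: "y (4, 2) = - y (3, 2)" using s0 by (simp add: eq_neg_iff_add_eq_0 add.commute)
  have "s * (y (2, 2) + y (5, 2)) = 0" using H[of 2 5] by (simp add: defs) algebra
  then have e25: "y (5, 2) = - y (2, 2)" using s0 by (simp add: eq_neg_iff_add_eq_0 add.commute)
  have "(1 + s) * (y (4, 1) + y (5, 1) + y (4, 2) + y (5, 2)) = 0" using H[of 4 5] by (simp add: defs) algebra
  then have e45: "y (5, 1) = - y (4, 1) - y (4, 2) - y (5, 2)"
    using s0 by simp algebra
  have "s * (y (0, 1) + y (3, 1) + y (0, 2) + y (3, 2)) = 0" using H[of 0 3] by (simp add: defs) algebra
  then have e03: "y (3, 1) = - y (0, 1) - y (0, 2) - y (3, 2)" using s0 by simp algebra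
  have "2 * s * (y (3, 2) + y (5, 2)) = 0"
    using H[of 3 5] e03 e45 e14 e34 e25 e12 by (simp add: defs) algebra
  then have "y (3, 2) + y (5, 2) = 0" using s0 two by simp
  then have e35: "y (3, 2) = y (0, 1) + y (0, 2) - y (1, 1)" using e25 e12 by algebra
  have "(s - 1) * (y (0, 1) - y (1, 1)) = 0"
    using H[of 0 4] e14 e34 e35 by (simp add: defs) algebra
  then have e04: "y (1, 1) = y (0, 1)" using s0 by simp
  have "2 * s * y (0, 2) = 0"
    using H[of 1 3] e01 e03 e35 e04 by (simp add: defs) algebra
  then have z02: "y (0, 2) = 0" using s0 two by simp
  have "2 * (1 + s) * y (0, 1) = 0"
    using H[of 2 3] e02 e12 e03 e35 e04 z02 by (simp add: defs del: mult_eq_0_iff) algebra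
  then have z01: "y (0, 1) = 0" using s0 two by (metis mult_eq_0_iff)
  have "y (j, x) = 0" if "j < 6" "x = 1 \<or> x = 2" for j x
    using less_six_cases[OF that(1)] that(2) z01 z02 e01 e02 e12 e14 e34 e25 e45 e03 e35 e04
    by (elim disjE) simp_all
  then show ?thesis by auto
qed

definition base_K :: "(nat \<times> nat) set" where
  "base_K = {(0, 1), (0, 2), (1, 1)}"

definition base_nu :: "nat \<times> nat \<Rightarrow> 'k::field \<times> 'k \<times> 'k" where
  "base_nu \<kappa> = (if \<kappa> = (1, 1) then (1, 0, 0) else if \<kappa> = (0, 1) then (0, 1, 0) else (0, 0, 1))"

text \<open>Over the field with four elements the six lines of \<open>base_b\<close>, \<open>base_c\<close> form a dual hyperoval, and with
  equal weights all second-order terms cancel; rescaling the first line breaks the symmetry.\<close>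

lemma base_key_char_2:
  fixes s :: "'k::field"
  assumes s: "s * s = s + 1" and two: "(2 :: 'k) = 0"
    and H: "\<And>j k. j < 6 \<Longrightarrow> k < 6 \<Longrightarrow> j \<noteq> k \<Longrightarrow>
          (dot3 (dir_line base_K y j) (cross (base_b s) (base_c s) j k) + dot3 (dir_line base_K y k) (cross (base_b s) (base_c s) j k))
            * (\<Prod>m\<in>{..<6} - {j, k}. dot3 (base_line (base_lam (s + 1)) (base_b s) (base_c s) m) (cross (base_b s) (base_c s) j k))
          + 3 * (\<Sum>\<kappa>\<in>base_K. y \<kappa> * (dot3 (base_nu \<kappa>) (cross (base_b s) (base_c s) j k))\<^sup>2)
            * E3 (\<lambda>m. dot3 (base_line (base_lam (s + 1)) (base_b s) (base_c s) m) (cross (base_b s) (base_c s) j k)) = 0"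
  shows "\<forall>\<kappa>\<in>{..<6} \<times> {1, 2}. y \<kappa> = 0"
proof -
  note defs = base_defs dir_line_def cross_def dot3_def base_K_def base_nu_def base_line_def E3_def
    lessThan_small insert_Diff_if power2_eq_square
  have xx: "x + x = 0" for x :: 'k
    using two by (metis mult_2 mult_zero_left)
  have xxy: "x + (x + z) = z" for x z :: 'k
    by (simp add: xx flip: add.assoc)
  have neg: "- x = x" "x - z = x + z" for x z :: 'k
    using xx by (simp_all add: neg_eq_iff_add_eq_0 diff_eq_eq xxy add.commute[of x z])
  have num: "numeral (num.Bit0 n) = (0 :: 'k)" "numeral (num.Bit1 n) = (1 :: 'k)" for n
    by (simp_all add: numeral_Bit0 numeral_Bit1 xx)
  have ss: "s * (s * x) = s * x + x" for x
    using s by (simp add: distrib_right flip: mult.assoc)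
  \<comment> \<open>Normal form over the field with four elements: signs disappear, numerals reduce
    modulo 2, \<open>s * s\<close> becomes \<open>s + 1\<close>, and equal summands cancel.\<close>
  note nf = neg num ring_distribs mult_ac add_ac s ss xx xxy
  \<comment> \<open>Scaling by \<open>1\<close>, \<open>s\<close> or \<open>s + 1\<close>, the units
    of that field, gives the unknown to be solved for the coefficient 1.\<close>
  note H' = arg_cong[OF H, of _ _ "\<lambda>x. p * x" for p]
  have e12: "y (1, 2) = 0"
    using H'[of 0 1 s] by (simp add: defs nf del: mult_eq_0_iff)
  have e21: "y (2, 1) = 0"
    using H'[of 0 2 s] by (simp add: defs nf del: mult_eq_0_iff)
  have "y (3, 1) + y (3, 2) = 0"
    using H'[of 0 3 1] by (simp add: defs nf del: mult_eq_0_iff)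
  then have e3: "y (3, 2) = y (3, 1)" by (metis xxy add.right_neutral)
  have "y (4, 2) + s * y (4, 1) = 0"
    using H'[of 0 4 s] by (simp add: defs nf del: mult_eq_0_iff)
  then have e4: "y (4, 2) = s * y (4, 1)" by (metis xxy add.right_neutral)
  have "y (5, 1) + s * y (5, 2) = 0"
    using H'[of 0 5 s] by (simp add: defs nf del: mult_eq_0_iff)
  then have e5: "y (5, 1) = s * y (5, 2)" by (metis xxy add.right_neutral)
  have "y (2, 2) + (s + 1) * (y (1, 1) + y (0, 1) + y (0, 2)) = 0"
    using H'[of 1 2 "s + 1"] e12 e21 by (simp add: defs nf del: mult_eq_0_iff)
  then have f2: "y (2, 2) = (s + 1) * (y (1, 1) + y (0, 1) + y (0, 2))" by (metis xxy add.right_neutral)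
  have "y (3, 1) + (y (1, 1) + y (0, 1) + (s + 1) * y (0, 2)) = 0"
    using H'[of 1 3 "s + 1"] e12 e3 by (simp add: defs nf del: mult_eq_0_iff)
  then have f3: "y (3, 1) = y (1, 1) + y (0, 1) + (s + 1) * y (0, 2)" by (metis xxy add.right_neutral)
  have "y (4, 1) + (s + 1) * (y (1, 1) + y (0, 1)) = 0"
    using H'[of 1 4 "s"] e12 e4 by (simp add: defs nf del: mult_eq_0_iff)
  then have f4: "y (4, 1) = (s + 1) * (y (1, 1) + y (0, 1))" by (metis xxy add.right_neutral)
  have "y (5, 2) + ((s + 1) * (y (1, 1) + y (0, 1)) + y (0, 2)) = 0"
    using H'[of 1 5 "s + 1"] e12 e5 by (simp add: defs nf del: mult_eq_0_iff)
  then have f5: "y (5, 2) = (s + 1) * (y (1, 1) + y (0, 1)) + y (0, 2)" by (metis xxy add.right_neutral)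
  have "y (1, 1) + (s + 1) * (y (0, 1) + y (0, 2)) = 0"
    using H'[of 2 3 "s + 1"] e21 e3 f2 f3 by (simp add: defs nf del: mult_eq_0_iff)
  then have g0: "y (1, 1) = (s + 1) * (y (0, 1) + y (0, 2))" by (metis xxy add.right_neutral)
  have "(s + 1) * y (1, 1) + y (0, 1) = 0"
    using H'[of 2 4 "s + 1"] e21 e4 f2 f4 by (simp add: defs nf del: mult_eq_0_iff)
  then have g1: "y (0, 1) = (s + 1) * y (1, 1)" by (metis xxy add.right_neutral)
  have "y (1, 1) + s * y (0, 2) = 0"
    using H'[of 2 5 "s + 1"] e21 e5 f2 f5 by (simp add: defs nf del: mult_eq_0_iff)
  then have g2: "y (1, 1) = s * y (0, 2)" by (metis xxy add.right_neutral)
  \<comment> \<open>Since \<open>(s + 1) * s = 1\<close>, the last two relations identify these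
    unknowns, and their sum in \<open>g0\<close> then cancels in characteristic 2.\<close>
  have "y (0, 1) = y (0, 2)" unfolding g1 g2 by (simp add: nf)
  then have z11: "y (1, 1) = 0" using g0 by (simp add: xx)
  then have z01: "y (0, 1) = 0" using g1 by simp
  then have z02: "y (0, 2) = 0" using \<open>y (0, 1) = y (0, 2)\<close> by simp
  have "y (j, x) = 0" if "j < 6" "x = 1 \<or> x = 2" for j x
    using less_six_cases[OF that(1)] that(2) e12 e21 e3 e4 e5 f2 f3 f4 f5 z11 z01 z02
    by (elim disjE) simp_all
  then show ?thesis by auto
qed

section \<open>Existence of a base point\<close>

lemma alg_closed_infinite:
  assumes "alg_closed TYPE('k::field)" shows "infinite (UNIV :: 'k set)"
proof
  assume fin: "finite (UNIV :: 'k set)"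
  define p where "p = (\<Prod>x\<in>UNIV. [:- x, 1:]) + (1 :: 'k poly)"
  have "degree (\<Prod>x\<in>(UNIV :: 'k set). [:- x, 1:]) = card (UNIV :: 'k set)"
    by (subst degree_prod_eq_sum_degree) simp_all
  moreover have "card (UNIV :: 'k set) > 0" using fin by (simp add: card_gt_0_iff)
  ultimately have "degree p > 0" unfolding p_def by (subst degree_add_eq_left) simp_all
  then obtain x where "poly p x = 0" using assms unfolding alg_closed_def by blast
  moreover have "poly p x = 1" using fin by (auto simp: p_def poly_prod prod_zero_iff)
  ultimately show False by simp
qed

text \<open>Each pair of lines excludes at most one \<open>r\<close>. The result is a linear form
  \<open>x1 + r x2\<close> that misses all intersection points.\<close>

lemma exists_slope:
  fixes b c :: "nat \<Rightarrow> 'k::field"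
  assumes inf: "infinite (UNIV :: 'k set)"
    and bc: "\<And>j k. j < 6 \<Longrightarrow> k < 6 \<Longrightarrow> j \<noteq> k \<Longrightarrow> (b j, c j) \<noteq> (b k, c k)"
  shows "\<exists>r. \<forall>j<6. \<forall>k<6. j \<noteq> k \<longrightarrow> c j - c k + r * (b k - b j) \<noteq> 0"
proof -
  define T where "T = {p \<in> {..<6} \<times> {..<6::nat}. fst p \<noteq> snd p}"
  have T: "finite T" by (simp add: T_def)
  define f where "f p = [:c (fst p) - c (snd p), b (snd p) - b (fst p):]" for p
  have "f p \<noteq> 0" if "p \<in> T" for p using bc[of "fst p" "snd p"] that by (auto simp: T_def f_def)
  then have "prod f T \<noteq> 0" using T by simp
  then obtain r where "poly (prod f T) r \<noteq> 0" using poly_eq_0_cofinite[OF inf, of "{}"] by blast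
  then have r: "poly (f p) r \<noteq> 0" if "p \<in> T" for p using T that by (auto simp: poly_prod)
  have "c j - c k + r * (b k - b j) \<noteq> 0" if "j < 6" "k < 6" "j \<noteq> k" for j k
    using r[of "(j, k)"] that by (simp add: T_def f_def)
  then show ?thesis by blast
qed

lemma base_point_exists:
  assumes ac: "alg_closed TYPE('k::field)"
  shows "\<exists>lam b c (r :: 'k) K \<nu>. star_base lam b c r K \<nu>"
proof -
  note inf = alg_closed_infinite[OF ac]
  have root: "\<exists>x. poly p x = 0" if "degree p > 0" for p :: "'k poly"
    using ac that unfolding alg_closed_def by blast
  have sqrt: "\<exists>y. y\<^sup>2 = x" for x :: 'k
    using root[of "[:- x, 0, 1:]"] by (auto simp: power2_eq_square)
  have slope: "\<exists>r. \<forall>j<6. \<forall>k<6. j \<noteq> k \<longrightarrow> base_c s j - base_c s k + r * (base_b s k - base_b s j) \<noteq> 0"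
    if s: "s ^ 5 \<noteq> s" for s :: 'k
  proof (rule exists_slope[OF inf])
    fix j k :: nat assume jk: "j < 6" "k < 6" "j \<noteq> k"
    obtain i where "i < 6" "i \<noteq> j" "i \<noteq> k" using exists_third[of j k] by blast
    then have "det3 (base_line (base_lam 1) (base_b s) (base_c s) j) (base_line (base_lam 1) (base_b s) (base_c s) k)
      (base_line (base_lam 1) (base_b s) (base_c s) i) \<noteq> 0"
      using base_det[OF one_neq_zero s jk(1,2)] jk by blast
    then show "(base_b s j, base_c s j) \<noteq> (base_b s k, base_c s k)"
      by (auto simp: det3_base_line) (simp add: det3_def algebra_simps)
  qed
  show ?thesis
  proof (cases "(2 :: 'k) = 0")
    case False
    have "[:0, - 1, 0, 0, 0, 1:] \<noteq> (0 :: 'k poly)" by simp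
    then obtain s :: 'k where "poly [:0, - 1, 0, 0, 0, 1:] s \<noteq> 0"
      using poly_eq_0_cofinite[OF inf, of "{}"] by blast
    then have s: "s ^ 5 \<noteq> s" by (simp add: eval_nat_numeral algebra_simps)
    obtain r where r: "\<forall>j<6. \<forall>k<6. j \<noteq> k \<longrightarrow> base_c s j - base_c s k + r * (base_b s k - base_b s j) \<noteq> 0"
      using slope[OF s] by blast
    have "star_base (base_lam 1) (base_b s) (base_c s) r {} base_nu"
    proof
      let ?l = "base_line (base_lam 1) (base_b s) (base_c s)" and ?P = "cross (base_b s) (base_c s)"
      fix y :: "nat \<times> nat \<Rightarrow> 'k"
      assume H: "\<And>j k. j < 6 \<Longrightarrow> k < 6 \<Longrightarrow> j \<noteq> k \<Longrightarrow>
          (dot3 (dir_line {} y j) (?P j k) + dot3 (dir_line {} y k) (?P j k))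
            * (\<Prod>m\<in>{..<6} - {j, k}. dot3 (?l m) (?P j k))
          + 3 * (\<Sum>\<kappa>\<in>{}. y \<kappa> * (dot3 (base_nu \<kappa>) (?P j k))\<^sup>2)
            * E3 (\<lambda>m. dot3 (?l m) (?P j k)) = 0"
      show "\<forall>\<kappa>\<in>{..<6} \<times> {1, 2}. y \<kappa> = 0"
      proof (rule base_key_char_not_2[OF s False])
        fix j k :: nat assume jk: "j < 6" "k < 6" "j \<noteq> k"
        \<comment> \<open>\<open>K\<close> is empty here, and by general position the product of the
          other four lines cancels at the intersection point.\<close>
        have "dot3 (?l m) (?P j k) \<noteq> 0"
          if "m \<in> {..<6} - {j, k}" for m
          using base_det[OF one_neq_zero s, of m j k] jk that by (auto simp: det3_cross)
        then have "(\<Prod>m\<in>{..<6} - {j, k}. dot3 (?l m) (?P j k)) \<noteq> 0"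
          by simp
        then show "dot3 (dir_line {} y j) (?P j k) + dot3 (dir_line {} y k) (?P j k) = 0"
          using H[OF jk] by simp
      qed
    qed (use inf sqrt r base_det[OF one_neq_zero s] in auto)
    then show ?thesis by blast
  next
    case True
    \<comment> \<open>A primitive cube root of unity: \<open>s^5 = s^2 = s + 1\<close> differs from
      \<open>s\<close>, so the same general-position lemma applies.\<close>
    obtain s :: 'k where "poly [:1, 1, 1:] s = 0" using root[of "[:1, 1, 1:]"] by auto
    then have "s * s + (s + 1) = 0" by (simp add: algebra_simps)
    moreover have "(s + 1) + (s + 1) = 0" using True by (metis mult_2 mult_zero_left)
    ultimately have ss: "s * s = s + 1" by (metis add_right_cancel)
    have s3: "s * (s * s) = 1"
    proof -
      have "s * (s * s) = s * s + s" by (simp add: ss distrib_left)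
      also have "\<dots> = 2 * s + 1" by (simp add: ss)
      finally show ?thesis using True by simp
    qed
    have "s ^ 5 = s * s" using s3 by (simp add: eval_nat_numeral)
    then have s: "s ^ 5 \<noteq> s" using ss by simp
    have lam: "s + 1 \<noteq> 0" using ss s3 by (metis mult_zero_right zero_neq_one)
    obtain r where r: "\<forall>j<6. \<forall>k<6. j \<noteq> k \<longrightarrow> base_c s j - base_c s k + r * (base_b s k - base_b s j) \<noteq> 0"
      using slope[OF s] by blast
    have "star_base (base_lam (s + 1)) (base_b s) (base_c s) r base_K base_nu"
    proof
      show "base_K \<subseteq> {..<6} \<times> {1, 2}" by (simp add: base_K_def)
    qed (use inf sqrt r base_det[OF lam s] True base_key_char_2[OF ss True] in \<open>blast+\<close>)
    then show ?thesis by blast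
  qed
qed

theorem theorem3p1:
  fixes d :: nat
  assumes "alg_closed TYPE('k::field)"
    and "d \<ge> 5"
  shows "proj_dim (Mon d) (S d 6 :: (nat \<times> nat \<times> nat \<Rightarrow> 'k) set) = (d + 2 choose 2) - 4"
proof -
  obtain e where d: "d = e + 5" using assms(2) le_Suc_ex[of 5 d] by (auto simp: add.commute)
  obtain lam b c and r :: 'k and K \<nu> where "star_base lam b c r K \<nu>"
    using base_point_exists[OF assms(1)] by blast
  then interpret star_base e lam b c r K \<nu> .
  show ?thesis
    unfolding d
    by (rule proj_dim_eqI[OF S_chain_exists]) (rule S_chain_bound[OF inf])
qed

end
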